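(* Robinson arithmetic $\mathsf{Q}$ interprets the set theory $\mathsf{S}_0+\mathsf{Coll}$.
   Context: Interpretability: for first-order theories $S,T$, "$T$ interprets $S$" means that a fixed finite family of parameter-free formulas in the language of $T$ defines, in every model of $T$, a nonempty quotient structure satisfying $S$; the formulas specify the domain, an equivalence relation on that domain (serving as equality), and the interpretations of the relations and functions of $S$. Set theories are in the first-order language $\{\in\}$. $\mathsf{S}_0$ consists of Extensionality, Empty Set, Pairing, Set Difference ($x\setminus y$ exists for all $x,y$), and Union. $\mathsf{Coll}$ is the full Collection scheme: for every formula $\varphi(x,y,\bar p)$ of the language $\{\in\}$, $\forall x\in a\,\exists y\,\varphi(x,y,\bar p)\to\exists b\,\forall x\in a\,\exists y\in b\,\varphi(x,y,\bar p)$. *)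

theory Defs
  imports Main "HOL-Library.Countable_Set"
begin

section \<open>First-order logic\<close>

text \<open>A language is given by its function symbols and its relation symbols, each paired with its
  arity. Equality is a logical symbol. Variables are natural numbers.\<close>

datatype 'f tm = Var nat | Fun 'f "'f tm list"

datatype ('f, 'r) fm =
    Eq "'f tm" "'f tm"
  | Rel 'r "'f tm list"
  | Neg "('f, 'r) fm"
  | Conj "('f, 'r) fm" "('f, 'r) fm"
  | Ex nat "('f, 'r) fm"

abbreviation "Disj p q \<equiv> Neg (Conj (Neg p) (Neg q))"
abbreviation "Imp p q \<equiv> Neg (Conj p (Neg q))"
abbreviation "Iff p q \<equiv> Conj (Imp p q) (Imp q p)"
abbreviation "Forall x p \<equiv> Neg (Ex x (Neg p))"

record ('f, 'r) lang =
  funs :: "('f \<times> nat) set"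
  rels :: "('r \<times> nat) set"

fun wf_tm :: "('f, 'r) lang \<Rightarrow> 'f tm \<Rightarrow> bool" where
  "wf_tm L (Var x) = True"
| "wf_tm L (Fun f ts) = ((f, length ts) \<in> funs L \<and> (\<forall>t\<in>set ts. wf_tm L t))"

fun wf_fm :: "('f, 'r) lang \<Rightarrow> ('f, 'r) fm \<Rightarrow> bool" where
  "wf_fm L (Eq s t) = (wf_tm L s \<and> wf_tm L t)"
| "wf_fm L (Rel r ts) = ((r, length ts) \<in> rels L \<and> (\<forall>t\<in>set ts. wf_tm L t))"
| "wf_fm L (Neg p) = wf_fm L p"
| "wf_fm L (Conj p q) = (wf_fm L p \<and> wf_fm L q)"
| "wf_fm L (Ex x p) = wf_fm L p"

fun fvt :: "'f tm \<Rightarrow> nat set" where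
  "fvt (Var x) = {x}"
| "fvt (Fun f ts) = (\<Union>t\<in>set ts. fvt t)"

fun fv :: "('f, 'r) fm \<Rightarrow> nat set" where
  "fv (Eq s t) = fvt s \<union> fvt t"
| "fv (Rel r ts) = (\<Union>t\<in>set ts. fvt t)"
| "fv (Neg p) = fv p"
| "fv (Conj p q) = fv p \<union> fv q"
| "fv (Ex x p) = fv p - {x}"

record ('a, 'f, 'r) struct =
  univ :: "'a set"
  fn :: "'f \<Rightarrow> 'a list \<Rightarrow> 'a"
  rl :: "'r \<Rightarrow> 'a list \<Rightarrow> bool"

definition is_struct :: "('f, 'r) lang \<Rightarrow> ('a, 'f, 'r) struct \<Rightarrow> bool" where
  "is_struct L M \<longleftrightarrow> univ M \<noteq> {} \<and>
     (\<forall>(f, n) \<in> funs L. \<forall>as. set as \<subseteq> univ M \<and> length as = n \<longrightarrow> fn M f as \<in> univ M)"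

fun val :: "('a, 'f, 'r) struct \<Rightarrow> (nat \<Rightarrow> 'a) \<Rightarrow> 'f tm \<Rightarrow> 'a" where
  "val M e (Var x) = e x"
| "val M e (Fun f ts) = fn M f (map (val M e) ts)"

fun sat :: "('a, 'f, 'r) struct \<Rightarrow> (nat \<Rightarrow> 'a) \<Rightarrow> ('f, 'r) fm \<Rightarrow> bool" where
  "sat M e (Eq s t) \<longleftrightarrow> val M e s = val M e t"
| "sat M e (Rel r ts) \<longleftrightarrow> rl M r (map (val M e) ts)"
| "sat M e (Neg p) \<longleftrightarrow> \<not> sat M e p"
| "sat M e (Conj p q) \<longleftrightarrow> sat M e p \<and> sat M e q"
| "sat M e (Ex x p) \<longleftrightarrow> (\<exists>a\<in>univ M. sat M (e(x := a)) p)"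

text \<open>A theory is a set of formulas; a formula with free variables stands for its universal
  closure.\<close>

definition is_model :: "('f, 'r) lang \<Rightarrow> ('f, 'r) fm set \<Rightarrow> ('a, 'f, 'r) struct \<Rightarrow> bool" where
  "is_model L T M \<longleftrightarrow> is_struct L M \<and>
     (\<forall>p\<in>T. \<forall>e. range e \<subseteq> univ M \<longrightarrow> sat M e p)"


section \<open>Interpretations\<close>

text \<open>A (one-dimensional, parameter-free) interpretation of the language \<open>K\<close> (symbols \<open>'g\<close>, \<open>'s\<close>)
  in the language \<open>L\<close> (symbols \<open>'f\<close>, \<open>'r\<close>) is a family of formulas of \<open>L\<close>: one for the domain,
  one for equality, one for each relation symbol of \<open>K\<close>, and one for the graph of each function
  symbol of \<open>K\<close>. The arguments are the variables \<open>0, 1, \<dots>\<close>; in the graph of an \<open>n\<close>-ary function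
  the variable \<open>n\<close> is the value.\<close>

record ('f, 'r, 'g, 's) interp =
  i_dom :: "('f, 'r) fm"
  i_eq :: "('f, 'r) fm"
  i_rel :: "'s \<times> nat \<Rightarrow> ('f, 'r) fm"
  i_fun :: "'g \<times> nat \<Rightarrow> ('f, 'r) fm"

definition wf_interp ::
  "('f, 'r) lang \<Rightarrow> ('g, 's) lang \<Rightarrow> ('f, 'r, 'g, 's) interp \<Rightarrow> bool" where
  "wf_interp L K I \<longleftrightarrow>
     wf_fm L (i_dom I) \<and> fv (i_dom I) \<subseteq> {..<1} \<and>
     wf_fm L (i_eq I) \<and> fv (i_eq I) \<subseteq> {..<2} \<and>
     (\<forall>(r, n) \<in> rels K. wf_fm L (i_rel I (r, n)) \<and> fv (i_rel I (r, n)) \<subseteq> {..<n}) \<and>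
     (\<forall>(f, n) \<in> funs K. wf_fm L (i_fun I (f, n)) \<and> fv (i_fun I (f, n)) \<subseteq> {..<Suc n})"

text \<open>\<open>holds M p as\<close>: the tuple \<open>as\<close> satisfies \<open>p\<close>, for \<open>p\<close> with free variables below
  \<open>length as\<close>.\<close>

definition holds :: "('a, 'f, 'r) struct \<Rightarrow> ('f, 'r) fm \<Rightarrow> 'a list \<Rightarrow> bool" where
  "holds M p as \<longleftrightarrow> sat M (\<lambda>i. as ! i) p"

definition int_dom :: "('a, 'f, 'r) struct \<Rightarrow> ('f, 'r, 'g, 's) interp \<Rightarrow> 'a set" where
  "int_dom M I = {a \<in> univ M. holds M (i_dom I) [a]}"

definition int_eq :: "('a, 'f, 'r) struct \<Rightarrow> ('f, 'r, 'g, 's) interp \<Rightarrow> ('a \<times> 'a) set" where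
  "int_eq M I = {(a, b). a \<in> int_dom M I \<and> b \<in> int_dom M I \<and> holds M (i_eq I) [a, b]}"

text \<open>The formulas define a nonempty quotient structure in \<open>M\<close>: \<open>int_eq\<close> is an equivalence
  relation on the nonempty \<open>int_dom\<close>, all relations and graphs are invariant under it, and each
  graph is that of a total function modulo \<open>int_eq\<close>.\<close>

definition defines_quotient ::
  "('g, 's) lang \<Rightarrow> ('a, 'f, 'r) struct \<Rightarrow> ('f, 'r, 'g, 's) interp \<Rightarrow> bool" where
  "defines_quotient K M I \<longleftrightarrow>
     int_dom M I \<noteq> {} \<and> equiv (int_dom M I) (int_eq M I) \<and>
     (\<forall>(r, n) \<in> rels K. \<forall>as bs.
        length as = n \<and> list_all2 (\<lambda>a b. (a, b) \<in> int_eq M I) as bs \<longrightarrow>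
        (holds M (i_rel I (r, n)) as \<longleftrightarrow> holds M (i_rel I (r, n)) bs)) \<and>
     (\<forall>(f, n) \<in> funs K.
        (\<forall>as bs. length as = Suc n \<and> list_all2 (\<lambda>a b. (a, b) \<in> int_eq M I) as bs \<longrightarrow>
           (holds M (i_fun I (f, n)) as \<longleftrightarrow> holds M (i_fun I (f, n)) bs)) \<and>
        (\<forall>as. length as = n \<and> set as \<subseteq> int_dom M I \<longrightarrow>
           (\<exists>b \<in> int_dom M I. holds M (i_fun I (f, n)) (as @ [b])) \<and>
           (\<forall>b \<in> int_dom M I. \<forall>c \<in> int_dom M I.
              holds M (i_fun I (f, n)) (as @ [b]) \<and> holds M (i_fun I (f, n)) (as @ [c]) \<longrightarrow>
              (b, c) \<in> int_eq M I)))"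

definition quot_struct ::
  "('a, 'f, 'r) struct \<Rightarrow> ('f, 'r, 'g, 's) interp \<Rightarrow> ('a set, 'g, 's) struct" where
  "quot_struct M I =
     \<lparr> univ = int_dom M I // int_eq M I,
       fn = (\<lambda>f Xs. THE Y. Y \<in> int_dom M I // int_eq M I \<and>
               (\<exists>as. \<exists>b\<in>Y. list_all2 (\<in>) as Xs \<and> holds M (i_fun I (f, length Xs)) (as @ [b]))),
       rl = (\<lambda>r Xs. \<exists>as. list_all2 (\<in>) as Xs \<and> holds M (i_rel I (r, length Xs)) as) \<rparr>"

text \<open>The formulas of \<open>I\<close> define a model of the \<open>K\<close>-theory \<open>S\<close> in every model of the
  \<open>L\<close>-theory \<open>T\<close> whose universe is a subset of the type \<open>'a\<close>.\<close>

definition is_interpretation ::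
  "'a itself \<Rightarrow> ('f, 'r) lang \<Rightarrow> ('f, 'r) fm set \<Rightarrow> ('g, 's) lang \<Rightarrow> ('g, 's) fm set \<Rightarrow>
   ('f, 'r, 'g, 's) interp \<Rightarrow> bool" where
  "is_interpretation _ L T K S I \<longleftrightarrow> wf_interp L K I \<and>
     (\<forall>M :: ('a, 'f, 'r) struct. is_model L T M \<longrightarrow>
        defines_quotient K M I \<and> is_model K S (quot_struct M I))"

text \<open>\<open>T\<close> interprets \<open>S\<close>. HOL cannot quantify over types inside the formula, so the type \<open>'a\<close>
  of the universes of the models is a parameter. This does not let the interpretation depend on
  \<open>'a\<close> in an essential way: by the theorem \<open>is_interpretation_transfer\<close> below (a form of the
  downward Loewenheim-Skolem theorem), for countable languages an interpretation that works for
  \<open>'a = nat\<close> works for every type.\<close>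

definition interprets ::
  "'a itself \<Rightarrow> ('f, 'r) lang \<Rightarrow> ('f, 'r) fm set \<Rightarrow> ('g, 's) lang \<Rightarrow> ('g, 's) fm set \<Rightarrow> bool" where
  "interprets A L T K S \<longleftrightarrow> (\<exists>I. is_interpretation A L T K S I)"


section \<open>Robinson arithmetic\<close>

datatype arith_sym = ZeroS | SuccS | PlusS | TimesS

text \<open>There are no relation symbols; the type \<open>unit\<close> is a dummy.\<close>

definition lang_arith :: "(arith_sym, unit) lang" where
  "lang_arith = \<lparr> funs = {(ZeroS, 0), (SuccS, 1), (PlusS, 2), (TimesS, 2)}, rels = {} \<rparr>"

abbreviation "ZeroT \<equiv> Fun ZeroS []"
abbreviation "SuccT s \<equiv> Fun SuccS [s]"
abbreviation "PlusT s t \<equiv> Fun PlusS [s, t]"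
abbreviation "TimesT s t \<equiv> Fun TimesS [s, t]"

definition Robinson_Q :: "(arith_sym, unit) fm set" where
  "Robinson_Q = {Neg (Eq (SuccT (Var 0)) ZeroT),
        Imp (Eq (SuccT (Var 0)) (SuccT (Var 1))) (Eq (Var 0) (Var 1)),
        Imp (Neg (Eq (Var 0) ZeroT)) (Ex 1 (Eq (Var 0) (SuccT (Var 1)))),
        Eq (PlusT (Var 0) ZeroT) (Var 0),
        Eq (PlusT (Var 0) (SuccT (Var 1))) (SuccT (PlusT (Var 0) (Var 1))),
        Eq (TimesT (Var 0) ZeroT) ZeroT,
        Eq (TimesT (Var 0) (SuccT (Var 1))) (PlusT (TimesT (Var 0) (Var 1)) (Var 0))}"


section \<open>The set theory\<close>

datatype set_sym = MemS

text \<open>There are no function symbols; the type \<open>unit\<close> is a dummy.\<close>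

definition lang_set :: "(unit, set_sym) lang" where
  "lang_set = \<lparr> funs = {}, rels = {(MemS, 2)} \<rparr>"

type_synonym set_fm = "(unit, set_sym) fm"

abbreviation Mem :: "nat \<Rightarrow> nat \<Rightarrow> set_fm" where
  "Mem x y \<equiv> Rel MemS [Var x, Var y]"

definition extensionality_ax :: set_fm where
  "extensionality_ax = Imp (Forall 2 (Iff (Mem 2 0) (Mem 2 1))) (Eq (Var 0) (Var 1))"

definition empty_set_ax :: set_fm where
  "empty_set_ax = Ex 0 (Forall 1 (Neg (Mem 1 0)))"

definition pairing_ax :: set_fm where
  "pairing_ax = Ex 2 (Forall 3 (Iff (Mem 3 2) (Disj (Eq (Var 3) (Var 0)) (Eq (Var 3) (Var 1)))))"

definition set_difference_ax :: set_fm where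
  "set_difference_ax = Ex 2 (Forall 3 (Iff (Mem 3 2) (Conj (Mem 3 0) (Neg (Mem 3 1)))))"

definition union_ax :: set_fm where
  "union_ax = Ex 1 (Forall 2 (Iff (Mem 2 1) (Ex 3 (Conj (Mem 3 0) (Mem 2 3)))))"

definition S0 :: "set_fm set" where
  "S0 = {extensionality_ax, empty_set_ax, pairing_ax, set_difference_ax, union_ax}"

text \<open>The parameters of the instance are the remaining free variables of \<open>p\<close>; the set \<open>a\<close> may be
  one of them, but the new bound variable \<open>b\<close> must not be captured.\<close>

definition collection_ax :: "set_fm \<Rightarrow> nat \<Rightarrow> nat \<Rightarrow> nat \<Rightarrow> nat \<Rightarrow> set_fm" where
  "collection_ax p x y a b =
     Imp (Forall x (Imp (Mem x a) (Ex y p)))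
         (Ex b (Forall x (Imp (Mem x a) (Ex y (Conj (Mem y b) p)))))"

definition Coll :: "set_fm set" where
  "Coll = {collection_ax p x y a b | p x y a b.
             wf_fm lang_set p \<and> distinct [x, y, a, b] \<and> b \<notin> fv p}"


section \<open>Interpretations do not depend on the universe type\<close>

text \<open>If an interpretation works for all models with universe in \<open>nat\<close>, then it works for all
  models. Given a model \<open>M\<close>, a countable elementary submodel \<open>N\<close> is chosen such that the quotient
  structure of \<open>N\<close> is also elementary in the quotient structure of \<open>M\<close>.\<close>

instance tm :: (countable) countable by countable_datatype
instance fm :: (countable, countable) countable by countable_datatype

datatype 'i sk = Cst nat | Node 'i "'i sk list"

instance sk :: (countable) countable by countable_datatype

fun sk_val :: "(nat \<Rightarrow> 'a) \<Rightarrow> ('i \<Rightarrow> 'a list \<Rightarrow> 'a) \<Rightarrow> 'i sk \<Rightarrow> 'a" where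
  "sk_val c F (Cst n) = c n"
| "sk_val c F (Node i ts) = F i (map (sk_val c F) ts)"

lemma val_cong: "(\<And>i. i \<in> fvt t \<Longrightarrow> e i = e' i) \<Longrightarrow> val M e t = val M e' t"
proof (induction t)
  case (Fun f ts)
  then have "map (val M e) ts = map (val M e') ts" by (auto intro!: map_cong)
  then show ?case by (metis val.simps(2))
qed auto

lemma sat_cong: "(\<And>i. i \<in> fv p \<Longrightarrow> e i = e' i) \<Longrightarrow> sat M e p = sat M e' p"
proof (induction p arbitrary: e e')
  case (Eq s t)
  then show ?case using val_cong[of s e e' M] val_cong[of t e e' M] by auto
next
  case (Rel r ts)
  then have "map (val M e) ts = map (val M e') ts" by (auto intro!: map_cong val_cong)
  then show ?case by (metis sat.simps(2))
next
  case (Neg p)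
  then show ?case by (metis fv.simps(3) sat.simps(3))
next
  case (Conj p q)
  then show ?case by (metis Un_iff fv.simps(4) sat.simps(4))
next
  case (Ex x p)
  have "sat M (e(x := a)) p = sat M (e'(x := a)) p" for a
    by (rule Ex.IH) (use Ex.prems in auto)
  then show ?case by simp
qed

lemma finite_fvt: "finite (fvt t)"
  by (induction t) auto

lemma finite_fv: "finite (fv p)"
  by (induction p) (auto simp: finite_fvt)

lemma countable_hull:
  fixes P :: "'i::countable \<Rightarrow> 'a list \<Rightarrow> 'a \<Rightarrow> bool" and c :: "nat \<Rightarrow> 'a"
  assumes "range c \<subseteq> X"
  obtains N where "countable N" "range c \<subseteq> N" "N \<subseteq> X"
    "\<And>i as. set as \<subseteq> N \<Longrightarrow> \<exists>a\<in>X. P i as a \<Longrightarrow> \<exists>a\<in>N. P i as a"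
proof -
  define F where "F i as = (if \<exists>a\<in>X. P i as a then SOME a. a \<in> X \<and> P i as a else c 0)" for i as
  have F: "F i as \<in> X \<and> P i as (F i as)" if "\<exists>a\<in>X. P i as a" for i as
    using that someI_ex[of "\<lambda>a. a \<in> X \<and> P i as a"] by (auto simp: F_def)
  have FX: "F i as \<in> X" for i as
    using F[of i as] assms by (cases "\<exists>a\<in>X. P i as a") (auto simp: F_def)
  let ?N = "range (sk_val c F)"
  show thesis
  proof
    show "countable ?N" by simp
    show "range c \<subseteq> ?N" by (metis image_subset_iff rangeI sk_val.simps(1))
    have "sk_val c F t \<in> X" for t
      by (cases t) (use assms FX in auto)
    then show "?N \<subseteq> X" by auto
    fix i as assume "set as \<subseteq> ?N" and ex: "\<exists>a\<in>X. P i as a"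
    then obtain ts where ts: "as = map (sk_val c F) ts"
      by (metis ex_map_conv image_iff subsetD)
    have "sk_val c F (Node i ts) = F i as" by (simp add: ts)
    then show "\<exists>a\<in>?N. P i as a" using F[OF ex] by (metis rangeI)
  qed
qed

definition emb :: "('f, 'r) lang \<Rightarrow> ('b, 'f, 'r) struct \<Rightarrow> ('a, 'f, 'r) struct \<Rightarrow> ('b \<Rightarrow> 'a) \<Rightarrow> bool"
  where "emb L N M h \<longleftrightarrow> is_struct L N \<and> h ` univ N \<subseteq> univ M \<and>
     (\<forall>p e. wf_fm L p \<and> (\<forall>i\<in>fv p. e i \<in> univ N) \<longrightarrow> sat N e p = sat M (\<lambda>i. h (e i)) p)"

lemma countable_emb:
  fixes M :: "('a, 'f::countable, 'r::countable) struct"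
    and P :: "'i::countable \<Rightarrow> 'a list \<Rightarrow> 'a \<Rightarrow> bool"
    and c :: "nat \<Rightarrow> 'a"
  assumes M: "is_struct L M" and c: "range c \<subseteq> univ M"
  obtains N :: "(nat, 'f, 'r) struct" and h where
    "emb L N M h" "range c \<subseteq> h ` univ N"
    "\<And>i as. set as \<subseteq> h ` univ N \<Longrightarrow> \<exists>a\<in>univ M. P i as a \<Longrightarrow> \<exists>a\<in>h ` univ N. P i as a"
proof -
  define R :: "('f, 'r) fm \<times> nat + 'i \<Rightarrow> 'a list \<Rightarrow> 'a \<Rightarrow> bool" where
    "R j as a = (case j of Inl (p, x) \<Rightarrow> sat M ((\<lambda>i. as ! i)(x := a)) p | Inr i \<Rightarrow> P i as a)" for j as a
  obtain X where X: "countable X" "range c \<subseteq> X" "X \<subseteq> univ M"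
    and R: "\<And>j as. set as \<subseteq> X \<Longrightarrow> \<exists>a\<in>univ M. R j as a \<Longrightarrow> \<exists>a\<in>X. R j as a"
    using countable_hull[OF c, of R] by blast
  have TV: "\<exists>a\<in>X. sat M (e(x := a)) p"
    if e: "\<And>i. i \<in> fv p - {x} \<Longrightarrow> e i \<in> X" and a: "a \<in> univ M" "sat M (e(x := a)) p" for p x e a
  proof -
    obtain m where m: "fv p \<subseteq> {..<m}" using finite_fv[of p] by (metis finite_nat_iff_bounded)
    define as where "as = map (\<lambda>i. if i \<in> fv p - {x} then e i else c 0) [0..<m]"
    have as: "set as \<subseteq> X" using e X by (auto simp: as_def)
    have eq: "sat M ((\<lambda>i. as ! i)(x := b)) p = sat M (e(x := b)) p" for b
      by (rule sat_cong) (use m in \<open>auto simp: as_def\<close>)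
    show ?thesis using R[OF as, of "Inl (p, x)"] a by (auto simp: R_def eq)
  qed
  have cl: "fn M f as \<in> X" if f: "(f, n) \<in> funs L" and as: "set as \<subseteq> X" "length as = n" for f n as
  proof -
    let ?p = "Eq (Var n) (Fun f (map Var [0..<n])) :: ('f, 'r) fm"
    have v: "val M ((\<lambda>i. as ! i)(n := b)) (Fun f (map Var [0..<n])) = fn M f as" for b
    proof -
      have "map (val M ((\<lambda>i. as ! i)(n := b))) (map Var [0..<n]) = as"
        using as by (auto simp: list_eq_iff_nth_eq)
      then show ?thesis by (metis val.simps(2))
    qed
    have "fn M f as \<in> univ M" using M f as X unfolding is_struct_def by blast
    moreover have "sat M ((\<lambda>i. as ! i)(n := fn M f as)) ?p" by (simp only: sat.simps v) simp
    ultimately obtain b where "b \<in> X" "sat M ((\<lambda>i. as ! i)(n := b)) ?p"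
      using TV[of ?p n "\<lambda>i. as ! i"] as by fastforce
    then show ?thesis by (simp only: sat.simps v) simp
  qed
  define g where "g = to_nat_on X"
  define h where "h = inv_into X g"
  have g: "inj_on g X" using X by (simp add: g_def inj_on_to_nat_on)
  have hg: "h (g a) = a" if "a \<in> X" for a using that g by (simp add: h_def)
  define N :: "(nat, 'f, 'r) struct" where
    "N = \<lparr> univ = g ` X, fn = (\<lambda>f as. g (fn M f (map h as))), rl = (\<lambda>r as. rl M r (map h as)) \<rparr>"
  have hN: "h ` univ N = X" using hg by (force simp: N_def)
  have cl': "fn N f as \<in> univ N \<and> h (fn N f as) = fn M f (map h as)"
    if "(f, length as) \<in> funs L" "set as \<subseteq> univ N" for f as
  proof -
    have "set (map h as) \<subseteq> X" using that hN by auto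
    then have "fn M f (map h as) \<in> X" using cl[OF that(1), of "map h as"] by auto
    then show ?thesis by (auto simp: N_def hg)
  qed
  have vN: "val N e t \<in> univ N \<and> h (val N e t) = val M (\<lambda>i. h (e i)) t"
    if "wf_tm L t" "\<forall>i\<in>fvt t. e i \<in> univ N" for e t
    using that
  proof (induction t)
    case (Fun f ts)
    then have IH: "\<And>t. t \<in> set ts \<Longrightarrow> val N e t \<in> univ N \<and> h (val N e t) = val M (\<lambda>i. h (e i)) t"
      by auto
    have "map h (map (val N e) ts) = map (val M (\<lambda>i. h (e i))) ts" using IH by simp
    then show ?case using cl'[of f "map (val N e) ts"] Fun.prems IH
      by (auto simp: image_subset_iff simp del: map_map)
  qed simp
  have inj: "inj_on h (univ N)" by (auto simp: inj_on_def N_def hg)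
  have sN: "sat N e p = sat M (\<lambda>i. h (e i)) p"
    if "wf_fm L p" "\<forall>i\<in>fv p. e i \<in> univ N" for e p
    using that
  proof (induction p arbitrary: e)
    case (Eq s t)
    have s: "val N e s \<in> univ N \<and> h (val N e s) = val M (\<lambda>i. h (e i)) s"
      by (rule vN) (use Eq in auto)
    have t: "val N e t \<in> univ N \<and> h (val N e t) = val M (\<lambda>i. h (e i)) t"
      by (rule vN) (use Eq in auto)
    show ?case using s t inj_on_eq_iff[OF inj, of "val N e s" "val N e t"] by simp
  next
    case (Rel r ts)
    have "h (val N e t) = val M (\<lambda>i. h (e i)) t" if "t \<in> set ts" for t
      using vN[of t e] Rel.prems that by auto
    then have "map h (map (val N e) ts) = map (val M (\<lambda>i. h (e i))) ts" by simp
    moreover have "rl N r as = rl M r (map h as)" for as by (simp add: N_def)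
    ultimately show ?case by (simp only: sat.simps)
  next
    case (Ex x p)
    have IH: "sat N (e(x := b)) p = sat M ((\<lambda>i. h (e i))(x := h b)) p" if "b \<in> univ N" for b
    proof -
      have "sat N (e(x := b)) p = sat M (\<lambda>i. h ((e(x := b)) i)) p"
        by (rule Ex.IH) (use Ex.prems that in auto)
      moreover have "(\<lambda>i. h ((e(x := b)) i)) = (\<lambda>i. h (e i))(x := h b)" by auto
      ultimately show ?thesis by simp
    qed
    have "(\<exists>a\<in>univ M. sat M ((\<lambda>i. h (e i))(x := a)) p) \<longleftrightarrow> (\<exists>a\<in>X. sat M ((\<lambda>i. h (e i))(x := a)) p)"
      using TV[of p x "\<lambda>i. h (e i)"] Ex.prems X(3) hN by auto
    also have "\<dots> \<longleftrightarrow> (\<exists>b\<in>univ N. sat M ((\<lambda>i. h (e i))(x := h b)) p)" using hN by auto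
    finally show ?case using IH by auto
  qed auto
  show thesis
  proof (rule that)
    have "X \<noteq> {}" using X(2) by auto
    then have "is_struct L N" unfolding is_struct_def using cl' by (auto simp: N_def)
    then show "emb L N M h" unfolding emb_def using sN hN X(3) by auto
    show "range c \<subseteq> h ` univ N" using X hN by simp
    fix i as assume "set as \<subseteq> h ` univ N" "\<exists>a\<in>univ M. P i as a"
    then show "\<exists>a\<in>h ` univ N. P i as a" using R[of as "Inr i"] hN by (simp add: R_def)
  qed
qed

lemma emb_sat:
  "emb L N M h \<Longrightarrow> wf_fm L p \<Longrightarrow> (\<And>i. i \<in> fv p \<Longrightarrow> e i \<in> univ N) \<Longrightarrow>
    sat N e p = sat M (\<lambda>i. h (e i)) p"
  by (simp add: emb_def)

lemma emb_univ: "emb L N M h \<Longrightarrow> a \<in> univ N \<Longrightarrow> h a \<in> univ M"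
  by (auto simp: emb_def)

lemma emb_holds:
  assumes "emb L N M h" "wf_fm L p" "fv p \<subseteq> {..<length as}" "set as \<subseteq> univ N"
  shows "holds N p as \<longleftrightarrow> holds M p (map h as)"
proof -
  have "sat N (\<lambda>i. as ! i) p = sat M (\<lambda>i. h (as ! i)) p"
    using assms(3,4) nth_mem by (intro emb_sat[OF assms(1,2)]) fastforce
  also have "\<dots> = sat M (\<lambda>i. map h as ! i) p"
    by (rule sat_cong) (use assms in auto)
  finally show ?thesis by (simp add: holds_def)
qed

lemma emb_int_dom:
  assumes "emb L N M h" "wf_interp L K I" "a \<in> univ N"
  shows "a \<in> int_dom N I \<longleftrightarrow> h a \<in> int_dom M I"
  using assms emb_holds[OF assms(1), of "i_dom I" "[a]"] emb_univ[OF assms(1)]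
  by (auto simp: int_dom_def wf_interp_def)

lemma emb_int_eq:
  assumes "emb L N M h" "wf_interp L K I" "a \<in> univ N" "b \<in> univ N"
  shows "(a, b) \<in> int_eq N I \<longleftrightarrow> (h a, h b) \<in> int_eq M I"
  using assms emb_holds[OF assms(1), of "i_eq I" "[a, b]"] emb_int_dom[OF assms(1,2)]
  by (auto simp: int_eq_def wf_interp_def numeral_2_eq_2)

lemma emb_model:
  assumes "emb L N M h" "is_model L T M" "\<And>p. p \<in> T \<Longrightarrow> wf_fm L p"
  shows "is_model L T N"
  unfolding is_model_def
proof (intro conjI ballI allI impI)
  show "is_struct L N" using assms by (simp add: emb_def)
  fix p and e :: "nat \<Rightarrow> _" assume p: "p \<in> T" and e: "range e \<subseteq> univ N"
  have "sat N e p = sat M (\<lambda>i. h (e i)) p" by (rule emb_sat[OF assms(1) assms(3)[OF p]]) (use e in auto)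
  moreover have "range (\<lambda>i. h (e i)) \<subseteq> univ M" using emb_univ[OF assms(1)] e by auto
  ultimately show "sat N e p" using assms(2) p by (simp add: is_model_def)
qed

lemma int_dom_univ: "int_dom M I \<subseteq> univ M"
  by (auto simp: int_dom_def)

lemma int_eq_dom: "(a, b) \<in> int_eq M I \<Longrightarrow> a \<in> int_dom M I \<and> b \<in> int_dom M I"
  by (auto simp: int_eq_def)

lemma list_all2_int_eq_dom:
  "list_all2 (\<lambda>a b. (a, b) \<in> int_eq M I) as bs \<Longrightarrow> set as \<subseteq> int_dom M I \<and> set bs \<subseteq> int_dom M I"
  by (induction rule: list_all2_induct) (auto dest: int_eq_dom)

context
  fixes K :: "('g, 's) lang" and M :: "('a, 'f, 'r) struct" and I :: "('f, 'r, 'g, 's) interp"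
  assumes dq: "defines_quotient K M I"
begin

lemmas dq_unfolded = dq[unfolded defines_quotient_def]
lemmas dq_fun_unfolded = dq_unfolded[THEN conjunct2, THEN conjunct2, THEN conjunct2,
  THEN bspec, where x = "(f, n)", unfolded prod.case] for f n

lemma dq_ne: "int_dom M I \<noteq> {}"
  by (rule dq_unfolded[THEN conjunct1])

lemma dq_equiv: "equiv (int_dom M I) (int_eq M I)"
  by (rule dq_unfolded[THEN conjunct2, THEN conjunct1])

lemma dq_rel:
  "(r, n) \<in> rels K \<Longrightarrow> length as = n \<Longrightarrow> list_all2 (\<lambda>a b. (a, b) \<in> int_eq M I) as bs \<Longrightarrow>
    holds M (i_rel I (r, n)) as \<longleftrightarrow> holds M (i_rel I (r, n)) bs"
  by (rule dq_unfolded[THEN conjunct2, THEN conjunct2, THEN conjunct1,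
    THEN bspec, where x = "(r, n)", unfolded prod.case, rule_format]) auto

lemma dq_graph:
  "(f, n) \<in> funs K \<Longrightarrow> length as = Suc n \<Longrightarrow> list_all2 (\<lambda>a b. (a, b) \<in> int_eq M I) as bs \<Longrightarrow>
    holds M (i_fun I (f, n)) as \<longleftrightarrow> holds M (i_fun I (f, n)) bs"
  by (rule dq_fun_unfolded[THEN conjunct1, rule_format]) auto

lemma dq_total:
  "(f, n) \<in> funs K \<Longrightarrow> length as = n \<Longrightarrow> set as \<subseteq> int_dom M I \<Longrightarrow>
    \<exists>b \<in> int_dom M I. holds M (i_fun I (f, n)) (as @ [b])"
  by (rule dq_fun_unfolded[THEN conjunct2, THEN spec, THEN mp, THEN conjunct1]) auto

lemma dq_unique:
  "(f, n) \<in> funs K \<Longrightarrow> length as = n \<Longrightarrow> set as \<subseteq> int_dom M I \<Longrightarrow>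
    b \<in> int_dom M I \<Longrightarrow> c \<in> int_dom M I \<Longrightarrow> holds M (i_fun I (f, n)) (as @ [b]) \<Longrightarrow>
    holds M (i_fun I (f, n)) (as @ [c]) \<Longrightarrow> (b, c) \<in> int_eq M I"
  by (rule dq_fun_unfolded[THEN conjunct2, THEN spec, THEN mp, THEN conjunct2, rule_format]) auto

end

lemma dq_refl: "defines_quotient K M I \<Longrightarrow> a \<in> int_dom M I \<Longrightarrow> (a, a) \<in> int_eq M I"
  by (meson dq_equiv equiv_def refl_onD)

lemma dq_sym: "defines_quotient K M I \<Longrightarrow> (a, b) \<in> int_eq M I \<Longrightarrow> (b, a) \<in> int_eq M I"
  by (meson dq_equiv equiv_def symD)

lemma dq_trans:
  "defines_quotient K M I \<Longrightarrow> (a, b) \<in> int_eq M I \<Longrightarrow> (b, c) \<in> int_eq M I \<Longrightarrow> (a, c) \<in> int_eq M I"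
  by (meson dq_equiv equiv_def transD)

lemma defines_quotient_transfer:
  assumes I: "wf_interp L K I" and ne: "univ M \<noteq> {}"
    and ex: "\<And>zs. set zs \<subseteq> univ M \<Longrightarrow>
      \<exists>(N :: ('b, 'f, 'r) struct) h. emb L N M h \<and> set zs \<subseteq> h ` univ N \<and> defines_quotient K N I"
  shows "defines_quotient K (M :: ('a, 'f, 'r) struct) I"
proof -
  have lift: "\<exists>as'. as = map h as' \<and> set as' \<subseteq> univ N" if "set as \<subseteq> h ` univ N"
    for as :: "'a list" and N :: "('b, 'f, 'r) struct" and h
    using that by (induction as) (auto, metis insert_subset list.simps(15) list.simps(9))
  have ne: "int_dom M I \<noteq> {}"
  proof -
    obtain N :: "('b, 'f, 'r) struct" and h where N: "emb L N M h" "defines_quotient K N I"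
      using ex[of "[]"] by auto
    then obtain a where "a \<in> int_dom N I" using dq_ne by blast
    then show ?thesis using emb_int_dom[OF N(1) I, of a] int_dom_univ[of N I] by auto
  qed
  have all2: "list_all2 (\<lambda>a b. (a, b) \<in> int_eq N I) as bs"
    if "emb L N M h" "set as \<subseteq> univ N" "set bs \<subseteq> univ N"
      "list_all2 (\<lambda>a b. (a, b) \<in> int_eq M I) (map h as) (map h bs)"
    for N :: "('b, 'f, 'r) struct" and h as bs
    using that emb_int_eq[OF that(1) I] unfolding list_all2_conv_all_nth
    by (auto simp: subset_iff)
  have eqv: "equiv (int_dom M I) (int_eq M I)"
  proof (rule equivI)
    show "refl_on (int_dom M I) (int_eq M I)"
    proof (rule refl_onI)
      fix a assume a: "a \<in> int_dom M I"
      obtain N :: "('b, 'f, 'r) struct" and h where N: "emb L N M h" "a \<in> h ` univ N" "defines_quotient K N I"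
        using ex[of "[a]"] a int_dom_univ[of M I] by auto
      then obtain b where b: "a = h b" "b \<in> univ N" by auto
      have "b \<in> int_dom N I" using emb_int_dom[OF N(1) I b(2)] a b by simp
      then have "(b, b) \<in> int_eq N I" using dq_refl[OF N(3)] by simp
      then show "(a, a) \<in> int_eq M I" using emb_int_eq[OF N(1) I b(2) b(2)] b by simp
    qed
    show "sym (int_eq M I)"
    proof (rule symI)
      fix a b assume ab: "(a, b) \<in> int_eq M I"
      then have "set [a, b] \<subseteq> univ M" using int_eq_dom[OF ab] int_dom_univ[of M I] by auto
      from ex[OF this] lift obtain N :: "('b, 'f, 'r) struct" and h where
        N: "emb L N M h" "{a, b} \<subseteq> h ` univ N" "defines_quotient K N I" by auto
      then obtain a' b' where b: "a = h a'" "b = h b'" "a' \<in> univ N" "b' \<in> univ N" by auto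
      have "(a', b') \<in> int_eq N I" using emb_int_eq[OF N(1) I b(3,4)] ab b by simp
      then have "(b', a') \<in> int_eq N I" using dq_sym[OF N(3)] by simp
      then show "(b, a) \<in> int_eq M I" using emb_int_eq[OF N(1) I b(4,3)] b by simp
    qed
    show "trans (int_eq M I)"
    proof (rule transI)
      fix a b c assume ab: "(a, b) \<in> int_eq M I" and bc: "(b, c) \<in> int_eq M I"
      then have "set [a, b, c] \<subseteq> univ M"
        using int_eq_dom[OF ab] int_eq_dom[OF bc] int_dom_univ[of M I] by auto
      from ex[OF this] obtain N :: "('b, 'f, 'r) struct" and h where
        N: "emb L N M h" "{a, b, c} \<subseteq> h ` univ N" "defines_quotient K N I" by auto
      then obtain a' b' c' where b: "a = h a'" "b = h b'" "c = h c'"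
        "a' \<in> univ N" "b' \<in> univ N" "c' \<in> univ N" by auto
      have "(a', b') \<in> int_eq N I" "(b', c') \<in> int_eq N I"
        using emb_int_eq[OF N(1) I] ab bc b by auto
      then have "(a', c') \<in> int_eq N I" using dq_trans[OF N(3)] by blast
      then show "(a, c) \<in> int_eq M I" using emb_int_eq[OF N(1) I b(4,6)] b by simp
    qed
    show "int_eq M I \<subseteq> int_dom M I \<times> int_dom M I" by (auto simp: int_eq_def)
  qed
  have inv: "holds M p as \<longleftrightarrow> holds M p bs"
    if p: "wf_fm L p" "fv p \<subseteq> {..<length as}"
      and ab: "list_all2 (\<lambda>a b. (a, b) \<in> int_eq M I) as bs"
      and NN: "\<And>(N :: ('b, 'f, 'r) struct) cs ds. defines_quotient K N I \<Longrightarrow> length cs = length as \<Longrightarrow>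
        list_all2 (\<lambda>a b. (a, b) \<in> int_eq N I) cs ds \<Longrightarrow> holds N p cs \<longleftrightarrow> holds N p ds"
    for p as bs
  proof -
    have "set (as @ bs) \<subseteq> univ M"
      using list_all2_int_eq_dom[OF ab] int_dom_univ[of M I] by auto
    from ex[OF this] obtain N :: "('b, 'f, 'r) struct" and h where
      N: "emb L N M h" "set as \<subseteq> h ` univ N" "set bs \<subseteq> h ` univ N" "defines_quotient K N I" by auto
    obtain cs ds where cd: "as = map h cs" "bs = map h ds" "set cs \<subseteq> univ N" "set ds \<subseteq> univ N"
      using lift N by metis
    have l: "length ds = length as" using list_all2_lengthD[OF ab] cd by simp
    have "holds N p cs \<longleftrightarrow> holds N p ds"
      using NN[OF N(4)] all2[OF N(1) cd(3,4)] ab cd by simp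
    then show ?thesis
      using emb_holds[OF N(1) p(1), of cs] emb_holds[OF N(1) p(1), of ds] p(2) cd l by simp
  qed
  have rel: "holds M (i_rel I (r, n)) as \<longleftrightarrow> holds M (i_rel I (r, n)) bs"
    if "(r, n) \<in> rels K" "length as = n" "list_all2 (\<lambda>a b. (a, b) \<in> int_eq M I) as bs" for r n as bs
  proof (rule inv[OF _ _ that(3)])
    show "wf_fm L (i_rel I (r, n))" "fv (i_rel I (r, n)) \<subseteq> {..<length as}"
      using I that unfolding wf_interp_def by auto
    show "holds N (i_rel I (r, n)) cs \<longleftrightarrow> holds N (i_rel I (r, n)) ds"
      if "defines_quotient K N I" "length cs = length as"
        "list_all2 (\<lambda>a b. (a, b) \<in> int_eq N I) cs ds" for N :: "('b, 'f, 'r) struct" and cs ds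
      using dq_rel[OF that(1)] that \<open>(r, n) \<in> rels K\<close> \<open>length as = n\<close> by simp
  qed
  have graph: "holds M (i_fun I (f, n)) as \<longleftrightarrow> holds M (i_fun I (f, n)) bs"
    if "(f, n) \<in> funs K" "length as = Suc n" "list_all2 (\<lambda>a b. (a, b) \<in> int_eq M I) as bs" for f n as bs
  proof (rule inv[OF _ _ that(3)])
    show "wf_fm L (i_fun I (f, n))" "fv (i_fun I (f, n)) \<subseteq> {..<length as}"
      using I that unfolding wf_interp_def by auto
    show "holds N (i_fun I (f, n)) cs \<longleftrightarrow> holds N (i_fun I (f, n)) ds"
      if "defines_quotient K N I" "length cs = length as"
        "list_all2 (\<lambda>a b. (a, b) \<in> int_eq N I) cs ds" for N :: "('b, 'f, 'r) struct" and cs ds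
      using dq_graph[OF that(1)] that \<open>(f, n) \<in> funs K\<close> \<open>length as = Suc n\<close> by simp
  qed
  have fn: "(\<exists>b \<in> int_dom M I. holds M (i_fun I (f, n)) (as @ [b])) \<and>
           (\<forall>b \<in> int_dom M I. \<forall>c \<in> int_dom M I.
              holds M (i_fun I (f, n)) (as @ [b]) \<and> holds M (i_fun I (f, n)) (as @ [c]) \<longrightarrow>
              (b, c) \<in> int_eq M I)"
    if f: "(f, n) \<in> funs K" "length as = n" "set as \<subseteq> int_dom M I" for f n as
  proof -
    let ?p = "i_fun I (f, n)"
    have p: "wf_fm L ?p" "fv ?p \<subseteq> {..<Suc n}" using I f unfolding wf_interp_def by auto
    have dq: "(\<exists>b \<in> int_dom N I. holds N ?p (cs @ [b])) \<and>
           (\<forall>b \<in> int_dom N I. \<forall>c \<in> int_dom N I.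
              holds N ?p (cs @ [b]) \<and> holds N ?p (cs @ [c]) \<longrightarrow> (b, c) \<in> int_eq N I)"
      if "defines_quotient K N I" "length cs = n" "set cs \<subseteq> int_dom N I"
      for N :: "('b, 'f, 'r) struct" and cs
      using dq_total[OF that(1) f(1) that(2,3)] dq_unique[OF that(1) f(1) that(2,3)] by blast
    have key: "\<exists>(N :: ('b, 'f, 'r) struct) h cs. emb L N M h \<and> defines_quotient K N I \<and>
        set bs \<subseteq> h ` univ N \<and> as = map h cs \<and> set cs \<subseteq> int_dom N I \<and> length cs = n \<and>
        (\<forall>b\<in>univ N. holds N ?p (cs @ [b]) \<longleftrightarrow> holds M ?p (as @ [h b]))"
      if "set bs \<subseteq> univ M" for bs
    proof -
      have "set (as @ bs) \<subseteq> univ M" using f that int_dom_univ[of M I] by auto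
      from ex[OF this] obtain N :: "('b, 'f, 'r) struct" and h where
        N: "emb L N M h" "set as \<subseteq> h ` univ N" "set bs \<subseteq> h ` univ N" "defines_quotient K N I" by auto
      obtain cs where cs: "as = map h cs" "set cs \<subseteq> univ N" using lift N by metis
      have "set cs \<subseteq> int_dom N I" using emb_int_dom[OF N(1) I] cs f(3) by auto
      moreover have "holds N ?p (cs @ [b]) \<longleftrightarrow> holds M ?p (as @ [h b])" if "b \<in> univ N" for b
        using emb_holds[OF N(1) p(1), of "cs @ [b]"] p(2) cs f that by simp
      ultimately show ?thesis using N cs f by (metis length_map)
    qed
    show ?thesis
    proof (intro conjI ballI impI)
      obtain N :: "('b, 'f, 'r) struct" and h cs where
        N: "emb L N M h" "defines_quotient K N I" "set cs \<subseteq> int_dom N I" "length cs = n"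
          "\<forall>b\<in>univ N. holds N ?p (cs @ [b]) \<longleftrightarrow> holds M ?p (as @ [h b])"
        using key[of "[]"] by auto
      obtain b where b: "b \<in> int_dom N I" "holds N ?p (cs @ [b])" using dq[OF N(2,4,3)] by auto
      then have "b \<in> univ N" using int_dom_univ[of N I] by auto
      then show "\<exists>b\<in>int_dom M I. holds M ?p (as @ [b])"
        using b N(5) emb_int_dom[OF N(1) I] by auto
    next
      fix b c assume bc: "b \<in> int_dom M I" "c \<in> int_dom M I"
        and hh: "holds M ?p (as @ [b]) \<and> holds M ?p (as @ [c])"
      then have "set [b, c] \<subseteq> univ M" using int_dom_univ[of M I] by auto
      from key[OF this] obtain N :: "('b, 'f, 'r) struct" and h cs where
        N: "emb L N M h" "defines_quotient K N I" "set cs \<subseteq> int_dom N I" "length cs = n"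
          "\<forall>b\<in>univ N. holds N ?p (cs @ [b]) \<longleftrightarrow> holds M ?p (as @ [h b])"
        and im: "set [b, c] \<subseteq> h ` univ N" by blast
      obtain b' c' where b': "b = h b'" "c = h c'" "b' \<in> univ N" "c' \<in> univ N" using im by auto
      then have "b' \<in> int_dom N I" "c' \<in> int_dom N I" using emb_int_dom[OF N(1) I] bc by auto
      then have "(b', c') \<in> int_eq N I" using dq[OF N(2,4,3)] hh N(5) b' by auto
      then show "(b, c) \<in> int_eq M I" using emb_int_eq[OF N(1) I b'(3,4)] b' by simp
    qed
  qed
  show ?thesis
    unfolding defines_quotient_def
  proof (intro conjI ne eqv ballI)
    show "case x of (r, n) \<Rightarrow> \<forall>as bs.
        length as = n \<and> list_all2 (\<lambda>a b. (a, b) \<in> int_eq M I) as bs \<longrightarrow>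
        (holds M (i_rel I (r, n)) as \<longleftrightarrow> holds M (i_rel I (r, n)) bs)" if "x \<in> rels K" for x
      using that by (cases x) (simp add: rel)
    show "case x of (f, n) \<Rightarrow>
        (\<forall>as bs. length as = Suc n \<and> list_all2 (\<lambda>a b. (a, b) \<in> int_eq M I) as bs \<longrightarrow>
           (holds M (i_fun I (f, n)) as \<longleftrightarrow> holds M (i_fun I (f, n)) bs)) \<and>
        (\<forall>as. length as = n \<and> set as \<subseteq> int_dom M I \<longrightarrow>
           (\<exists>b \<in> int_dom M I. holds M (i_fun I (f, n)) (as @ [b])) \<and>
           (\<forall>b \<in> int_dom M I. \<forall>c \<in> int_dom M I.
              holds M (i_fun I (f, n)) (as @ [b]) \<and> holds M (i_fun I (f, n)) (as @ [c]) \<longrightarrow>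
              (b, c) \<in> int_eq M I))" if "x \<in> funs K" for x
      using that by (cases x) (simp only: prod.case, intro conjI allI impI;
        (elim conjE, rule graph fn[THEN conjunct1] fn[THEN conjunct2]; assumption))
  qed
qed

abbreviation "cls M I a \<equiv> int_eq M I `` {a}"

lemma cls_eq:
  assumes "defines_quotient K M I" "a \<in> int_dom M I" "b \<in> int_dom M I"
  shows "cls M I a = cls M I b \<longleftrightarrow> (a, b) \<in> int_eq M I"
  using eq_equiv_class_iff[OF dq_equiv[OF assms(1)] assms(2,3)] .

lemma list_all2_cls:
  assumes "list_all2 (\<in>) bs (map (cls M I) as)"
  shows "list_all2 (\<lambda>a b. (a, b) \<in> int_eq M I) as bs"
  using assms by (auto simp: list_all2_conv_all_nth)

lemma list_all2_self:
  assumes "defines_quotient K M I" "set as \<subseteq> int_dom M I"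
  shows "list_all2 (\<in>) as (map (cls M I) as)"
  using assms dq_refl[OF assms(1)] unfolding list_all2_conv_all_nth by (auto simp: subset_iff)

lemma quot_rl:
  assumes dq: "defines_quotient K M I" and r: "(r, length as) \<in> rels K" and as: "set as \<subseteq> int_dom M I"
  shows "rl (quot_struct M I) r (map (cls M I) as) \<longleftrightarrow> holds M (i_rel I (r, length as)) as"
proof
  assume "rl (quot_struct M I) r (map (cls M I) as)"
  then obtain bs where bs: "list_all2 (\<in>) bs (map (cls M I) as)" "holds M (i_rel I (r, length as)) bs"
    by (auto simp: quot_struct_def)
  then show "holds M (i_rel I (r, length as)) as"
    using dq_rel[OF dq r refl list_all2_cls[OF bs(1)]] by simp
next
  assume "holds M (i_rel I (r, length as)) as"
  then show "rl (quot_struct M I) r (map (cls M I) as)"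
    using list_all2_self[OF dq as] by (auto simp: quot_struct_def)
qed

lemma quot_fn:
  assumes dq: "defines_quotient K M I" and f: "(f, length as) \<in> funs K" and as: "set as \<subseteq> int_dom M I"
    and b: "b \<in> int_dom M I" "holds M (i_fun I (f, length as)) (as @ [b])"
  shows "fn (quot_struct M I) f (map (cls M I) as) = cls M I b"
proof -
  let ?p = "i_fun I (f, length as)"
  have eqv: "equiv (int_dom M I) (int_eq M I)" by (rule dq_equiv[OF dq])
  have "(THE Y. Y \<in> int_dom M I // int_eq M I \<and>
          (\<exists>cs. \<exists>d\<in>Y. list_all2 (\<in>) cs (map (cls M I) as) \<and> holds M ?p (cs @ [d]))) = cls M I b"
  proof (rule the_equality)
    show "cls M I b \<in> int_dom M I // int_eq M I \<and>
       (\<exists>cs. \<exists>d\<in>cls M I b. list_all2 (\<in>) cs (map (cls M I) as) \<and> holds M ?p (cs @ [d]))"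
      using b list_all2_self[OF dq as] equiv_class_self[OF eqv b(1)] quotientI[OF b(1)] by blast
  next
    fix Y assume "Y \<in> int_dom M I // int_eq M I \<and>
       (\<exists>cs. \<exists>d\<in>Y. list_all2 (\<in>) cs (map (cls M I) as) \<and> holds M ?p (cs @ [d]))"
    then obtain y cs d where y: "y \<in> int_dom M I" "Y = cls M I y"
      and d: "(y, d) \<in> int_eq M I" "list_all2 (\<in>) cs (map (cls M I) as)" "holds M ?p (cs @ [d])"
      by (auto elim!: quotientE)
    have dd: "d \<in> int_dom M I" using int_eq_dom[OF d(1)] by simp
    have "(d, d) \<in> int_eq M I" using dq_refl[OF dq dd] .
    then have "list_all2 (\<lambda>a b. (a, b) \<in> int_eq M I) (as @ [d]) (cs @ [d])"
      using list_all2_cls[OF d(2)] by (simp add: list_all2_appendI)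
    moreover have "length (as @ [d]) = Suc (length as)" by simp
    ultimately have "holds M ?p (as @ [d])"
      using dq_graph[OF dq f] d(3) by blast
    then have "(d, b) \<in> int_eq M I"
      using dq_unique[OF dq f refl as dd b(1) _ b(2)] by simp
    then have "(y, b) \<in> int_eq M I" using dq_trans[OF dq d(1)] by simp
    then show "Y = cls M I b" using y cls_eq[OF dq y(1) b(1)] by simp
  qed
  then show ?thesis by (simp add: quot_struct_def)
qed

lemma quot_univ: "univ (quot_struct M I) = int_dom M I // int_eq M I"
  by (simp add: quot_struct_def)

lemma quot_is_struct:
  assumes dq: "defines_quotient K M I"
  shows "is_struct K (quot_struct M I)"
proof -
  have "fn (quot_struct M I) f Xs \<in> int_dom M I // int_eq M I"
    if f: "(f, length Xs) \<in> funs K" and Xs: "set Xs \<subseteq> int_dom M I // int_eq M I" for f Xs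
  proof -
    have "\<exists>as. Xs = map (cls M I) as \<and> set as \<subseteq> int_dom M I"
      using Xs
    proof (induction Xs)
      case (Cons X Xs)
      then obtain as a where "Xs = map (cls M I) as" "set as \<subseteq> int_dom M I" "X = cls M I a" "a \<in> int_dom M I"
        by (auto elim!: quotientE)
      then have "X # Xs = map (cls M I) (a # as) \<and> set (a # as) \<subseteq> int_dom M I" by simp
      then show ?case by (intro exI)
    qed simp
    then obtain as where as: "Xs = map (cls M I) as" "set as \<subseteq> int_dom M I" by blast
    then obtain b where b: "b \<in> int_dom M I" "holds M (i_fun I (f, length as)) (as @ [b])"
      using dq_total[OF dq f _ as(2)] by auto
    then have "fn (quot_struct M I) f Xs = cls M I b" using quot_fn[OF dq _ as(2) b] f as by simp
    then show ?thesis using b by (simp add: quotientI)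
  qed
  moreover have "int_dom M I // int_eq M I \<noteq> {}"
    using dq_ne[OF dq] by (auto simp: quotient_def)
  ultimately show ?thesis by (auto simp: is_struct_def quot_univ)
qed

lemma quot_emb_sat:
  assumes E: "emb L N M h" and I: "wf_interp L K I"
    and dN: "defines_quotient K N I" and dM: "defines_quotient K M I"
    and TV: "\<And>p x r X. range r \<subseteq> int_dom N I \<Longrightarrow> X \<in> int_dom M I // int_eq M I \<Longrightarrow>
      sat (quot_struct M I) ((\<lambda>i. cls M I (h (r i)))(x := X)) p \<Longrightarrow>
      \<exists>b\<in>int_dom N I. sat (quot_struct M I) ((\<lambda>i. cls M I (h (r i)))(x := cls M I (h b))) p"
    and p: "wf_fm K p" and r: "range r \<subseteq> int_dom N I"
  shows "sat (quot_struct N I) (\<lambda>i. cls N I (r i)) p \<longleftrightarrow> sat (quot_struct M I) (\<lambda>i. cls M I (h (r i))) p"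
proof -
  have hD: "h a \<in> int_dom M I" if "a \<in> int_dom N I" for a
    using that emb_int_dom[OF E I] int_dom_univ[of N I] by auto
  have tms: "\<exists>as. set as \<subseteq> int_dom N I \<and> map (val (quot_struct N I) e) ts = map (cls N I) as \<and>
       map (val (quot_struct M I) e') ts = map (cls M I) (map h as)"
    if "\<And>t. t \<in> set ts \<Longrightarrow> \<exists>a\<in>int_dom N I. val (quot_struct N I) e t = cls N I a \<and>
        val (quot_struct M I) e' t = cls M I (h a)" for ts e e'
    using that
  proof (induction ts)
    case (Cons t ts)
    have "\<exists>as. set as \<subseteq> int_dom N I \<and> map (val (quot_struct N I) e) ts = map (cls N I) as \<and>
       map (val (quot_struct M I) e') ts = map (cls M I) (map h as)"
      by (rule Cons.IH, rule Cons.prems) simp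
    moreover have "\<exists>a\<in>int_dom N I. val (quot_struct N I) e t = cls N I a \<and>
        val (quot_struct M I) e' t = cls M I (h a)"
      by (rule Cons.prems) simp
    ultimately obtain as a where "set as \<subseteq> int_dom N I" "map (val (quot_struct N I) e) ts = map (cls N I) as"
       "map (val (quot_struct M I) e') ts = map (cls M I) (map h as)"
       "a \<in> int_dom N I" "val (quot_struct N I) e t = cls N I a" "val (quot_struct M I) e' t = cls M I (h a)"
      by (elim exE bexE conjE)
    then show ?case by (intro exI[of _ "a # as"]) simp
  qed simp
  have v: "\<exists>a\<in>int_dom N I. val (quot_struct N I) (\<lambda>i. cls N I (r i)) t = cls N I a \<and>
      val (quot_struct M I) (\<lambda>i. cls M I (h (r i))) t = cls M I (h a)"
    if "wf_tm K t" "range r \<subseteq> int_dom N I" for t r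
    using that
  proof (induction t)
    case (Var x)
    then show ?case by (intro bexI[of _ "r x"]) auto
  next
    case (Fun f ts)
    have f: "(f, length ts) \<in> funs K" using Fun.prems by simp
    have "\<exists>as. set as \<subseteq> int_dom N I \<and>
      map (val (quot_struct N I) (\<lambda>i. cls N I (r i))) ts = map (cls N I) as \<and>
      map (val (quot_struct M I) (\<lambda>i. cls M I (h (r i)))) ts = map (cls M I) (map h as)"
      by (rule tms, rule Fun.IH) (use Fun.prems in auto)
    then obtain as where as: "set as \<subseteq> int_dom N I"
      "map (val (quot_struct N I) (\<lambda>i. cls N I (r i))) ts = map (cls N I) as"
      "map (val (quot_struct M I) (\<lambda>i. cls M I (h (r i)))) ts = map (cls M I) (map h as)"
      by (elim exE conjE)
    have l: "length as = length ts" using arg_cong[OF as(2), of length] by simp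
    let ?p = "i_fun I (f, length as)"
    obtain b where b: "b \<in> int_dom N I" "holds N ?p (as @ [b])"
      using dq_total[OF dN f l as(1)] l by auto
    have "holds M ?p (map h (as @ [b]))"
    proof -
      have "wf_fm L ?p" "fv ?p \<subseteq> {..<length (as @ [b])}" using I f l unfolding wf_interp_def by auto
      moreover have "set (as @ [b]) \<subseteq> univ N" using as b int_dom_univ[of N I] by auto
      ultimately show ?thesis using emb_holds[OF E] b by blast
    qed
    then have "fn (quot_struct M I) f (map (cls M I) (map h as)) = cls M I (h b)"
      by (intro quot_fn[OF dM]) (use f l as b hD in auto)
    moreover have "fn (quot_struct N I) f (map (cls N I) as) = cls N I b"
      by (rule quot_fn[OF dN]) (use f l as b in auto)
    ultimately show ?case
      using b(1) as(2,3) by (intro bexI[of _ b]) (simp_all only: val.simps)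
  qed
  show ?thesis using p r
  proof (induction p arbitrary: r)
    case (Eq s t)
    obtain a where a: "a \<in> int_dom N I" "val (quot_struct N I) (\<lambda>i. cls N I (r i)) s = cls N I a"
      "val (quot_struct M I) (\<lambda>i. cls M I (h (r i))) s = cls M I (h a)" using v[of s r] Eq by auto
    obtain b where b: "b \<in> int_dom N I" "val (quot_struct N I) (\<lambda>i. cls N I (r i)) t = cls N I b"
      "val (quot_struct M I) (\<lambda>i. cls M I (h (r i))) t = cls M I (h b)" using v[of t r] Eq by auto
    have "a \<in> univ N" "b \<in> univ N" using a b int_dom_univ[of N I] by auto
    then show ?case
      using a b cls_eq[OF dN a(1) b(1)] cls_eq[OF dM hD hD, OF a(1) b(1)] emb_int_eq[OF E I]
      by simp
  next
    case (Rel q ts)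
    have "\<exists>as. set as \<subseteq> int_dom N I \<and>
      map (val (quot_struct N I) (\<lambda>i. cls N I (r i))) ts = map (cls N I) as \<and>
      map (val (quot_struct M I) (\<lambda>i. cls M I (h (r i)))) ts = map (cls M I) (map h as)"
      by (rule tms, rule v) (use Rel.prems in auto)
    then obtain as where as: "set as \<subseteq> int_dom N I"
      "map (val (quot_struct N I) (\<lambda>i. cls N I (r i))) ts = map (cls N I) as"
      "map (val (quot_struct M I) (\<lambda>i. cls M I (h (r i)))) ts = map (cls M I) (map h as)"
      by (elim exE conjE)
    have l: "length as = length ts" using arg_cong[OF as(2), of length] by simp
    have q: "(q, length as) \<in> rels K" using Rel.prems l by simp
    have "rl (quot_struct N I) q (map (cls N I) as) \<longleftrightarrow> holds N (i_rel I (q, length as)) as"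
      by (rule quot_rl[OF dN q as(1)])
    moreover have "rl (quot_struct M I) q (map (cls M I) (map h as)) \<longleftrightarrow> holds M (i_rel I (q, length as)) (map h as)"
      using quot_rl[OF dM, of q "map h as"] q as(1) hD by auto
    moreover have "holds N (i_rel I (q, length as)) as \<longleftrightarrow> holds M (i_rel I (q, length as)) (map h as)"
      by (rule emb_holds[OF E]) (use I q as int_dom_univ[of N I] in \<open>auto simp: wf_interp_def\<close>)
    ultimately show ?case using as by (simp only: sat.simps)
  next
    case (Ex x p)
    have IH: "sat (quot_struct N I) ((\<lambda>i. cls N I (r i))(x := cls N I b)) p \<longleftrightarrow>
        sat (quot_struct M I) ((\<lambda>i. cls M I (h (r i)))(x := cls M I (h b))) p"
      if "b \<in> int_dom N I" for b
    proof -
      have "sat (quot_struct N I) (\<lambda>i. cls N I ((r(x := b)) i)) p \<longleftrightarrow>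
          sat (quot_struct M I) (\<lambda>i. cls M I (h ((r(x := b)) i))) p"
        by (rule Ex.IH) (use Ex.prems that in auto)
      moreover have "(\<lambda>i. cls N I ((r(x := b)) i)) = (\<lambda>i. cls N I (r i))(x := cls N I b)"
        "(\<lambda>i. cls M I (h ((r(x := b)) i))) = (\<lambda>i. cls M I (h (r i)))(x := cls M I (h b))" by (auto simp: fun_eq_iff)
      ultimately show ?thesis by simp
    qed
    show ?case
    proof
      assume "sat (quot_struct N I) (\<lambda>i. cls N I (r i)) (Ex x p)"
      then obtain b where "b \<in> int_dom N I" "sat (quot_struct N I) ((\<lambda>i. cls N I (r i))(x := cls N I b)) p"
        by (auto simp: quot_univ elim!: quotientE)
      then show "sat (quot_struct M I) (\<lambda>i. cls M I (h (r i))) (Ex x p)"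
        using IH hD by (auto simp: quot_univ intro!: bexI[OF _ quotientI])
    next
      assume "sat (quot_struct M I) (\<lambda>i. cls M I (h (r i))) (Ex x p)"
      then obtain X where "X \<in> int_dom M I // int_eq M I"
        "sat (quot_struct M I) ((\<lambda>i. cls M I (h (r i)))(x := X)) p" by (auto simp: quot_univ)
      then obtain b where "b \<in> int_dom N I"
        "sat (quot_struct M I) ((\<lambda>i. cls M I (h (r i)))(x := cls M I (h b))) p"
        using TV Ex.prems(2) by blast
      then show "sat (quot_struct N I) (\<lambda>i. cls N I (r i)) (Ex x p)"
        using IH by (auto simp: quot_univ intro!: bexI[OF _ quotientI])
    qed
  qed auto
qed

theorem is_interpretation_transfer:
  fixes L :: "('f::countable, 'r::countable) lang" and K :: "('g::countable, 's::countable) lang"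
  assumes nat: "is_interpretation TYPE(nat) L T K S I"
    and T: "\<And>p. p \<in> T \<Longrightarrow> wf_fm L p" and S: "\<And>p. p \<in> S \<Longrightarrow> wf_fm K p"
  shows "is_interpretation TYPE('a) L T K S I"
proof -
  have I: "wf_interp L K I" using nat by (simp add: is_interpretation_def)
  have "defines_quotient K M I \<and> is_model K S (quot_struct M I)"
    if M: "is_model L T M" for M :: "('a, 'f, 'r) struct"
  proof -
    have sM: "is_struct L M" using M by (simp add: is_model_def)
    then obtain d where d: "d \<in> univ M" by (auto simp: is_struct_def)
    have natN: "defines_quotient K N I \<and> is_model K S (quot_struct N I)"
      if "emb L N M h" for N :: "(nat, 'f, 'r) struct" and h
      using nat emb_model[OF that M T] unfolding is_interpretation_def by blast
    have dM: "defines_quotient K M I"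
    proof (rule defines_quotient_transfer[OF I])
      show "univ M \<noteq> {}" using d by auto
      fix zs assume zs: "set zs \<subseteq> univ M"
      define c where "c i = (if i < length zs then zs ! i else d)" for i
      have cM: "range c \<subseteq> univ M" using zs d by (auto simp: c_def)
      obtain N :: "(nat, 'f, 'r) struct" and h where N: "emb L N M h" "range c \<subseteq> h ` univ N"
        by (rule countable_emb[OF sM cM, where P = "\<lambda>(_::nat) _ _. False"])
      have "set zs \<subseteq> range c" by (auto simp: c_def in_set_conv_nth)
      then show "\<exists>(N :: (nat, 'f, 'r) struct) h. emb L N M h \<and> set zs \<subseteq> h ` univ N \<and> defines_quotient K N I"
        using N natN[OF N(1)] by blast
    qed
    have "sat (quot_struct M I) e p" if p: "p \<in> S" and e: "range e \<subseteq> univ (quot_struct M I)" for p e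
    proof -
      have "\<exists>a. a \<in> int_dom M I \<and> e i = cls M I a" for i
      proof -
        have "e i \<in> int_dom M I // int_eq M I" using e by (auto simp: quot_univ)
        then show ?thesis by (auto elim!: quotientE)
      qed
      then obtain c where c: "\<And>i. c i \<in> int_dom M I" "\<And>i. e i = cls M I (c i)" by metis
      define P :: "('g, 's) fm \<times> nat \<Rightarrow> 'a list \<Rightarrow> 'a \<Rightarrow> bool" where
        "P j as a = (a \<in> int_dom M I \<and>
          sat (quot_struct M I) ((\<lambda>i. cls M I (as ! i))(snd j := cls M I a)) (fst j))" for j as a
      have cM: "range c \<subseteq> univ M" using c int_dom_univ[of M I] by auto
      obtain N :: "(nat, 'f, 'r) struct" and h where
        E: "emb L N M h" and cN: "range c \<subseteq> h ` univ N" and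
        PN: "\<And>i as. set as \<subseteq> h ` univ N \<Longrightarrow> \<exists>a\<in>univ M. P i as a \<Longrightarrow> \<exists>a\<in>h ` univ N. P i as a"
        by (rule countable_emb[OF sM cM, where P = P], rule that, assumption, assumption, metis)
      have "\<exists>b. b \<in> univ N \<and> c i = h b" for i using cN by blast
      then obtain r where r: "\<And>i. r i \<in> univ N" "\<And>i. c i = h (r i)" by metis
      have rD: "range r \<subseteq> int_dom N I" using emb_int_dom[OF E I] r c by auto
      have TV: "\<exists>b\<in>int_dom N I. sat (quot_struct M I) ((\<lambda>i. cls M I (h (r i)))(x := cls M I (h b))) p"
        if r: "range r \<subseteq> int_dom N I" and X: "X \<in> int_dom M I // int_eq M I"
          "sat (quot_struct M I) ((\<lambda>i. cls M I (h (r i)))(x := X)) p" for p x r X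
      proof -
        obtain m where m: "fv p \<subseteq> {..<m}" using finite_fv[of p] by (metis finite_nat_iff_bounded)
        define as where "as = map (\<lambda>i. h (r i)) [0..<m]"
        have as: "set as \<subseteq> h ` univ N" using r int_dom_univ[of N I] by (auto simp: as_def)
        have eq: "sat (quot_struct M I) ((\<lambda>i. cls M I (as ! i))(x := Y)) p =
            sat (quot_struct M I) ((\<lambda>i. cls M I (h (r i)))(x := Y)) p" for Y
          by (rule sat_cong) (use m in \<open>auto simp: as_def\<close>)
        obtain a where "a \<in> int_dom M I" "X = cls M I a" using X by (auto elim!: quotientE)
        then have "\<exists>a\<in>univ M. P (p, x) as a"
          using X int_dom_univ[of M I] by (auto simp: P_def eq)
        then obtain b where "b \<in> univ N" "P (p, x) as (h b)" using PN[OF as] by blast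
        then show ?thesis using emb_int_dom[OF E I] by (auto simp: P_def eq)
      qed
      have dN: "defines_quotient K N I" and mN: "is_model K S (quot_struct N I)" using natN[OF E] by auto
      have "range (\<lambda>i. cls N I (r i)) \<subseteq> univ (quot_struct N I)"
        using rD by (auto simp: quot_univ intro: quotientI)
      then have "sat (quot_struct N I) (\<lambda>i. cls N I (r i)) p"
        using mN p by (simp add: is_model_def)
      moreover have "sat (quot_struct N I) (\<lambda>i. cls N I (r i)) p \<longleftrightarrow>
          sat (quot_struct M I) (\<lambda>i. cls M I (h (r i))) p"
        by (rule quot_emb_sat[OF E I dN dM _ S[OF p] rD], rule TV)
      moreover have "e = (\<lambda>i. cls M I (h (r i)))" using c r by auto
      ultimately show ?thesis by simp
    qed
    then show ?thesis using dM quot_is_struct[OF dM] by (simp add: is_model_def)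
  qed
  then show ?thesis using I by (simp add: is_interpretation_def)
qed

instance arith_sym :: countable by countable_datatype
instance set_sym :: countable by countable_datatype

lemma wf_Robinson_Q: "p \<in> Robinson_Q \<Longrightarrow> wf_fm lang_arith p"
  by (auto simp: Robinson_Q_def lang_arith_def)

lemma wf_S0_Coll: "p \<in> S0 \<union> Coll \<Longrightarrow> wf_fm lang_set p"
  by (auto simp: S0_def Coll_def collection_ax_def extensionality_ax_def empty_set_ax_def
      pairing_ax_def set_difference_ax_def union_ax_def lang_set_def)

corollary Robinson_Q_interpretation_uniform:
  assumes "is_interpretation TYPE(nat) lang_arith Robinson_Q lang_set (S0 \<union> Coll) I"
  shows "is_interpretation TYPE('a) lang_arith Robinson_Q lang_set (S0 \<union> Coll) I"
  using assms wf_Robinson_Q wf_S0_Coll by (rule is_interpretation_transfer)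

end

(* A set theory with a universal set satisfies Collection trivially: the universal set collects all
   witnesses. So it suffices to interpret S0 together with a universal set, and the finite and
   cofinite sets do this.

   By Solovay's shortening of cuts, Q has a definable cut that is an ordered semiring. On it,
   Goedel's beta function codes finite sets, and a further cut provides a least code for every set;
   these codes are the sets, with a flag that marks complements. Coding a set modulo b needs a
   sufficiently divisible b, so recoding would need induction; this is avoided by admitting only
   sets that have a code modulo every such b, which are closed under adjunction. A set belongs to the
   universe if it lies in a transitive set of least codes that is closed under the few separations
   needed; intersections, differences and unions of members are then cut out of this transitive set
   or of its complement, and again no induction is needed. *)

theory Submission
  imports Defs
begin

section \<open>Uniformly definable relations\<close>

text \<open>Robinson arithmetic has no induction, so a law is never proved for all numbers. Instead
  one passes to the numbers for which it holds in a form inherited by successors, and then shrinks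
  this class until it has the closure properties needed. The engine is composition: if translations
  by \<open>x\<close> and by \<open>y\<close> preserve a class, so does translation by
  \<open>x + y\<close>, by associativity alone. This turns closure under successor into closure
  under addition; applied to sets (\<open>joinable\<close>) it turns closure under adjoining one
  element into closure under binary union. Separation would be an induction along the set. It is
  therefore demanded of a support: the empty set and singletons satisfy the demand trivially, and
  unions inherit it. Only the separations for difference and union are demanded, together with their
  negations, because a cofinite result is cut out through its complement. Two facts replace
  foundation and recoding: elements are smaller than codes, so a support copied as a set lies
  outside itself and finite sets differ from cofinite ones; and least codes make equality of sets
  the identity.\<close>

type_synonym 'a arith = "('a, arith_sym, unit) struct"

definition ze :: "'a arith \<Rightarrow> 'a" where "ze M = fn M ZeroS []"
definition su :: "'a arith \<Rightarrow> 'a \<Rightarrow> 'a" where "su M x = fn M SuccS [x]"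
definition pl :: "'a arith \<Rightarrow> 'a \<Rightarrow> 'a \<Rightarrow> 'a" where "pl M x y = fn M PlusS [x, y]"
definition ti :: "'a arith \<Rightarrow> 'a \<Rightarrow> 'a \<Rightarrow> 'a" where "ti M x y = fn M TimesS [x, y]"

text \<open>The defining term or formula is the same for all structures; \<open>n\<close> bounds its free variables.\<close>

definition dtm :: "nat \<Rightarrow> ('a arith \<Rightarrow> (nat \<Rightarrow> 'a) \<Rightarrow> 'a) \<Rightarrow> bool" where
  "dtm n t \<longleftrightarrow> (\<exists>s. wf_tm lang_arith s \<and> fvt s \<subseteq> {..<n} \<and> (\<forall>M e. val M e s = t M e))"

definition dfm :: "nat \<Rightarrow> ('a arith \<Rightarrow> (nat \<Rightarrow> 'a) \<Rightarrow> bool) \<Rightarrow> bool" where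
  "dfm n R \<longleftrightarrow> (\<exists>p. wf_fm lang_arith p \<and> fv p \<subseteq> {..<n} \<and> (\<forall>M e. sat M e p \<longleftrightarrow> R M e))"

text \<open>Allowing every term \<open>t\<close>, and not just a variable, builds in closure under
  substitution, so no substitution on formulas is needed. The inclusion lets a quantifier bounded by
  \<open>A M\<close> be written with \<open>Ex\<close>.\<close>

definition dset :: "('a arith \<Rightarrow> 'a set) \<Rightarrow> bool" where
  "dset A \<longleftrightarrow> (\<forall>M. A M \<subseteq> univ M) \<and> (\<forall>n t. dtm n t \<longrightarrow> dfm n (\<lambda>M e. t M e \<in> A M))"

lemma dtm_mono: "dtm n t \<Longrightarrow> n \<le> m \<Longrightarrow> dtm m t"
  unfolding dtm_def by (meson lessThan_subset_iff subset_trans)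

lemma dtm_upd: "dtm n t \<Longrightarrow> n \<le> i \<Longrightarrow> t M (e(i := a)) = t M e"
  unfolding dtm_def by (metis fun_upd_other lessThan_iff linorder_not_less subsetD val_cong)

lemma dtm_var: "i < n \<Longrightarrow> dtm n (\<lambda>M e. e i)"
  unfolding dtm_def by (rule exI[of _ "Var i"]) auto

lemma dtm_ze: "dtm n (\<lambda>M e. ze M)"
  unfolding dtm_def by (rule exI[of _ ZeroT]) (auto simp: ze_def lang_arith_def)

lemma dtm_su: "dtm n t \<Longrightarrow> dtm n (\<lambda>M e. su M (t M e))"
  unfolding dtm_def
proof (elim exE conjE)
  fix s assume "wf_tm lang_arith s" "fvt s \<subseteq> {..<n}" "\<forall>M e. val M e s = t M e"
  then show "\<exists>s. wf_tm lang_arith s \<and> fvt s \<subseteq> {..<n} \<and> (\<forall>M e. val M e s = su M (t M e))"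
    by (intro exI[of _ "SuccT s"]) (auto simp: su_def lang_arith_def)
qed

lemma dtm_pl: "dtm n t \<Longrightarrow> dtm n u \<Longrightarrow> dtm n (\<lambda>M e. pl M (t M e) (u M e))"
  unfolding dtm_def
proof (elim exE conjE)
  fix s s' assume "wf_tm lang_arith s" "fvt s \<subseteq> {..<n}" "\<forall>M e. val M e s = t M e"
    "wf_tm lang_arith s'" "fvt s' \<subseteq> {..<n}" "\<forall>M e. val M e s' = u M e"
  then show "\<exists>s. wf_tm lang_arith s \<and> fvt s \<subseteq> {..<n} \<and> (\<forall>M e. val M e s = pl M (t M e) (u M e))"
    by (intro exI[of _ "PlusT s s'"]) (auto simp: pl_def lang_arith_def)
qed

lemma dtm_ti: "dtm n t \<Longrightarrow> dtm n u \<Longrightarrow> dtm n (\<lambda>M e. ti M (t M e) (u M e))"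
  unfolding dtm_def
proof (elim exE conjE)
  fix s s' assume "wf_tm lang_arith s" "fvt s \<subseteq> {..<n}" "\<forall>M e. val M e s = t M e"
    "wf_tm lang_arith s'" "fvt s' \<subseteq> {..<n}" "\<forall>M e. val M e s' = u M e"
  then show "\<exists>s. wf_tm lang_arith s \<and> fvt s \<subseteq> {..<n} \<and> (\<forall>M e. val M e s = ti M (t M e) (u M e))"
    by (intro exI[of _ "TimesT s s'"]) (auto simp: ti_def lang_arith_def)
qed

lemma dfm_eq: "dtm n t \<Longrightarrow> dtm n u \<Longrightarrow> dfm n (\<lambda>M e. t M e = u M e)"
  unfolding dtm_def dfm_def
proof (elim exE conjE)
  fix s s' assume "wf_tm lang_arith s" "fvt s \<subseteq> {..<n}" "\<forall>M e. val M e s = t M e"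
    "wf_tm lang_arith s'" "fvt s' \<subseteq> {..<n}" "\<forall>M e. val M e s' = u M e"
  then show "\<exists>p. wf_fm lang_arith p \<and> fv p \<subseteq> {..<n} \<and> (\<forall>M e. sat M e p = (t M e = u M e))"
    by (intro exI[of _ "Eq s s'"]) auto
qed

lemma dfm_not: "dfm n P \<Longrightarrow> dfm n (\<lambda>M e. \<not> P M e)"
  unfolding dfm_def
proof (elim exE conjE)
  fix p assume "wf_fm lang_arith p" "fv p \<subseteq> {..<n}" "\<forall>M e. sat M e p = P M e"
  then show "\<exists>p. wf_fm lang_arith p \<and> fv p \<subseteq> {..<n} \<and> (\<forall>M e. sat M e p = (\<not> P M e))"
    by (intro exI[of _ "Neg p"]) auto
qed

lemma dfm_conj: "dfm n P \<Longrightarrow> dfm n Q \<Longrightarrow> dfm n (\<lambda>M e. P M e \<and> Q M e)"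
  unfolding dfm_def
proof (elim exE conjE)
  fix p q assume "wf_fm lang_arith p" "fv p \<subseteq> {..<n}" "\<forall>M e. sat M e p = P M e"
    "wf_fm lang_arith q" "fv q \<subseteq> {..<n}" "\<forall>M e. sat M e q = Q M e"
  then show "\<exists>p. wf_fm lang_arith p \<and> fv p \<subseteq> {..<n} \<and> (\<forall>M e. sat M e p = (P M e \<and> Q M e))"
    by (intro exI[of _ "Conj p q"]) auto
qed

lemma dfm_disj: "dfm n P \<Longrightarrow> dfm n Q \<Longrightarrow> dfm n (\<lambda>M e. P M e \<or> Q M e)"
  using dfm_not[OF dfm_conj[OF dfm_not dfm_not], of n P Q] by simp

lemma dfm_imp: "dfm n P \<Longrightarrow> dfm n Q \<Longrightarrow> dfm n (\<lambda>M e. P M e \<longrightarrow> Q M e)"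
  unfolding imp_conv_disj by (intro dfm_disj dfm_not)

lemma dfm_iff: "dfm n P \<Longrightarrow> dfm n Q \<Longrightarrow> dfm n (\<lambda>M e. P M e \<longleftrightarrow> Q M e)"
  unfolding iff_conv_conj_imp by (intro dfm_conj dfm_imp)

lemma dfm_if:
  "dfm n P \<Longrightarrow> dfm n Q \<Longrightarrow> dfm n R \<Longrightarrow> dfm n (\<lambda>M e. if P M e then Q M e else R M e)"
  unfolding if_bool_eq_conj by (intro dfm_conj dfm_imp dfm_not)

lemma dfm_mem: "dset A \<Longrightarrow> dtm n t \<Longrightarrow> dfm n (\<lambda>M e. t M e \<in> A M)"
  by (simp add: dset_def)

text \<open>Slot \<open>n\<close> carries the witness. By \<open>upd\<close> the rest of
  \<open>Q\<close> does not read it, so it can be bound.\<close>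

lemma dfm_bex:
  assumes A: "dset A" and Q: "dfm (Suc n) (\<lambda>M e. Q M e (e n))"
    and upd: "\<And>M e a b. Q M (e(n := b)) a = Q M e a"
  shows "dfm n (\<lambda>M e. \<exists>a\<in>A M. Q M e a)"
proof -
  have "dfm (Suc n) (\<lambda>M e. e n \<in> A M \<and> Q M e (e n))"
    by (intro dfm_conj Q dfm_mem[OF A] dtm_var) simp
  then obtain p where "wf_fm lang_arith p" "fv p \<subseteq> {..<Suc n}"
    and p: "\<And>M e. sat M e p \<longleftrightarrow> e n \<in> A M \<and> Q M e (e n)"
    by (auto simp: dfm_def)
  moreover have "sat M e (Ex n p) \<longleftrightarrow> (\<exists>a\<in>A M. Q M e a)" for M e
  proof -
    have "A M \<subseteq> univ M" using A by (simp add: dset_def)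
    then show ?thesis by (auto simp: p upd)
  qed
  ultimately show ?thesis
    unfolding dfm_def by (intro exI[of _ "Ex n p"]) (simp, force)
qed

lemma dfm_ball:
  assumes "dset A" "dfm (Suc n) (\<lambda>M e. Q M e (e n))"
    and "\<And>M e a b. Q M (e(n := b)) a = Q M e a"
  shows "dfm n (\<lambda>M e. \<forall>a\<in>A M. Q M e a)"
proof -
  have "dfm n (\<lambda>M e. \<not> (\<exists>a\<in>A M. \<not> Q M e a))"
    by (rule dfm_not, rule dfm_bex[OF assms(1)], rule dfm_not, rule assms(2), simp only: assms(3))
  then show ?thesis by simp
qed

text \<open>Definability is required for environments with values outside the universe as well, so
  membership has to be expressed by \<open>Ex n (Eq (Var n) s)\<close>.\<close>

lemma dset_univ: "dset univ"
proof -
  have "dfm n (\<lambda>M e. t M e \<in> univ M)" if t: "dtm n t" for n and t :: "'a arith \<Rightarrow> _"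
  proof -
    obtain s where s: "wf_tm lang_arith s" "fvt s \<subseteq> {..<n}" "\<And>M e. val M e s = t M e"
      using t by (auto simp: dtm_def)
    have "sat M e (Ex n (Eq (Var n) s)) \<longleftrightarrow> t M e \<in> univ M" for M e
      by (simp add: s(3) dtm_upd[OF t])
    then show ?thesis
      unfolding dfm_def using s(1,2) by (intro exI[of _ "Ex n (Eq (Var n) s)"]) auto
  qed
  then show ?thesis by (simp add: dset_def)
qed

lemma dset_Collect:
  assumes A: "dset A" and R: "\<And>n t. dtm n t \<Longrightarrow> dfm n (\<lambda>M e. R M (t M e))"
  shows "dset (\<lambda>M. {x \<in> A M. R M x})"
  using A dfm_conj[OF dfm_mem[OF A] R] by (auto simp: dset_def)

text \<open>These rules follow the build-up of a definition; \<open>dtm_mono\<close> moves a term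
  under a binder and \<open>dtm_upd\<close> settles the freshness condition there.\<close>

named_theorems dfb
lemmas [dfb] = dtm_var dtm_ze dtm_su dtm_pl dtm_ti dfm_eq dfm_not dfm_conj dfm_disj dfm_imp
  dfm_iff dfm_if dfm_mem dfm_bex dfm_ball dset_univ

section \<open>A cut with the laws of an ordered semiring\<close>

text \<open>Here and in the next classes \<open>x\<close> is the variable on which an induction
  would run. The other variables range over \<open>univ M\<close> or over an earlier class, chosen
  so that the successor step can be computed.\<close>

definition addc :: "'a arith \<Rightarrow> 'a set" where
  "addc M = {x \<in> univ M.
     (\<forall>y\<in>univ M. \<forall>z\<in>univ M. pl M y (pl M z x) = pl M (pl M y z) x \<and> (pl M y x = pl M z x \<longrightarrow> y = z)) \<and>
     pl M (ze M) x = x \<and> (\<forall>y\<in>univ M. pl M (su M y) x = su M (pl M y x))}"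

text \<open>The last condition is comparability, the source of the linear order
  \<open>leq\<close>.\<close>

definition commc :: "'a arith \<Rightarrow> 'a set" where
  "commc M = {x \<in> addc M. \<forall>y\<in>addc M.
     pl M y x = pl M x y \<and> (\<exists>d\<in>addc M. pl M d x = y \<or> pl M d y = x)}"

definition ldistc :: "'a arith \<Rightarrow> 'a set" where
  "ldistc M = {x \<in> addc M. \<forall>y\<in>addc M. \<forall>z\<in>univ M. ti M y (pl M z x) = pl M (ti M y z) (ti M y x)}"

definition massocc :: "'a arith \<Rightarrow> 'a set" where
  "massocc M = {x \<in> addc M. \<forall>y\<in>addc M. \<forall>z\<in>ldistc M. ti M y (ti M z x) = ti M (ti M y z) x}"

definition multc :: "'a arith \<Rightarrow> 'a set" where
  "multc M = {x \<in> addc M. \<forall>z\<in>addc M. ti M z x \<in> addc M}"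

definition rdistc :: "'a arith \<Rightarrow> 'a set" where
  "rdistc M = {x \<in> multc M. ti M (ze M) x = ze M \<and> ti M (su M (ze M)) x = x \<and>
     (\<forall>y\<in>commc M. \<forall>z\<in>addc M. ti M (pl M y z) x = pl M (ti M y x) (ti M z x))}"

definition mcommc :: "'a arith \<Rightarrow> 'a set" where
  "mcommc M = {x \<in> commc M. \<forall>y\<in>rdistc M. ti M y x = ti M x y}"

definition lawc :: "'a arith \<Rightarrow> 'a set" where
  "lawc M = {x \<in> addc M. x \<in> commc M \<and> x \<in> ldistc M \<and> x \<in> massocc M \<and> x \<in> rdistc M \<and> x \<in> mcommc M}"

text \<open>Solovay's shortening: it turns an inductive class inside \<open>lawc\<close>, on which the algebraic laws hold,
  into a cut that is moreover closed under addition and multiplication.\<close>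

definition downc :: "'a arith \<Rightarrow> 'a set \<Rightarrow> 'a set" where
  "downc M Q = {x \<in> addc M. \<forall>y\<in>addc M. \<forall>d\<in>addc M. pl M d y = x \<longrightarrow> y \<in> Q}"

text \<open>Translations preserving \<open>Q\<close> compose, which yields closure under addition
  without induction.\<close>

definition plusc :: "'a arith \<Rightarrow> 'a set \<Rightarrow> 'a set" where
  "plusc M Q = {x \<in> addc M. \<forall>y\<in>Q. pl M y x \<in> Q}"

text \<open>The same device for multiplication. Closure under sums comes from distributivity, so the
  class it is applied to must already be closed under addition.\<close>

definition timesc :: "'a arith \<Rightarrow> 'a set \<Rightarrow> 'a set" where
  "timesc M Q = {x \<in> Q. \<forall>y\<in>Q. ti M y x \<in> Q}"

definition shorten :: "'a arith \<Rightarrow> 'a set \<Rightarrow> 'a set" where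
  "shorten M Q = timesc M (plusc M (downc M Q))"

lemma dset_addc [dfb]: "dset addc"
  unfolding addc_def
  by (rule dset_Collect) (rule dfb | erule dtm_mono | simp add: dtm_upd)+

lemma dset_commc [dfb]: "dset commc"
  unfolding commc_def
  by (rule dset_Collect) (rule dfb | erule dtm_mono | simp add: dtm_upd)+

lemma dset_ldistc [dfb]: "dset ldistc"
  unfolding ldistc_def
  by (rule dset_Collect) (rule dfb | erule dtm_mono | simp add: dtm_upd)+

lemma dset_massocc [dfb]: "dset massocc"
  unfolding massocc_def
  by (rule dset_Collect) (rule dfb | erule dtm_mono | simp add: dtm_upd)+

lemma dset_multc [dfb]: "dset multc"
  unfolding multc_def
  by (rule dset_Collect) (rule dfb | erule dtm_mono | simp add: dtm_upd)+

lemma dset_rdistc [dfb]: "dset rdistc"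
  unfolding rdistc_def
  by (rule dset_Collect) (rule dfb | erule dtm_mono | simp add: dtm_upd)+

lemma dset_mcommc [dfb]: "dset mcommc"
  unfolding mcommc_def
  by (rule dset_Collect) (rule dfb | erule dtm_mono | simp add: dtm_upd)+

lemma dset_lawc [dfb]: "dset lawc"
  unfolding lawc_def
  by (rule dset_Collect) (rule dfb | erule dtm_mono | simp add: dtm_upd)+

lemma dset_shorten: "dset Q \<Longrightarrow> dset (\<lambda>M. shorten M (Q M))"
proof -
  assume Q: "dset Q"
  have "dset (\<lambda>M. downc M (Q M))"
    unfolding downc_def
    by (rule dset_Collect) (rule dfb Q | erule dtm_mono | simp add: dtm_upd)+
  then have P: "dset (\<lambda>M. plusc M (downc M (Q M)))"
    unfolding plusc_def[of _ "downc _ _"]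
    by (intro dset_Collect) (rule dfb | assumption | erule dtm_mono | simp add: dtm_upd)+
  show ?thesis
    unfolding shorten_def timesc_def
    by (rule dset_Collect) (rule dfb P | erule dtm_mono | simp add: dtm_upd)+
qed

section \<open>The axioms of Robinson arithmetic in a fixed model\<close>

locale qmodel =
  fixes M :: "'a arith"
  assumes model: "is_model lang_arith Robinson_Q M"
begin

abbreviation "U \<equiv> univ M"
abbreviation Z ("\<zero>") where "Z \<equiv> ze M"
abbreviation S where "S \<equiv> su M"
abbreviation plus (infixl "\<oplus>" 65) where "x \<oplus> y \<equiv> pl M x y"
abbreviation times (infixl "\<otimes>" 70) where "x \<otimes> y \<equiv> ti M x y"

lemma closed_U [simp]:
  "\<zero> \<in> U" "x \<in> U \<Longrightarrow> S x \<in> U" "x \<in> U \<Longrightarrow> y \<in> U \<Longrightarrow> x \<oplus> y \<in> U" "x \<in> U \<Longrightarrow> y \<in> U \<Longrightarrow> x \<otimes> y \<in> U"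
  using model by (auto simp: is_model_def is_struct_def lang_arith_def ze_def su_def pl_def ti_def)

text \<open>The axioms have no free variables other than 0 and 1.\<close>

lemma sat_Q: "p \<in> Robinson_Q \<Longrightarrow> x \<in> U \<Longrightarrow> y \<in> U \<Longrightarrow> sat M (\<lambda>i. if i = 0 then x else y) p"
  using model by (auto simp: is_model_def image_subset_iff)

lemma Q_succ [simp]:
  "x \<in> U \<Longrightarrow> S x \<noteq> \<zero>" "x \<in> U \<Longrightarrow> \<zero> \<noteq> S x" "x \<in> U \<Longrightarrow> y \<in> U \<Longrightarrow> S x = S y \<longleftrightarrow> x = y"
  using sat_Q[of "Neg (Eq (SuccT (Var 0)) ZeroT)" x x]
    sat_Q[of "Imp (Eq (SuccT (Var 0)) (SuccT (Var 1))) (Eq (Var 0) (Var 1))" x y]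
  by (auto simp: Robinson_Q_def ze_def su_def)

lemma Q_cases: "x \<in> U \<Longrightarrow> x = \<zero> \<or> (\<exists>y\<in>U. x = S y)"
  using sat_Q[of "Imp (Neg (Eq (Var 0) ZeroT)) (Ex 1 (Eq (Var 0) (SuccT (Var 1))))" x x]
  by (auto simp: Robinson_Q_def ze_def su_def)

lemma Q_add [simp]:
  "x \<in> U \<Longrightarrow> x \<oplus> \<zero> = x" "x \<in> U \<Longrightarrow> y \<in> U \<Longrightarrow> x \<oplus> S y = S (x \<oplus> y)"
  using sat_Q[of "Eq (PlusT (Var 0) ZeroT) (Var 0)" x x]
    sat_Q[of "Eq (PlusT (Var 0) (SuccT (Var 1))) (SuccT (PlusT (Var 0) (Var 1)))" x y]
  by (auto simp: Robinson_Q_def ze_def su_def pl_def)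

lemma Q_mult [simp]:
  "x \<in> U \<Longrightarrow> x \<otimes> \<zero> = \<zero>" "x \<in> U \<Longrightarrow> y \<in> U \<Longrightarrow> x \<otimes> S y = x \<otimes> y \<oplus> x"
  using sat_Q[of "Eq (TimesT (Var 0) ZeroT) ZeroT" x x]
    sat_Q[of "Eq (TimesT (Var 0) (SuccT (Var 1))) (PlusT (TimesT (Var 0) (Var 1)) (Var 0))" x y]
  by (auto simp: Robinson_Q_def ze_def su_def pl_def ti_def)

section \<open>The classes on which the algebraic laws hold\<close>

lemma addc_U: "x \<in> addc M \<Longrightarrow> x \<in> U"
  by (simp add: addc_def)

lemma addcD:
  assumes "x \<in> addc M"
  shows "y \<in> U \<Longrightarrow> z \<in> U \<Longrightarrow> y \<oplus> (z \<oplus> x) = y \<oplus> z \<oplus> x"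
    and "y \<in> U \<Longrightarrow> z \<in> U \<Longrightarrow> y \<oplus> x = z \<oplus> x \<longleftrightarrow> y = z"
    and "\<zero> \<oplus> x = x" and "y \<in> U \<Longrightarrow> S y \<oplus> x = S (y \<oplus> x)"
  using assms by (auto simp: addc_def)

lemma addc_Z: "\<zero> \<in> addc M"
  by (auto simp: addc_def)

text \<open>By injectivity of \<open>S\<close> the class is closed under predecessors too, so a
  nonzero difference can be decremented inside it.\<close>

lemma addc_S: "x \<in> U \<Longrightarrow> S x \<in> addc M \<longleftrightarrow> x \<in> addc M"
  by (auto simp: addc_def)

lemma addc_add: "x \<in> addc M \<Longrightarrow> y \<in> addc M \<Longrightarrow> x \<oplus> y \<in> addc M"
proof -
  assume x: "x \<in> addc M" and y: "y \<in> addc M"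
  note [simp] = addc_U[OF x] addc_U[OF y] addcD[OF x] addcD[OF y]
  show "x \<oplus> y \<in> addc M" by (auto simp: addc_def[of M])
qed

definition inductive_cut :: "'a set \<Rightarrow> bool" where
  "inductive_cut A \<longleftrightarrow> A \<subseteq> addc M \<and> \<zero> \<in> A \<and> (\<forall>x\<in>A. S x \<in> A)"

lemma commcD:
  assumes "x \<in> commc M" "y \<in> addc M"
  shows "y \<oplus> x = x \<oplus> y" "\<exists>d\<in>addc M. d \<oplus> x = y \<or> d \<oplus> y = x"
  using assms unfolding commc_def by blast+

lemma commc_addc: "x \<in> commc M \<Longrightarrow> x \<in> addc M"
  by (simp add: commc_def)

lemma commcI:
  assumes "x \<in> addc M" "\<And>y. y \<in> addc M \<Longrightarrow> y \<oplus> x = x \<oplus> y"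
    "\<And>y. y \<in> addc M \<Longrightarrow> \<exists>d\<in>addc M. d \<oplus> x = y \<or> d \<oplus> y = x"
  shows "x \<in> commc M"
  using assms unfolding commc_def by blast

lemma cut_commc: "inductive_cut (commc M)"
proof -
  have "\<exists>d\<in>addc M. d \<oplus> S x = y \<or> d \<oplus> y = S x" if x: "x \<in> commc M" and y: "y \<in> addc M" for x y
  proof -
    have xc: "x \<in> addc M" using x by (simp add: commc_def)
    obtain d where d: "d \<in> addc M" "d \<oplus> x = y \<or> d \<oplus> y = x" using commcD(2)[OF x y] by blast
    show ?thesis
    proof (cases "d \<oplus> y = x")
      case True
      then show ?thesis using d y by (intro bexI[of _ "S d"]) (auto simp: addcD addc_U addc_S)
    next
      case False
      then have dx: "d \<oplus> x = y" using d by simp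
      \<comment> \<open>A nonzero \<open>d\<close> hands one unit over to \<open>x\<close>;
        \<open>d\<close> equal to zero means \<open>y = x\<close>, which \<open>S x\<close> exceeds
        by one.\<close>
      consider "d = \<zero>" | c where "c \<in> U" "d = S c" using Q_cases addc_U d by blast
      then show ?thesis
      proof cases
        case 1
        then show ?thesis using dx xc
          by (intro bexI[of _ "S \<zero>"]) (auto simp: addcD addc_U addc_S addc_Z)
      next
        case 2
        then show ?thesis using dx d xc
          by (intro bexI[of _ c]) (auto simp: addcD addc_U addc_S)
      qed
    qed
  qed
  moreover have "y \<oplus> S x = S x \<oplus> y" if "x \<in> commc M" "y \<in> addc M" for x y
    using that commcD(1)[OF that] by (simp add: addcD addc_U commc_addc)
  ultimately have "S x \<in> commc M" if "x \<in> commc M" for x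
    using that commc_addc[OF that] addc_S[OF addc_U] by (intro commcI) blast+
  moreover have "\<zero> \<in> commc M"
    by (rule commcI) (auto simp: addcD addc_U addc_Z)
  ultimately show ?thesis
    unfolding inductive_cut_def using commc_addc by blast
qed

lemma cut_ldistc: "inductive_cut (ldistc M)"
  unfolding inductive_cut_def ldistc_def
  by (auto simp: addc_Z addc_U addc_S addcD)

lemma ldistcD: "x \<in> ldistc M \<Longrightarrow> y \<in> addc M \<Longrightarrow> z \<in> U \<Longrightarrow> y \<otimes> (z \<oplus> x) = y \<otimes> z \<oplus> y \<otimes> x"
  by (simp add: ldistc_def)

lemma ldistc_addc: "x \<in> ldistc M \<Longrightarrow> x \<in> addc M"
  by (simp add: ldistc_def)

lemma cut_massocc: "inductive_cut (massocc M)"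
  unfolding inductive_cut_def massocc_def
  by (auto simp: addc_Z addc_U ldistc_addc addc_S ldistcD)

lemma cut_multc: "inductive_cut (multc M)"
  unfolding inductive_cut_def multc_def
  by (auto simp: addc_Z addc_U addc_S addc_add)

lemma cut_rdistc: "inductive_cut (rdistc M)"
proof -
  have "(y \<oplus> z) \<otimes> S x = y \<otimes> S x \<oplus> z \<otimes> S x" if x: "x \<in> rdistc M" and y: "y \<in> commc M" and z: "z \<in> addc M" for x y z
  proof -
    have xm: "x \<in> multc M" and d: "(y \<oplus> z) \<otimes> x = y \<otimes> x \<oplus> z \<otimes> x"
      using x y z by (auto simp: rdistc_def)
    have zx: "z \<otimes> x \<in> addc M" and xU: "x \<in> U" using xm z by (auto simp: multc_def addc_U)
    note [simp] = addc_U[OF z] addc_U[OF zx] addc_U[OF commc_addc[OF y]] xU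
    have "(y \<oplus> z) \<otimes> S x = y \<otimes> x \<oplus> (z \<otimes> x \<oplus> y) \<oplus> z"
      by (simp add: d addcD[OF z] addcD[OF commc_addc[OF y]])
    \<comment> \<open>The swap needs \<open>y\<close> in \<open>commc\<close> and \<open>z x\<close>
      in \<open>addc\<close>; the latter is why \<open>rdistc\<close> is taken inside
      \<open>multc\<close>.\<close>
    also have "\<dots> = y \<otimes> x \<oplus> (y \<oplus> z \<otimes> x) \<oplus> z"
      using commcD(1)[OF y zx] by simp
    also have "\<dots> = y \<otimes> S x \<oplus> z \<otimes> S x"
      by (simp add: addcD[OF z] addcD[OF zx])
    finally show ?thesis .
  qed
  note step = this
  have "S x \<in> rdistc M" if x: "x \<in> rdistc M" for x
  proof -
    have "x \<in> multc M" "x \<in> U" "\<zero> \<otimes> x = \<zero>" "S \<zero> \<otimes> x = x"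
      using x by (auto simp: rdistc_def multc_def addc_U)
    then show ?thesis
      unfolding rdistc_def[of M] using step[OF x] cut_multc by (simp add: inductive_cut_def)
  qed
  moreover have "\<zero> \<in> rdistc M"
    using cut_multc by (simp add: rdistc_def inductive_cut_def addc_U commc_addc)
  moreover have "rdistc M \<subseteq> addc M"
    by (auto simp: rdistc_def multc_def)
  ultimately show ?thesis
    unfolding inductive_cut_def by blast
qed

lemma cut_mcommc: "inductive_cut (mcommc M)"
proof -
  have "y \<otimes> S x = S x \<otimes> y" if x: "x \<in> mcommc M" and y: "y \<in> rdistc M" for x y
  proof -
    have xc: "x \<in> commc M" and yU: "y \<in> U" using x y by (auto simp: mcommc_def rdistc_def multc_def addc_U)
    note [simp] = addc_U[OF commc_addc[OF xc]] yU
    \<comment> \<open>Reading \<open>S x\<close> as \<open>x + 1\<close> makes right distributivity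
      at \<open>y\<close> apply.\<close>
    have "S \<zero> \<in> addc M" by (simp add: addc_S addc_Z)
    then have "(x \<oplus> S \<zero>) \<otimes> y = x \<otimes> y \<oplus> S \<zero> \<otimes> y" "S \<zero> \<otimes> y = y"
      using y xc unfolding rdistc_def by blast+
    then show ?thesis using x y by (simp add: mcommc_def)
  qed
  note step = this
  have "S x \<in> mcommc M" if x: "x \<in> mcommc M" for x
  proof -
    have "x \<in> commc M" using x by (simp add: mcommc_def)
    then show ?thesis
      unfolding mcommc_def[of M] using step[OF x] cut_commc by (simp add: inductive_cut_def)
  qed
  moreover have "\<zero> \<in> mcommc M"
    using cut_commc by (simp add: mcommc_def inductive_cut_def rdistc_def multc_def addc_U)
  moreover have "mcommc M \<subseteq> addc M"
    by (auto simp: mcommc_def commc_addc)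
  ultimately show ?thesis
    unfolding inductive_cut_def by blast
qed

lemma cut_lawc: "inductive_cut (lawc M)"
  using cut_commc cut_ldistc cut_massocc cut_rdistc cut_mcommc
  by (auto simp: inductive_cut_def lawc_def)

lemma lawcD:
  assumes "x \<in> lawc M" "y \<in> lawc M" "z \<in> lawc M"
  shows "x \<oplus> y \<oplus> z = x \<oplus> (y \<oplus> z)" "x \<oplus> y = y \<oplus> x" "\<zero> \<oplus> x = x" "x \<oplus> y = z \<oplus> y \<longleftrightarrow> x = z"
    "x \<otimes> y \<otimes> z = x \<otimes> (y \<otimes> z)" "x \<otimes> y = y \<otimes> x" "S \<zero> \<otimes> x = x" "\<zero> \<otimes> x = \<zero>"
    "x \<otimes> (y \<oplus> z) = x \<otimes> y \<oplus> x \<otimes> z"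
proof -
  have m: "w \<in> addc M" "w \<in> commc M" "w \<in> ldistc M" "w \<in> massocc M" "w \<in> rdistc M" "w \<in> mcommc M" "w \<in> U"
    if "w \<in> lawc M" for w
    using that by (auto simp: lawc_def addc_U)
  note x = m[OF assms(1)] and y = m[OF assms(2)] and z = m[OF assms(3)]
  show "x \<oplus> y \<oplus> z = x \<oplus> (y \<oplus> z)" "\<zero> \<oplus> x = x" "x \<oplus> y = z \<oplus> y \<longleftrightarrow> x = z"
    using addcD[OF z(1)] addcD[OF x(1)] addcD[OF y(1)] x(7) y(7) z(7) by simp_all
  show "x \<oplus> y = y \<oplus> x" by (rule commcD(1)[OF y(2) x(1)])
  show "x \<otimes> y \<otimes> z = x \<otimes> (y \<otimes> z)" using z(4) x(1) y(3) unfolding massocc_def by simp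
  show "x \<otimes> y = y \<otimes> x" using y(6) x(5) unfolding mcommc_def by simp
  show "S \<zero> \<otimes> x = x" "\<zero> \<otimes> x = \<zero>" using x(5) by (simp_all add: rdistc_def)
  show "x \<otimes> (y \<oplus> z) = x \<otimes> y \<oplus> x \<otimes> z" by (rule ldistcD[OF z(3) x(1) y(7)])
qed

lemma lawc_addc: "x \<in> lawc M \<Longrightarrow> x \<in> addc M"
  by (simp add: lawc_def)

section \<open>Closure properties of a shortened cut\<close>

context
  fixes Q
  assumes cut: "inductive_cut Q" and Q: "Q \<subseteq> lawc M"
begin

lemma downc_sub: "x \<in> downc M Q \<Longrightarrow> x \<in> Q \<and> x \<in> lawc M \<and> x \<in> addc M"
proof -
  assume x: "x \<in> downc M Q"
  then have xc: "x \<in> addc M" by (simp add: downc_def)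
  then have "x \<in> Q" using x addc_Z addcD(3)[OF xc] unfolding downc_def by blast
  then show ?thesis using xc Q by blast
qed

lemma downc_down:
  assumes "x \<in> downc M Q" "d \<in> addc M" "y \<in> addc M" "d \<oplus> y = x"
  shows "y \<in> downc M Q"
proof -
  have "y' \<in> Q" if "y' \<in> addc M" "d' \<in> addc M" "d' \<oplus> y' = y" for y' d'
  proof -
    have "d \<oplus> d' \<oplus> y' = x" using that assms by (simp add: addcD(1)[symmetric] addc_U)
    then show ?thesis using assms(1,2) that addc_add by (auto simp: downc_def)
  qed
  then show ?thesis using assms by (auto simp: downc_def)
qed

text \<open>A number below \<open>S x\<close> is zero or the successor of a number below
  \<open>x\<close>.\<close>

lemma cut_downc: "inductive_cut (downc M Q)"
proof -
  have "y \<in> Q" if x: "x \<in> downc M Q" and y: "y \<in> addc M" and d: "d \<in> addc M" "d \<oplus> y = S x" for x y d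
  proof -
    have "y = \<zero> \<or> (\<exists>z\<in>U. y = S z)" using Q_cases addc_U y by blast
    then show ?thesis
    proof (elim disjE bexE)
      assume "y = \<zero>" then show ?thesis using cut by (simp add: inductive_cut_def)
    next
      fix z assume z: "z \<in> U" "y = S z"
      have "d \<oplus> z = x" "z \<in> addc M"
        using z d y x addc_U by (auto simp: addc_S downc_def)
      then have "z \<in> Q" using x d by (auto simp: downc_def)
      then show ?thesis using z cut by (simp add: inductive_cut_def)
    qed
  qed
  moreover have "y \<in> Q" if y: "y \<in> addc M" and d: "d \<in> addc M" "d \<oplus> y = \<zero>" for y d
  proof -
    have "y = \<zero>" using Q_cases[of y] d y addc_U by fastforce
    then show ?thesis using cut by (simp add: inductive_cut_def)
  qed
  ultimately show ?thesis
    unfolding inductive_cut_def by (auto simp: downc_def addc_Z addc_S addc_U)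
qed

lemma plusc_sub: "x \<in> plusc M (downc M Q) \<Longrightarrow> x \<in> downc M Q \<and> x \<in> lawc M \<and> x \<in> addc M"
proof -
  assume x: "x \<in> plusc M (downc M Q)"
  then have "\<zero> \<oplus> x \<in> downc M Q" "x \<in> addc M"
    using cut_downc by (auto simp: plusc_def inductive_cut_def)
  then show ?thesis using addcD(3)[of x] downc_sub by auto
qed

lemma cut_plusc: "inductive_cut (plusc M (downc M Q))"
  using cut_downc unfolding inductive_cut_def plusc_def by (auto simp: addc_Z addc_S addc_U subset_iff)

lemma plusc_add: "x \<in> plusc M (downc M Q) \<Longrightarrow> y \<in> plusc M (downc M Q) \<Longrightarrow> x \<oplus> y \<in> plusc M (downc M Q)"
  using downc_sub by (simp add: plusc_def addc_add addcD addc_U)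

text \<open>For every \<open>z\<close> in the class, \<open>z + y\<close> lies below
  \<open>z + x\<close> with the same difference \<open>d\<close>.\<close>

lemma plusc_down:
  assumes x: "x \<in> plusc M (downc M Q)" and d: "d \<in> addc M" "y \<in> addc M" "d \<oplus> y = x"
  shows "y \<in> plusc M (downc M Q)"
proof -
  have "z \<oplus> y \<in> downc M Q" if z: "z \<in> downc M Q" for z
  proof -
    have zc: "z \<in> commc M" "z \<in> addc M" using downc_sub[OF z] by (auto simp: lawc_def)
    have "d \<oplus> (z \<oplus> y) = z \<oplus> x"
      using d zc commcD(1)[OF zc(1) d(1)] by (auto simp: addcD addc_U)
    moreover have "z \<oplus> x \<in> downc M Q" using x z by (simp add: plusc_def)
    ultimately show ?thesis using downc_down d zc addc_add by metis
  qed
  then show ?thesis using d by (simp add: plusc_def)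
qed

lemma shorten_plusc: "x \<in> shorten M Q \<Longrightarrow> x \<in> plusc M (downc M Q)"
  by (simp add: shorten_def timesc_def)

lemma shorten_sub: "x \<in> shorten M Q \<Longrightarrow> x \<in> Q"
  using shorten_plusc plusc_sub downc_sub by blast

lemma shorten_ZS: "\<zero> \<in> shorten M Q" "x \<in> shorten M Q \<Longrightarrow> S x \<in> shorten M Q"
  using cut_plusc plusc_sub plusc_add addc_U
  by (auto simp: inductive_cut_def shorten_def timesc_def)

lemma shorten_add:
  assumes x: "x \<in> shorten M Q" and y: "y \<in> shorten M Q" shows "x \<oplus> y \<in> shorten M Q"
proof -
  have "z \<otimes> (x \<oplus> y) = z \<otimes> x \<oplus> z \<otimes> y" if "z \<in> plusc M (downc M Q)" for z
    using plusc_sub[OF that] plusc_sub[OF shorten_plusc[OF x]] plusc_sub[OF shorten_plusc[OF y]]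
    by (simp add: lawcD)
  then show ?thesis
    using x y plusc_add by (simp add: shorten_def timesc_def)
qed

lemma shorten_mult:
  assumes x: "x \<in> shorten M Q" and y: "y \<in> shorten M Q" shows "x \<otimes> y \<in> shorten M Q"
proof -
  have "z \<otimes> (x \<otimes> y) = z \<otimes> x \<otimes> y" if "z \<in> plusc M (downc M Q)" for z
    using plusc_sub[OF that] plusc_sub[OF shorten_plusc[OF x]] plusc_sub[OF shorten_plusc[OF y]]
    by (simp add: lawcD)
  then show ?thesis
    using x y by (simp add: shorten_def timesc_def)
qed

text \<open>\<open>z y\<close> lies below \<open>z x\<close> with difference \<open>z d\<close>.
  Distributivity must hold at \<open>d\<close> as well, so the sum is first commuted to place
  \<open>d\<close> below \<open>x\<close>.\<close>

lemma shorten_down: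
  assumes x: "x \<in> shorten M Q" and d: "d \<in> addc M" "y \<in> addc M" "d \<oplus> y = x"
  shows "y \<in> shorten M Q"
proof -
  note xp = shorten_plusc[OF x]
  have y: "y \<in> plusc M (downc M Q)" using plusc_down[OF xp d] .
  then have yl: "y \<in> lawc M" using plusc_sub by blast
  have "y \<oplus> d = x" using commcD(1)[of y d] yl d by (simp add: lawc_def)
  then have d': "d \<in> plusc M (downc M Q)" using plusc_down[OF xp d(2,1)] by simp
  have "z \<otimes> y \<in> plusc M (downc M Q)" if z: "z \<in> plusc M (downc M Q)" for z
  proof -
    have zl: "z \<in> lawc M" "d \<in> lawc M" using plusc_sub z d' by auto
    have "z \<otimes> d \<oplus> z \<otimes> y = z \<otimes> x" using lawcD(9)[OF zl yl] d by simp
    moreover have "z \<otimes> d \<in> addc M" "z \<otimes> y \<in> addc M"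
      using zl yl by (auto simp: lawc_def rdistc_def multc_def)
    moreover have "z \<otimes> x \<in> plusc M (downc M Q)" using x z by (simp add: shorten_def timesc_def)
    ultimately show ?thesis using plusc_down by blast
  qed
  then show ?thesis using y by (simp add: shorten_def timesc_def)
qed

end

end

section \<open>Coding finite sets by remainders\<close>

definition numc :: "'a arith \<Rightarrow> 'a set" where
  "numc M = shorten M (lawc M)"

definition leq :: "'a arith \<Rightarrow> 'a \<Rightarrow> 'a \<Rightarrow> bool" where
  "leq M x y \<longleftrightarrow> (\<exists>d\<in>numc M. pl M d x = y)"

text \<open>Cantor's pairing with a square in place of the triangular number, which avoids division
  by two.\<close>

definition pair :: "'a arith \<Rightarrow> 'a \<Rightarrow> 'a \<Rightarrow> 'a" where
  "pair M x y = pl M (ti M (pl M x y) (pl M x y)) x"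

definition modulus :: "'a arith \<Rightarrow> 'a \<Rightarrow> 'a \<Rightarrow> 'a" where
  "modulus M b i = su M (ti M b (su M i))"

text \<open>No bound on \<open>y\<close> is built in: in \<open>elt\<close> the condition that
  \<open>y\<close> is at most \<open>b\<close> keeps it below every modulus.\<close>

definition rem :: "'a arith \<Rightarrow> 'a \<Rightarrow> 'a \<Rightarrow> 'a \<Rightarrow> bool" where
  "rem M a m y \<longleftrightarrow> (\<exists>q\<in>numc M. a = pl M (ti M q m) y)"

text \<open>The coded set consists of the remainders of \<open>a\<close> at the first
  \<open>k\<close> moduli, as far as they are at most \<open>b\<close>; a nonzero \<open>f\<close>
  marks a complement.\<close>

definition code :: "'a arith \<Rightarrow> 'a \<Rightarrow> 'a \<Rightarrow> 'a \<Rightarrow> 'a \<Rightarrow> 'a" where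
  "code M a b k f = pair M a (pair M b (pair M k f))"

definition elt :: "'a arith \<Rightarrow> 'a \<Rightarrow> 'a \<Rightarrow> bool" where
  "elt M y n \<longleftrightarrow> y \<in> numc M \<and>
     (\<exists>a\<in>numc M. \<exists>b\<in>numc M. \<exists>k\<in>numc M. \<exists>f\<in>numc M. n = code M a b k f \<and> leq M y b \<and>
        (\<exists>i\<in>numc M. leq M (su M i) k \<and> rem M a (modulus M b i) y))"

definition flag :: "'a arith \<Rightarrow> 'a \<Rightarrow> bool" where
  "flag M n \<longleftrightarrow>
     (\<exists>a\<in>numc M. \<exists>b\<in>numc M. \<exists>k\<in>numc M. \<exists>f\<in>numc M. n = code M a b k f \<and> f \<noteq> ze M)"

lemma dset_numc [dfb]: "dset numc"
  unfolding numc_def by (rule dset_shorten) (rule dfb)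

lemma dfm_leq [dfb]: "dtm n s \<Longrightarrow> dtm n t \<Longrightarrow> dfm n (\<lambda>M e. leq M (s M e) (t M e))"
  unfolding leq_def by (rule dfb | erule dtm_mono | simp add: dtm_upd)+

lemma dtm_pair [dfb]: "dtm n s \<Longrightarrow> dtm n t \<Longrightarrow> dtm n (\<lambda>M e. pair M (s M e) (t M e))"
  unfolding pair_def by (rule dfb | erule dtm_mono | simp add: dtm_upd)+

lemma dtm_code [dfb]: "dtm n s \<Longrightarrow> dtm n t \<Longrightarrow> dtm n u \<Longrightarrow> dtm n v \<Longrightarrow>
    dtm n (\<lambda>M e. code M (s M e) (t M e) (u M e) (v M e))"
  unfolding code_def by (rule dfb | erule dtm_mono | simp add: dtm_upd)+

lemma dtm_modulus [dfb]: "dtm n s \<Longrightarrow> dtm n t \<Longrightarrow> dtm n (\<lambda>M e. modulus M (s M e) (t M e))"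
  unfolding modulus_def by (rule dfb | erule dtm_mono | simp add: dtm_upd)+

lemma dfm_rem [dfb]: "dtm n s \<Longrightarrow> dtm n t \<Longrightarrow> dtm n u \<Longrightarrow>
    dfm n (\<lambda>M e. rem M (s M e) (t M e) (u M e))"
  unfolding rem_def by (rule dfb | erule dtm_mono | simp add: dtm_upd)+

lemma dfm_elt [dfb]: "dtm n s \<Longrightarrow> dtm n t \<Longrightarrow> dfm n (\<lambda>M e. elt M (s M e) (t M e))"
  unfolding elt_def by (rule dfb | erule dtm_mono | simp add: dtm_upd)+

lemma dfm_flag [dfb]: "dtm n t \<Longrightarrow> dfm n (\<lambda>M e. flag M (t M e))"
  unfolding flag_def by (rule dfb | erule dtm_mono | simp add: dtm_upd)+

context qmodel
begin

section \<open>Arithmetic and order on the cut \<open>J\<close>\<close>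

abbreviation "J \<equiv> numc M"

lemma J_lawc: "x \<in> J \<Longrightarrow> x \<in> lawc M"
  unfolding numc_def using shorten_sub[OF cut_lawc] by simp

lemma J_addc: "x \<in> J \<Longrightarrow> x \<in> addc M"
  using J_lawc lawc_addc by blast

lemma J_U [simp]: "x \<in> J \<Longrightarrow> x \<in> U"
  using J_addc addc_U by blast

lemma J_closed [simp]:
  "\<zero> \<in> J" "x \<in> J \<Longrightarrow> S x \<in> J" "x \<in> J \<Longrightarrow> y \<in> J \<Longrightarrow> x \<oplus> y \<in> J" "x \<in> J \<Longrightarrow> y \<in> J \<Longrightarrow> x \<otimes> y \<in> J"
  unfolding numc_def
  using shorten_ZS[OF cut_lawc] shorten_add[OF cut_lawc] shorten_mult[OF cut_lawc] by simp_all

lemma J_laws: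
  assumes "x \<in> J" "y \<in> J" "z \<in> J"
  shows "x \<oplus> y \<oplus> z = x \<oplus> (y \<oplus> z)" "x \<oplus> y = y \<oplus> x" "\<zero> \<oplus> x = x" "x \<oplus> y = z \<oplus> y \<longleftrightarrow> x = z"
    "x \<otimes> y \<otimes> z = x \<otimes> (y \<otimes> z)" "x \<otimes> y = y \<otimes> x" "S \<zero> \<otimes> x = x" "\<zero> \<otimes> x = \<zero>"
    "x \<otimes> (y \<oplus> z) = x \<otimes> y \<oplus> x \<otimes> z"
  by (rule lawcD[OF J_lawc[OF assms(1)] J_lawc[OF assms(2)] J_lawc[OF assms(3)]])+

lemma J_simps [simp]:
  assumes "x \<in> J"
  shows "\<zero> \<oplus> x = x" "\<zero> \<otimes> x = \<zero>" "y \<in> J \<Longrightarrow> S x \<oplus> y = S (x \<oplus> y)"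
  using assms J_addc addcD(4)[of y x] by (auto simp: J_laws)

lemma J_add_ac:
  assumes "x \<in> J" "y \<in> J"
  shows "x \<oplus> y = y \<oplus> x" "z \<in> J \<Longrightarrow> x \<oplus> y \<oplus> z = x \<oplus> (y \<oplus> z)" "z \<in> J \<Longrightarrow> x \<oplus> (y \<oplus> z) = y \<oplus> (x \<oplus> z)"
proof -
  show c: "x \<oplus> y = y \<oplus> x" using assms J_laws(2) by blast
  show a: "x \<oplus> y \<oplus> z = x \<oplus> (y \<oplus> z)" if "z \<in> J" for z using assms that J_laws(1) by blast
  show "x \<oplus> (y \<oplus> z) = y \<oplus> (x \<oplus> z)" if "z \<in> J"
    using a[OF that] c J_laws(1)[OF assms(2,1) that] by simp
qed

lemma J_mult_ac:
  assumes "x \<in> J" "y \<in> J"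
  shows "x \<otimes> y = y \<otimes> x" "z \<in> J \<Longrightarrow> x \<otimes> y \<otimes> z = x \<otimes> (y \<otimes> z)" "z \<in> J \<Longrightarrow> x \<otimes> (y \<otimes> z) = y \<otimes> (x \<otimes> z)"
proof -
  show c: "x \<otimes> y = y \<otimes> x" using assms J_laws(6) by blast
  show a: "x \<otimes> y \<otimes> z = x \<otimes> (y \<otimes> z)" if "z \<in> J" for z using assms that J_laws(5) by blast
  show "x \<otimes> (y \<otimes> z) = y \<otimes> (x \<otimes> z)" if "z \<in> J"
    using a[OF that] c J_laws(5)[OF assms(2,1) that] by simp
qed

lemma J_distrib:
  assumes "x \<in> J" "y \<in> J" "z \<in> J"
  shows "x \<otimes> (y \<oplus> z) = x \<otimes> y \<oplus> x \<otimes> z" "(y \<oplus> z) \<otimes> x = y \<otimes> x \<oplus> z \<otimes> x"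
proof -
  show d: "x \<otimes> (y \<oplus> z) = x \<otimes> y \<oplus> x \<otimes> z" by (rule J_laws(9)[OF assms])
  have "(y \<oplus> z) \<otimes> x = x \<otimes> (y \<oplus> z)" using assms by (intro J_mult_ac) auto
  then show "(y \<oplus> z) \<otimes> x = y \<otimes> x \<oplus> z \<otimes> x"
    unfolding d using J_mult_ac(1)[OF assms(1,2)] J_mult_ac(1)[OF assms(1,3)] by metis
qed

lemma J_S_mult: "x \<in> J \<Longrightarrow> y \<in> J \<Longrightarrow> S x \<otimes> y = x \<otimes> y \<oplus> y"
  by (simp add: J_mult_ac(1)[of _ y])

lemmas J_semiring = J_add_ac J_mult_ac J_distrib J_S_mult

lemma J_cancel [simp]:
  assumes "x \<in> J" "y \<in> J" "z \<in> J"
  shows "y \<oplus> x = z \<oplus> x \<longleftrightarrow> y = z" "x \<oplus> y = x \<oplus> z \<longleftrightarrow> y = z"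
  using assms J_laws(4) J_laws(2) by metis+

text \<open>Comparability gives a difference in \<open>addc\<close> only. It is a left summand of an
  element of \<open>J\<close>; commuting the sum brings it to the side where downward closure
  applies.\<close>

lemma J_diff:
  assumes "x \<in> J" "y \<in> J"
  shows "\<exists>d\<in>J. d \<oplus> x = y \<or> d \<oplus> y = x"
proof -
  have "x \<in> commc M" using J_lawc[OF assms(1)] by (simp add: lawc_def)
  then obtain d where d: "d \<in> addc M" "d \<oplus> x = y \<or> d \<oplus> y = x"
    using commcD(2) J_addc assms(2) by blast
  have "d \<in> J" if e: "e \<in> J" "d \<oplus> e \<in> J" for e
  proof -
    have "e \<in> commc M" using J_lawc[OF e(1)] by (simp add: lawc_def)
    then have "e \<oplus> d = d \<oplus> e" using commcD(1) d(1) by metis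
    then show ?thesis
      using shorten_down[OF cut_lawc, of "d \<oplus> e" e d] e d(1) J_addc unfolding numc_def by blast
  qed
  then show ?thesis using d assms by blast
qed

text \<open>Irreflexivity of the order, obtained from cancellation.\<close>

lemma J_ne_S: "x \<in> J \<Longrightarrow> y \<in> J \<Longrightarrow> x \<noteq> S (x \<oplus> y)"
proof
  assume x: "x \<in> J" and y: "y \<in> J" and e: "x = S (x \<oplus> y)"
  have "x \<oplus> \<zero> = x \<oplus> S y" using x y e by simp
  then show False using x y J_cancel(2)[of x "\<zero>" "S y"] by simp
qed

lemma leqI: "x \<in> J \<Longrightarrow> d \<in> J \<Longrightarrow> leq M x (d \<oplus> x)"
  unfolding leq_def by blast

lemma leqI': "x \<in> J \<Longrightarrow> d \<in> J \<Longrightarrow> leq M x (x \<oplus> d)"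
  using leqI J_add_ac(1) by metis

lemma leqE: "leq M x y \<Longrightarrow> (\<And>d. d \<in> J \<Longrightarrow> y = d \<oplus> x \<Longrightarrow> thesis) \<Longrightarrow> thesis"
  unfolding leq_def by blast

lemma leq_refl [simp]: "x \<in> J \<Longrightarrow> leq M x x"
  using leqI[of x "\<zero>"] by simp

lemma leq_Z [simp]: "x \<in> J \<Longrightarrow> leq M \<zero> x"
  using leqI[of "\<zero>" x] by simp

lemma leq_trans: "leq M x y \<Longrightarrow> leq M y z \<Longrightarrow> x \<in> J \<Longrightarrow> leq M x z"
proof -
  assume "leq M x y" "leq M y z" and x: "x \<in> J"
  then obtain d c where "d \<in> J" "c \<in> J" "z = c \<oplus> (d \<oplus> x)" by (auto elim!: leqE)
  then show ?thesis using leqI[of x "c \<oplus> d"] x by (simp add: J_add_ac(2))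
qed

lemma leq_S [simp]: "x \<in> J \<Longrightarrow> leq M x (S x)"
  using leqI[of x "S \<zero>"] by simp

lemma leq_S_S [simp]: "x \<in> J \<Longrightarrow> y \<in> J \<Longrightarrow> leq M (S x) (S y) \<longleftrightarrow> leq M x y"
  by (auto simp: leq_def)

lemma not_S_leq: "x \<in> J \<Longrightarrow> \<not> leq M (S x) x"
  by (metis J_U J_closed(2,3) J_ne_S Q_add(2) J_add_ac(1) leqE)

lemma not_S_leq_Z: "x \<in> J \<Longrightarrow> \<not> leq M (S x) \<zero>"
  by (auto elim!: leqE)

lemma leq_cases: "x \<in> J \<Longrightarrow> y \<in> J \<Longrightarrow> leq M x y \<or> leq M (S y) x"
proof -
  assume x: "x \<in> J" and y: "y \<in> J"
  obtain d where d: "d \<in> J" "d \<oplus> x = y \<or> d \<oplus> y = x" using J_diff[OF x y] by blast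
  then consider "leq M x y" | "d \<oplus> y = x" "d = \<zero>" | e where "e \<in> U" "d = S e" "d \<oplus> y = x"
    using Q_cases[of d] leqI x by auto
  then show ?thesis
  proof cases
    case 3
    have "e \<in> J"
    proof -
      have "S \<zero> \<oplus> e = d" "e \<in> addc M" using 3 d J_addc[OF d(1)] addc_S addc_add
        by (auto simp: addcD)
      moreover have "S \<zero> \<in> addc M" by (rule J_addc) simp
      ultimately show ?thesis
        using shorten_down[OF cut_lawc, of d "S \<zero>" e] d(1) unfolding numc_def by blast
    qed
    then show ?thesis using 3 y leqI[of "S y" e] by simp
  qed (use x y in auto)
qed

lemma leq_antisym: "leq M x y \<Longrightarrow> leq M y x \<Longrightarrow> x \<in> J \<Longrightarrow> y \<in> J \<Longrightarrow> x = y"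
proof (rule ccontr)
  assume a: "leq M x y" "leq M y x" "x \<in> J" "y \<in> J" "x \<noteq> y"
  obtain d where d: "d \<in> J" "y = d \<oplus> x" using a by (auto elim: leqE)
  have "\<not> leq M d \<zero>"
  proof
    assume "leq M d \<zero>"
    then obtain e where "e \<in> J" "\<zero> = e \<oplus> d" by (auto elim: leqE)
    then have "d = \<zero>" using Q_cases[of d] d(1) by fastforce
    then show False using a d by simp
  qed
  then have "leq M (S \<zero>) d" using leq_cases[of d "\<zero>"] d by simp
  then obtain e where e: "e \<in> J" "d = e \<oplus> S \<zero>" by (auto elim: leqE)
  then have "leq M (S x) y" using d a(3) leqI[of "S x" e] by simp
  then show False using leq_trans a not_S_leq by (meson J_closed(2))
qed

lemma leq_S_iff: "x \<in> J \<Longrightarrow> y \<in> J \<Longrightarrow> leq M x (S y) \<longleftrightarrow> leq M x y \<or> x = S y"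
  using leq_cases[of x y] leq_antisym[of x "S y"] leq_trans[of x y "S y"] by auto

lemma J_down_shorten:
  assumes "inductive_cut Q" "Q \<subseteq> lawc M" "x \<in> shorten M Q" "leq M y x" "y \<in> J"
  shows "y \<in> shorten M Q"
  using assms(4) shorten_down[OF assms(1-3)] J_addc assms(5) by (blast elim: leqE)

section \<open>Pairing and the size of codes\<close>

lemma pair_J [simp]: "x \<in> J \<Longrightarrow> y \<in> J \<Longrightarrow> pair M x y \<in> J"
  by (simp add: pair_def)

text \<open>With \<open>s = x + y\<close>, the value \<open>s^2 + x\<close> stays below
  \<open>(s + 1)^2\<close> because \<open>x\<close> is at most \<open>s\<close>.\<close>

lemma pair_sum_less:
  assumes J: "x \<in> J" "y \<in> J" "x' \<in> J" "y' \<in> J" and l: "leq M (S (x \<oplus> y)) (x' \<oplus> y')"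
  shows "pair M x y \<noteq> pair M x' y'"
proof
  assume e: "pair M x y = pair M x' y'"
  obtain d where d: "d \<in> J" "x' \<oplus> y' = d \<oplus> S (x \<oplus> y)" using l by (auto elim: leqE)
  define s where "s = x \<oplus> y"
  have s: "s \<in> J" using J by (simp add: s_def)
  have "s \<otimes> s \<oplus> x = (d \<oplus> S s) \<otimes> (d \<oplus> S s) \<oplus> x'"
    using e d by (simp add: pair_def s_def)
  also have "\<dots> = s \<otimes> s \<oplus> (x \<oplus> S (y \<oplus> s \<oplus> d \<otimes> (d \<oplus> S s) \<oplus> s \<otimes> d \<oplus> d \<oplus> x'))"
  proof -
    have "\<dots> = s \<otimes> s \<oplus> (s \<oplus> S (s \<oplus> d \<otimes> (d \<oplus> S s) \<oplus> s \<otimes> d \<oplus> d \<oplus> x'))"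
      using s d J by (simp add: J_semiring)
    then show ?thesis using J d by (simp add: s_def J_add_ac)
  qed
  finally have "x = x \<oplus> S (y \<oplus> s \<oplus> d \<otimes> (d \<oplus> S s) \<oplus> s \<otimes> d \<oplus> d \<oplus> x')"
    by (subst (asm) J_cancel(2)) (use s d J in simp_all)
  then show False
    using J_ne_S[of x "y \<oplus> s \<oplus> d \<otimes> (d \<oplus> S s) \<oplus> s \<otimes> d \<oplus> d \<oplus> x'"] s d J by simp
qed

lemma pair_inj:
  assumes J: "x \<in> J" "y \<in> J" "x' \<in> J" "y' \<in> J"
  shows "pair M x y = pair M x' y' \<longleftrightarrow> x = x' \<and> y = y'"
proof
  assume e: "pair M x y = pair M x' y'"
  have "x \<oplus> y = x' \<oplus> y'"
    using pair_sum_less[OF J] pair_sum_less[OF J(3,4,1,2)] e leq_cases[of "x \<oplus> y" "x' \<oplus> y'"]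
      leq_cases[of "x' \<oplus> y'" "x \<oplus> y"] leq_antisym[of "x \<oplus> y" "x' \<oplus> y'"] J by auto
  then show "x = x' \<and> y = y'" using e J by (auto simp: pair_def)
qed simp

lemma code_inj:
  assumes "a \<in> J" "b \<in> J" "k \<in> J" "f \<in> J" "a' \<in> J" "b' \<in> J" "k' \<in> J" "f' \<in> J"
  shows "code M a b k f = code M a' b' k' f' \<longleftrightarrow> a = a' \<and> b = b' \<and> k = k' \<and> f = f'"
  using assms by (simp add: code_def pair_inj)

lemma leq_pair: "x \<in> J \<Longrightarrow> y \<in> J \<Longrightarrow> leq M x (pair M x y)" "x \<in> J \<Longrightarrow> y \<in> J \<Longrightarrow> leq M y (pair M x y)"
proof -
  assume J: "x \<in> J" "y \<in> J"
  show "leq M x (pair M x y)" using J by (simp add: pair_def leqI)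
  have "y = \<zero> \<or> leq M (S \<zero>) y" using leq_cases[of y "\<zero>"] leq_antisym[of y "\<zero>"] J by auto
  then show "leq M y (pair M x y)"
  proof
    assume "leq M (S \<zero>) y"
    then obtain u where u: "u \<in> J" "y = S u" by (auto elim!: leqE)
    have "pair M x y = (x \<oplus> x \<oplus> u \<otimes> (x \<oplus> y) \<oplus> x \<otimes> (x \<oplus> y)) \<oplus> y"
      using u J by (simp add: pair_def J_semiring)
    then show ?thesis using u J leqI by simp
  qed (use J in simp)
qed

text \<open>An element exists only if \<open>k\<close> is positive; then \<open>pair M k f\<close>
  is positive, so \<open>n\<close> exceeds \<open>b\<close> and hence \<open>y\<close>. This keeps
  elements inside the cut (\<open>elt_I\<close>) and excludes self-membership
  (\<open>not_elt_self\<close>).\<close>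

lemma elt_less: "elt M y n \<Longrightarrow> leq M (S y) n"
proof -
  assume "elt M y n"
  then obtain a b k f i where J: "y \<in> J" "a \<in> J" "b \<in> J" "k \<in> J" "f \<in> J" "i \<in> J"
    and n: "n = code M a b k f" and yb: "leq M y b" and ik: "leq M (S i) k"
    unfolding elt_def by blast
  have "leq M (S i) (pair M k f)" using ik leq_pair(1)[of k f] J leq_trans by (meson J_closed(2))
  then obtain d where d: "d \<in> J" "pair M k f = S (d \<oplus> i)" using J by (auto elim!: leqE)
  define u where "u = d \<oplus> i"
  have u: "u \<in> J" "pair M k f = S u" using d J by (auto simp: u_def)
  have "pair M b (S u) = (b \<oplus> b \<oplus> u \<oplus> b \<otimes> (b \<oplus> u) \<oplus> u \<otimes> (b \<oplus> u) \<oplus> u) \<oplus> S b"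
    using u J by (simp add: pair_def J_semiring)
  then have "leq M (S b) (pair M b (S u))" using u J leqI by simp
  moreover have "leq M (S y) (S b)" using yb J by simp
  moreover have "leq M (pair M b (S u)) n" using J u by (simp add: n code_def leq_pair)
  ultimately show ?thesis using J leq_trans by (meson J_closed(2))
qed

section \<open>Remainders and the identities behind the Chinese remainder theorem\<close>

lemma modulus_J [simp]: "b \<in> J \<Longrightarrow> i \<in> J \<Longrightarrow> modulus M b i \<in> J"
  by (simp add: modulus_def)

lemma less_modulus: "leq M y b \<Longrightarrow> y \<in> J \<Longrightarrow> b \<in> J \<Longrightarrow> i \<in> J \<Longrightarrow> leq M (S y) (modulus M b i)"
  using leq_trans[of y b "b \<otimes> i \<oplus> b"] leqI[of b "b \<otimes> i"] by (simp add: modulus_def)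

text \<open>If \<open>q\<close> exceeded \<open>q'\<close>, cancellation would leave
  \<open>y'\<close> at least \<open>m\<close>. No bound on \<open>y\<close> is assumed, which
  \<open>rem_shift\<close> exploits.\<close>

lemma quotient_mono:
  assumes J: "q \<in> J" "q' \<in> J" "m \<in> J" "y \<in> J" "y' \<in> J"
    and e: "q \<otimes> m \<oplus> y = q' \<otimes> m \<oplus> y'" and y': "leq M (S y') m"
  shows "leq M q q'"
proof (rule ccontr)
  assume "\<not> leq M q q'"
  then have "leq M (S q') q" using leq_cases[of q q'] J by blast
  then obtain d where d: "d \<in> J" "q = d \<oplus> S q'" by (auto elim: leqE)
  obtain c where c: "c \<in> J" "m = c \<oplus> S y'" using y' by (auto elim: leqE)
  have "q \<otimes> m = q' \<otimes> m \<oplus> (d \<otimes> m \<oplus> m)" using d J by (simp add: J_semiring)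
  then have "q \<otimes> m \<oplus> y = q' \<otimes> m \<oplus> (d \<otimes> m \<oplus> m \<oplus> y)" using d J by (simp add: J_add_ac)
  then have "d \<otimes> m \<oplus> m \<oplus> y = y'" using e d J by simp
  then have "y' = S (y' \<oplus> (d \<otimes> m \<oplus> c \<oplus> y))" using c d J by (simp add: J_add_ac)
  then show False using J_ne_S[of y' "d \<otimes> m \<oplus> c \<oplus> y"] c d J by simp
qed

lemma rem_unique:
  assumes "rem M a m y" "rem M a m y'" "leq M (S y) m" "leq M (S y') m" "m \<in> J" "y \<in> J" "y' \<in> J"
  shows "y = y'"
proof -
  obtain q q' where q: "q \<in> J" "a = q \<otimes> m \<oplus> y" "q' \<in> J" "a = q' \<otimes> m \<oplus> y'"
    using assms(1,2) unfolding rem_def by blast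
  have "leq M q q'" "leq M q' q"
    using quotient_mono[of q q' m y y'] quotient_mono[of q' q m y' y] q assms by auto
  then have "q = q'" using leq_antisym q by blast
  then show ?thesis using q assms by simp
qed

text \<open>The converse has to subtract \<open>c\<close> from the quotient;
  \<open>quotient_mono\<close>, with \<open>a\<close> in the place of a remainder, shows that the
  quotient is at least \<open>c\<close>.\<close>

lemma rem_shift:
  assumes J: "a \<in> J" "m \<in> J" "c \<in> J" "y \<in> J" and y: "leq M (S y) m"
  shows "rem M (a \<oplus> c \<otimes> m) m y \<longleftrightarrow> rem M a m y"
proof
  assume "rem M a m y"
  then obtain q where "q \<in> J" "a = q \<otimes> m \<oplus> y" unfolding rem_def by blast
  then show "rem M (a \<oplus> c \<otimes> m) m y"
    using J unfolding rem_def by (intro bexI[of _ "q \<oplus> c"]) (simp_all add: J_semiring)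
next
  assume "rem M (a \<oplus> c \<otimes> m) m y"
  then obtain q where q: "q \<in> J" "a \<oplus> c \<otimes> m = q \<otimes> m \<oplus> y" unfolding rem_def by blast
  then have "c \<otimes> m \<oplus> a = q \<otimes> m \<oplus> y" using J by (simp add: J_add_ac)
  then have "leq M c q" using quotient_mono[of c q m a y] q J y by blast
  then obtain d where d: "d \<in> J" "q = d \<oplus> c" by (auto elim: leqE)
  have "q \<otimes> m \<oplus> y = d \<otimes> m \<oplus> y \<oplus> c \<otimes> m" using d J by (simp add: J_semiring)
  then have "a = d \<otimes> m \<oplus> y" using q d J by simp
  then show "rem M a m y" using d unfolding rem_def by blast
qed

text \<open>Modulo \<open>m = l + 1\<close> the number \<open>l a\<close> stands for
  \<open>-a\<close> and \<open>w u\<close> for 1, so the summand added to \<open>a\<close> is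
  congruent to \<open>y - a\<close>, without any subtraction.\<close>

lemma crt_identity:
  assumes J: "a \<in> J" "w \<in> J" "u \<in> J" "v \<in> J" "m \<in> J" "y \<in> J"
    and c: "w \<otimes> u = S (m \<otimes> v)" and m: "m = S l" "l \<in> J"
  shows "a \<oplus> w \<otimes> (u \<otimes> (y \<oplus> l \<otimes> a)) = (a \<oplus> v \<otimes> (y \<oplus> l \<otimes> a)) \<otimes> m \<oplus> y"
proof -
  have "w \<otimes> (u \<otimes> (y \<oplus> l \<otimes> a)) = w \<otimes> u \<otimes> (y \<oplus> l \<otimes> a)"
    using J m(2) J_mult_ac(2)[of w u "y \<oplus> l \<otimes> a"] by simp
  also have "\<dots> = S (m \<otimes> v) \<otimes> (y \<oplus> l \<otimes> a)" by (simp only: c)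
  finally show ?thesis using J m(2) unfolding m(1) by (simp add: J_semiring)
qed

text \<open>With \<open>b = d c\<close>, the moduli at positions \<open>k\<close> and \<open>k + d\<close> are coprime: both sides below are
  explicit multiples of them that differ by one.\<close>

lemma coprime_identity:
  assumes J: "d \<in> J" "c \<in> J" "k \<in> J"
  defines "b \<equiv> d \<otimes> c" and "n \<equiv> S k" and "N \<equiv> S k \<oplus> d"
  shows "S (b \<otimes> n) \<otimes> S (b \<otimes> (c \<otimes> (N \<otimes> (N \<otimes> N))) \<oplus> b \<otimes> N) =
         S (S (b \<otimes> N) \<otimes> (b \<otimes> (c \<otimes> (n \<otimes> (N \<otimes> N))) \<oplus> b \<otimes> N \<oplus> b \<otimes> n))"
proof -
  have n: "n \<in> J" "N = n \<oplus> d" using J by (auto simp: n_def N_def b_def)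
  then show ?thesis unfolding n(2) using n(1) J by (simp add: J_semiring b_def)
qed

end

section \<open>Least codes and encodable sets\<close>

definition same :: "'a arith \<Rightarrow> 'a \<Rightarrow> 'a \<Rightarrow> bool" where
  "same M n m \<longleftrightarrow> (\<forall>y\<in>numc M. elt M y n \<longleftrightarrow> elt M y m) \<and> (flag M n \<longleftrightarrow> flag M m)"

definition canon :: "'a arith \<Rightarrow> 'a \<Rightarrow> bool" where
  "canon M n \<longleftrightarrow> (\<forall>m\<in>numc M. same M n m \<longrightarrow> leq M n m)"

text \<open>The least number principle for equivalent codes, turned into a class: it holds for all
  codes up to \<open>x\<close>.\<close>

definition leastc :: "'a arith \<Rightarrow> 'a set" where
  "leastc M = {x \<in> numc M. \<forall>n\<in>numc M. leq M n x \<longrightarrow> (\<exists>m\<in>numc M. leq M m n \<and> same M n m \<and> canon M m)}"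

definition setc :: "'a arith \<Rightarrow> 'a set" where
  "setc M = shorten M (leastc M)"

text \<open>A substitute for being a multiple of the factorial of \<open>k\<close>, which cannot be
  formed by recursion here.\<close>

definition divisible :: "'a arith \<Rightarrow> 'a \<Rightarrow> 'a \<Rightarrow> bool" where
  "divisible M k b \<longleftrightarrow>
     (\<forall>i\<in>setc M. leq M (su M (ze M)) i \<and> leq M i k \<longrightarrow> (\<exists>c\<in>setc M. b = ti M i c))"

text \<open>Bezout's identity without subtraction: \<open>u\<close> inverts \<open>w\<close> modulo
  \<open>m\<close>.\<close>

definition copr :: "'a arith \<Rightarrow> 'a \<Rightarrow> 'a \<Rightarrow> bool" where
  "copr M w m \<longleftrightarrow> (\<exists>u\<in>setc M. \<exists>v\<in>setc M. ti M w u = su M (ti M m v))"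

text \<open>\<open>w\<close> stands for the product of the first \<open>k\<close> moduli. Since no
  recursion defines that product, only the two facts used to add a remainder are recorded: it is a
  multiple of these moduli and coprime to the later ones.\<close>

definition enc :: "'a arith \<Rightarrow> 'a \<Rightarrow> 'a \<Rightarrow> 'a \<Rightarrow> 'a \<Rightarrow> ('a \<Rightarrow> bool) \<Rightarrow> bool" where
  "enc M b k a w X \<longleftrightarrow>
     (\<forall>j\<in>setc M. leq M k j \<and> divisible M j b \<longrightarrow> copr M w (modulus M b j)) \<and>
     (\<forall>i\<in>setc M. leq M (su M i) k \<longrightarrow> (\<exists>c\<in>setc M. w = ti M c (modulus M b i))) \<and>
     (\<forall>y\<in>numc M. X y \<longleftrightarrow> leq M y b \<and> (\<exists>i\<in>numc M. leq M (su M i) k \<and> rem M a (modulus M b i) y))"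

text \<open>A set is encodable if some number \<open>k\<close> of remainders suffices to code it with respect to every
  sufficiently divisible \<open>b\<close>. As \<open>b\<close> is arbitrary, adding an element never requires
  recoding the set.\<close>

definition encodable :: "'a arith \<Rightarrow> ('a \<Rightarrow> bool) \<Rightarrow> bool" where
  "encodable M X \<longleftrightarrow> (\<exists>k\<in>setc M. (\<exists>b\<in>setc M. b \<noteq> ze M \<and> divisible M k b) \<and>
     (\<forall>b\<in>setc M. divisible M k b \<and> (\<forall>y\<in>numc M. X y \<longrightarrow> leq M y b) \<longrightarrow>
        (\<exists>a\<in>setc M. \<exists>w\<in>setc M. enc M b k a w X)))"

lemma dfm_same [dfb]: "dtm n s \<Longrightarrow> dtm n t \<Longrightarrow> dfm n (\<lambda>M e. same M (s M e) (t M e))"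
  unfolding same_def by (rule dfb | erule dtm_mono | simp add: dtm_upd)+

lemma dfm_canon [dfb]: "dtm n t \<Longrightarrow> dfm n (\<lambda>M e. canon M (t M e))"
  unfolding canon_def by (rule dfb | erule dtm_mono | simp add: dtm_upd)+

lemma dset_leastc [dfb]: "dset leastc"
  unfolding leastc_def
  by (rule dset_Collect) (rule dfb | erule dtm_mono | simp add: dtm_upd)+

lemma dset_setc [dfb]: "dset setc"
  unfolding setc_def by (rule dset_shorten) (rule dfb)

lemma dfm_divisible [dfb]: "dtm n s \<Longrightarrow> dtm n t \<Longrightarrow> dfm n (\<lambda>M e. divisible M (s M e) (t M e))"
  unfolding divisible_def by (rule dfb | erule dtm_mono | simp add: dtm_upd)+

lemma dfm_copr [dfb]: "dtm n s \<Longrightarrow> dtm n t \<Longrightarrow> dfm n (\<lambda>M e. copr M (s M e) (t M e))"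
  unfolding copr_def by (rule dfb | erule dtm_mono | simp add: dtm_upd)+

lemma dfm_encodable [dfb]: "dtm n t \<Longrightarrow> dfm n (\<lambda>M e. encodable M (\<lambda>y. elt M y (t M e)))"
  unfolding encodable_def enc_def by (rule dfb | erule dtm_mono | simp add: dtm_upd)+

context qmodel
begin

abbreviation "I \<equiv> setc M"

section \<open>Least codes and the cut \<open>I\<close>\<close>

lemma same_refl: "same M n n"
  by (simp add: same_def)

lemma same_sym: "same M n m \<Longrightarrow> same M m n"
  by (auto simp: same_def)

lemma same_trans: "same M n m \<Longrightarrow> same M m k \<Longrightarrow> same M n k"
  by (simp add: same_def)

text \<open>A code \<open>n\<close> up to \<open>S x\<close> is either equivalent to some code up to
  \<open>x\<close> that is not above \<open>n\<close>, and then the class provides the least one, or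
  it is \<open>S x\<close> itself and nothing smaller is equivalent to it.\<close>

lemma cut_leastc: "inductive_cut (leastc M)" "leastc M \<subseteq> lawc M"
proof -
  have "S x \<in> leastc M" if x: "x \<in> leastc M" for x
  proof -
    have xJ: "x \<in> J" using x by (simp add: leastc_def)
    have "\<exists>m\<in>J. leq M m n \<and> same M n m \<and> canon M m" if n: "n \<in> J" "leq M n (S x)" for n
    proof (cases "\<exists>n'\<in>J. leq M n' x \<and> leq M n' n \<and> same M n n'")
      case True
      then obtain n' where n': "n' \<in> J" "leq M n' x" "leq M n' n" "same M n n'" by blast
      then obtain m where m: "m \<in> J" "leq M m n'" "same M n' m" "canon M m"
        using x by (auto simp: leastc_def)
      then show ?thesis using n' same_trans leq_trans by blast
    next
      case False
      then have "\<not> leq M n x" using n same_refl by auto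
      then have nx: "n = S x" using leq_S_iff n xJ by blast
      have "leq M n m" if "m \<in> J" "same M n m" for m
      proof (rule ccontr)
        assume "\<not> leq M n m"
        then have "leq M (S m) (S x)" "leq M m n"
          using leq_cases[of n m] leq_trans[of m "S m" n] n that nx by auto
        then have "leq M m x" "leq M m n" using that xJ by auto
        then show False using False that by blast
      qed
      then show ?thesis using n same_refl by (auto simp: canon_def)
    qed
    then show ?thesis using xJ by (simp add: leastc_def)
  qed
  moreover have "\<zero> \<in> leastc M"
  proof -
    have "n = \<zero>" if "n \<in> J" "leq M n \<zero>" for n using leq_antisym that by simp
    moreover have "canon M \<zero>" by (simp add: canon_def)
    ultimately show ?thesis
      unfolding leastc_def using same_refl[of "\<zero>"] leq_refl[of "\<zero>"] by (blast intro: J_closed(1))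
  qed
  moreover have sub: "leastc M \<subseteq> J" unfolding leastc_def by blast
  moreover have "J \<subseteq> addc M" using J_addc by blast
  ultimately show "inductive_cut (leastc M)"
    unfolding inductive_cut_def by blast
  show "leastc M \<subseteq> lawc M" using sub J_lawc by blast
qed

lemma I_J [simp]: "x \<in> I \<Longrightarrow> x \<in> J"
proof -
  assume "x \<in> I"
  then have "x \<in> leastc M" unfolding setc_def by (rule shorten_sub[OF cut_leastc])
  then show ?thesis unfolding leastc_def by blast
qed

lemma I_closed [simp]:
  "\<zero> \<in> I" "x \<in> I \<Longrightarrow> S x \<in> I" "x \<in> I \<Longrightarrow> y \<in> I \<Longrightarrow> x \<oplus> y \<in> I" "x \<in> I \<Longrightarrow> y \<in> I \<Longrightarrow> x \<otimes> y \<in> I"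
  unfolding setc_def
  using shorten_ZS[OF cut_leastc] shorten_add[OF cut_leastc] shorten_mult[OF cut_leastc] by simp_all

lemma I_down: "x \<in> I \<Longrightarrow> leq M y x \<Longrightarrow> y \<in> J \<Longrightarrow> y \<in> I"
  unfolding setc_def using J_down_shorten[OF cut_leastc] by simp

lemma I_down_less: "x \<in> I \<Longrightarrow> leq M (S y) x \<Longrightarrow> y \<in> J \<Longrightarrow> y \<in> I"
  using I_down[of x y] leq_trans[of y "S y" x] by simp

lemma canon_exists:
  assumes "n \<in> I"
  shows "\<exists>m\<in>I. same M n m \<and> canon M m"
proof -
  have "n \<in> leastc M" using assms shorten_sub[OF cut_leastc] by (simp add: setc_def)
  then obtain m where "m \<in> J" "leq M m n" "same M n m" "canon M m"
    using I_J[OF assms] leq_refl unfolding leastc_def by blast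
  then show ?thesis using I_down assms by blast
qed

lemma canon_unique:
  "canon M n \<Longrightarrow> canon M m \<Longrightarrow> same M n m \<Longrightarrow> n \<in> I \<Longrightarrow> m \<in> I \<Longrightarrow> n = m"
  using leq_antisym same_sym unfolding canon_def by (meson I_J)

lemma elt_I: "elt M y n \<Longrightarrow> n \<in> I \<Longrightarrow> y \<in> I"
  using elt_less[of y n] I_down_less[of n y] by (simp add: elt_def)

lemma modulus_I [simp]: "b \<in> I \<Longrightarrow> i \<in> I \<Longrightarrow> modulus M b i \<in> I"
  by (simp add: modulus_def)

lemma code_I: "a \<in> I \<Longrightarrow> b \<in> I \<Longrightarrow> k \<in> I \<Longrightarrow> f \<in> I \<Longrightarrow> code M a b k f \<in> I"
  by (simp add: code_def pair_def)

lemma elt_code: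
  assumes "a \<in> J" "b \<in> J" "k \<in> J" "f \<in> J"
  shows "elt M y (code M a b k f) \<longleftrightarrow>
    y \<in> J \<and> leq M y b \<and> (\<exists>i\<in>J. leq M (S i) k \<and> rem M a (modulus M b i) y)"
  unfolding elt_def using assms by (auto simp: code_inj)

lemma flag_code:
  assumes "a \<in> J" "b \<in> J" "k \<in> J" "f \<in> J"
  shows "flag M (code M a b k f) \<longleftrightarrow> f \<noteq> \<zero>"
  unfolding flag_def using assms by (auto simp: code_inj)

section \<open>Divisibility, coprime moduli and adjunction to encodable sets\<close>

lemma divisible_mono: "divisible M k b \<Longrightarrow> leq M j k \<Longrightarrow> divisible M j b"
  unfolding divisible_def using leq_trans by (meson I_J)

lemma divisible_mult:
  assumes "divisible M k b" "c \<in> I" "b \<in> I" shows "divisible M k (b \<otimes> c)"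
  unfolding divisible_def
proof (intro ballI impI)
  fix i assume i: "i \<in> I" "leq M (S \<zero>) i \<and> leq M i k"
  then obtain d where "d \<in> I" "b = i \<otimes> d" using assms unfolding divisible_def by blast
  then show "\<exists>d\<in>I. b \<otimes> c = i \<otimes> d" using i assms
    by (intro bexI[of _ "d \<otimes> c"]) (simp_all add: J_mult_ac)
qed

lemma divisible_Suc:
  assumes d: "divisible M k b" and k: "k \<in> I" and b: "b \<in> I" shows "divisible M (S k) (b \<otimes> S k)"
  unfolding divisible_def
proof (intro ballI impI)
  fix i assume i: "i \<in> I" "leq M (S \<zero>) i \<and> leq M i (S k)"
  then consider "leq M i k" | "i = S k" using leq_S_iff k by auto
  then show "\<exists>c\<in>I. b \<otimes> S k = i \<otimes> c"
  proof cases
    case 1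
    then show ?thesis
      using divisible_mult[OF d I_closed(2)[OF k] b] i unfolding divisible_def by blast
  next
    case 2
    then show ?thesis using k b by (intro bexI[of _ b]) (simp_all add: J_semiring)
  qed
qed

lemma copr_mult:
  assumes "copr M w m" "copr M w' m" "w \<in> I" "w' \<in> I" "m \<in> I"
  shows "copr M (w \<otimes> w') m"
proof -
  obtain u v u' v' where J: "u \<in> I" "v \<in> I" "u' \<in> I" "v' \<in> I"
    and e: "w \<otimes> u = S (m \<otimes> v)" "w' \<otimes> u' = S (m \<otimes> v')"
    using assms unfolding copr_def by blast
  have "w \<otimes> w' \<otimes> (u \<otimes> u') = (w \<otimes> u) \<otimes> (w' \<otimes> u')" using J assms by (simp add: J_mult_ac)
  also have "\<dots> = S (m \<otimes> v) \<otimes> S (m \<otimes> v')" by (simp only: e)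
  also have "\<dots> = S (m \<otimes> (v \<oplus> v' \<oplus> m \<otimes> (v \<otimes> v')))" using J assms by (simp add: J_semiring)
  finally show ?thesis
    unfolding copr_def using J assms
    by (intro bexI[of _ "u \<otimes> u'"] bexI[of _ "v \<oplus> v' \<oplus> m \<otimes> (v \<otimes> v')"]) simp_all
qed

lemma copr_moduli:
  assumes k: "k \<in> I" and j: "j \<in> I" and b: "b \<in> I" and kj: "leq M (S k) j" and dv: "divisible M j b"
  shows "copr M (modulus M b k) (modulus M b j)"
proof -
  obtain d' where d': "d' \<in> J" "j = d' \<oplus> S k" using kj by (auto elim: leqE)
  define d where "d = S d'"
  have d: "d \<in> J" "j = k \<oplus> d" using d' k by (auto simp: d_def J_add_ac)
  have dj: "leq M d j" using d k leqI[of d k] by simp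
  have dI: "d \<in> I" using I_down[OF j dj] d by simp
  \<comment> \<open>The distance \<open>d\<close> of the two positions is positive and at most
    \<open>j\<close>, so it divides \<open>b\<close>: this is the purpose of
    \<open>divisible\<close>.\<close>
  have "leq M (S \<zero>) d" using d' by (simp add: d_def)
  then obtain c where c: "c \<in> I" "b = d \<otimes> c" using dv dI dj unfolding divisible_def by blast
  have Sj: "S j = S k \<oplus> d" using d k by simp
  define N where "N = S k \<oplus> d"
  have NI: "N \<in> I" using k dI by (simp add: N_def)
  \<comment> \<open>Write \<open>m\<close>, \<open>m'\<close> for the moduli at \<open>k\<close> and
    \<open>j\<close>, and \<open>n\<close> for \<open>S k\<close>. Then
    \<open>N m - n m' = d\<close>, and multiplying by \<open>c\<close> gives \<open>b\<close>. A
    further factor \<open>b N^2\<close> gives \<open>b^2 N^2\<close>, which is 1 modulo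
    \<open>m'\<close> because \<open>b N\<close> is -1 there. Adding \<open>m m'\<close> on both
    sides makes all coefficients visibly nonnegative.\<close>
  have "modulus M b k \<otimes> S (b \<otimes> (c \<otimes> (N \<otimes> (N \<otimes> N))) \<oplus> b \<otimes> N) =
      S (modulus M b j \<otimes> (b \<otimes> (c \<otimes> (S k \<otimes> (N \<otimes> N))) \<oplus> b \<otimes> N \<oplus> b \<otimes> S k))"
    unfolding modulus_def Sj N_def c(2) by (rule coprime_identity[OF d(1) I_J[OF c(1)] I_J[OF k]])
  moreover have "S (b \<otimes> (c \<otimes> (N \<otimes> (N \<otimes> N))) \<oplus> b \<otimes> N) \<in> I"
    "b \<otimes> (c \<otimes> (S k \<otimes> (N \<otimes> N))) \<oplus> b \<otimes> N \<oplus> b \<otimes> S k \<in> I"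
    using NI k c(1) b by simp_all
  ultimately show ?thesis
    unfolding copr_def by blast
qed

text \<open>One step of the Chinese remainder theorem: changing \<open>a\<close> by a multiple of
  \<open>w\<close> keeps the first \<open>k\<close> remainders, and the multiple is chosen to make
  the next remainder \<open>x\<close>.\<close>

lemma enc_add:
  assumes e: "enc M b k a w X" and I: "b \<in> I" "k \<in> I" "a \<in> I" "w \<in> I" "x \<in> I"
    and dv: "divisible M (S k) b" and xb: "leq M x b"
  shows "\<exists>a'\<in>I. \<exists>w'\<in>I. enc M b (S k) a' w' (\<lambda>y. X y \<or> y = x)"
proof -
  define m where "m = modulus M b k"
  have mI: "m \<in> I" using I by (simp add: m_def)
  have "copr M w m"
    using e I divisible_mono[OF dv] by (simp add: enc_def m_def)
  then obtain u v where uv: "u \<in> I" "v \<in> I" "w \<otimes> u = S (m \<otimes> v)" unfolding copr_def by blast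
  define l where "l = b \<otimes> S k"
  have l: "l \<in> I" "m = S l" using I by (auto simp: l_def m_def modulus_def)
  define t where "t = u \<otimes> (x \<oplus> l \<otimes> a)"
  define a' where "a' = a \<oplus> w \<otimes> t"
  have tI: "t \<in> I" "a' \<in> I" using I uv l by (auto simp: t_def a'_def)
  have a': "a' = (a \<oplus> v \<otimes> (x \<oplus> l \<otimes> a)) \<otimes> m \<oplus> x"
    unfolding a'_def t_def using crt_identity[of a w u v m x l] uv l I mI by simp
  have less: "leq M (S y) (modulus M b i)" if "y \<in> J" "leq M y b" "i \<in> J" for y i
    using less_modulus that I by simp
  have rem_k: "rem M a' m y \<longleftrightarrow> y = x" if y: "y \<in> J" "leq M y b" for y
  proof -
    have x: "rem M a' m x" unfolding rem_def a' by (rule bexI, rule refl) (use I uv l in simp)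
    then show ?thesis
      using rem_unique[of a' m y x] less[OF y, of k] less[of x k] xb y I mI by (auto simp: m_def)
  qed
  have rem_i: "rem M a' (modulus M b i) y \<longleftrightarrow> rem M a (modulus M b i) y"
    if i: "i \<in> J" "leq M (S i) k" and y: "y \<in> J" "leq M y b" for i y
  proof -
    have iI: "i \<in> I" using I_down_less[of k i] i I by simp
    then obtain c where c: "c \<in> I" "w = c \<otimes> modulus M b i" using e i unfolding enc_def by blast
    have "a' = a \<oplus> c \<otimes> t \<otimes> modulus M b i"
      unfolding a'_def c(2) using c(1) tI iI I by (simp add: J_mult_ac)
    then show ?thesis using rem_shift[of a "modulus M b i" "c \<otimes> t" y] less[OF y i(1)] c(1) tI iI I y by simp
  qed
  have "enc M b (S k) a' (w \<otimes> m) (\<lambda>y. X y \<or> y = x)"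
    unfolding enc_def
  proof (intro conjI ballI impI)
    fix j assume j: "j \<in> I" "leq M (S k) j \<and> divisible M j b"
    have "leq M k j" using j I leq_trans[of k "S k" j] by simp
    then have "copr M w (modulus M b j)" using e j by (simp add: enc_def)
    moreover have "copr M m (modulus M b j)" unfolding m_def using copr_moduli j I by blast
    ultimately show "copr M (w \<otimes> m) (modulus M b j)" using copr_mult j I mI by simp
  next
    fix i assume i: "i \<in> I" "leq M (S i) (S k)"
    then consider "leq M (S i) k" | "i = k" using leq_S_iff[of "S i" k] I by auto
    then show "\<exists>c\<in>I. w \<otimes> m = c \<otimes> modulus M b i"
    proof cases
      case 1
      then obtain c where c: "c \<in> I" "w = c \<otimes> modulus M b i" using e i unfolding enc_def by blast
      then show ?thesis using mI i I by (intro bexI[of _ "c \<otimes> m"]) (simp_all add: J_mult_ac)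
    next
      case 2
      then show ?thesis using I by (auto simp: m_def)
    qed
  next
    fix y assume y: "y \<in> J"
    have X: "X y \<longleftrightarrow> leq M y b \<and> (\<exists>i\<in>J. leq M (S i) k \<and> rem M a (modulus M b i) y)"
      using e y unfolding enc_def by blast
    have lS: "leq M (S i) (S k) \<longleftrightarrow> leq M (S i) k \<or> i = k" if "i \<in> J" for i
      using leq_S_iff[of "S i" k] I that by simp
    show "X y \<or> y = x \<longleftrightarrow>
      leq M y b \<and> (\<exists>i\<in>J. leq M (S i) (S k) \<and> rem M a' (modulus M b i) y)"
    proof (cases "leq M y b")
      case True
      have "(\<exists>i\<in>J. leq M (S i) (S k) \<and> rem M a' (modulus M b i) y) \<longleftrightarrow>
          (\<exists>i\<in>J. leq M (S i) k \<and> rem M a (modulus M b i) y) \<or> rem M a' m y"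
        using lS rem_i y True I_J[OF I(2)] unfolding m_def by blast
      then show ?thesis using X True rem_k[OF y True] by blast
    next
      case False
      then show ?thesis using X xb by blast
    qed
  qed
  then show ?thesis using tI mI I by (intro bexI[of _ a'] bexI[of _ "w \<otimes> m"]) simp_all
qed

text \<open>For \<open>k = 0\<close> the empty product \<open>w = 1\<close> is coprime to
  everything.\<close>

lemma encodable_empty: "encodable M (\<lambda>y. False)"
proof -
  have no: "\<not> leq M (S i) \<zero>" if "i \<in> J" for i using not_S_leq_Z that by simp
  have "\<not> (leq M (S \<zero>) i \<and> leq M i \<zero>)" if "i \<in> I" for i
    using leq_trans[of "S \<zero>" i \<zero>] no[of \<zero>] by auto
  then have dv: "divisible M \<zero> (S \<zero>)" unfolding divisible_def by blast
  have "copr M (S \<zero>) (modulus M b j)" if "b \<in> I" "j \<in> I" for b j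
    unfolding copr_def using that by (intro bexI[of _ "S \<zero>"] bexI[of _ \<zero>]) simp_all
  then have "enc M b \<zero> \<zero> (S \<zero>) (\<lambda>y. False)" if "b \<in> I" for b
    unfolding enc_def using no I_J that by blast
  then show ?thesis
    unfolding encodable_def using dv
    by (intro bexI[of _ \<zero>] conjI bexI[of _ "S \<zero>"] ballI impI) auto
qed

text \<open>A \<open>b\<close> divisible up to \<open>S k\<close> is divisible up to
  \<open>k\<close>, so \<open>X\<close> already has a code modulo this very \<open>b\<close>, which
  \<open>enc_add\<close> extends.\<close>

lemma encodable_add:
  assumes X: "encodable M X" and x: "x \<in> I"
  shows "encodable M (\<lambda>y. X y \<or> y = x)"
proof -
  obtain k b0 where k: "k \<in> I" and b0: "b0 \<in> I" "b0 \<noteq> \<zero>" "divisible M k b0"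
    and enc: "\<And>b. b \<in> I \<Longrightarrow> divisible M k b \<Longrightarrow> (\<forall>y\<in>J. X y \<longrightarrow> leq M y b) \<Longrightarrow> \<exists>a\<in>I. \<exists>w\<in>I. enc M b k a w X"
    using X unfolding encodable_def by blast
  have dk: "divisible M k b" if "divisible M (S k) b" for b
    using divisible_mono[OF that] k by simp
  have "b0 \<otimes> S k \<noteq> \<zero>"
  proof -
    obtain c where "c \<in> U" "b0 = S c" using Q_cases[of b0] b0 by auto
    then show ?thesis using b0 k by simp
  qed
  moreover have "\<exists>a\<in>I. \<exists>w\<in>I. enc M b (S k) a w (\<lambda>y. X y \<or> y = x)"
    if b: "b \<in> I" "divisible M (S k) b" "\<forall>y\<in>J. X y \<or> y = x \<longrightarrow> leq M y b" for b
  proof -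
    obtain a w where "a \<in> I" "w \<in> I" "enc M b k a w X" using enc[OF b(1) dk[OF b(2)]] b(3) by blast
    then show ?thesis using enc_add[of b k a w X x] b x k by simp
  qed
  ultimately show ?thesis
    unfolding encodable_def using divisible_Suc[OF b0(3) k b0(1)] k b0(1)
    by (intro bexI[of _ "S k"] conjI bexI[of _ "b0 \<otimes> S k"]) auto
qed

lemma encodable_code:
  assumes X: "encodable M X" and bound: "c \<in> I" "\<And>y. X y \<Longrightarrow> y \<in> J \<and> leq M y c"
  shows "\<exists>n\<in>I. (\<forall>y. elt M y n \<longleftrightarrow> X y) \<and> (flag M n \<longleftrightarrow> F)"
proof -
  obtain k b0 where k: "k \<in> I" and b0: "b0 \<in> I" "b0 \<noteq> \<zero>" "divisible M k b0"
    and enc: "\<And>b. b \<in> I \<Longrightarrow> divisible M k b \<Longrightarrow> (\<forall>y\<in>J. X y \<longrightarrow> leq M y b) \<Longrightarrow> \<exists>a\<in>I. \<exists>w\<in>I. enc M b k a w X"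
    using X unfolding encodable_def by blast
  \<comment> \<open>\<open>b\<close> has to stay divisible and to bound the set; as
    \<open>b0\<close> is nonzero, this multiple reaches \<open>c\<close>. Zero is divisible by
    everything, hence the clause \<open>b \<noteq> ze M\<close> in \<open>encodable\<close>.\<close>
  define b where "b = b0 \<otimes> S c"
  have b: "b \<in> I" "divisible M k b"
    using b0 bound(1) divisible_mult[of k b0 "S c"] by (simp_all only: b_def I_closed)
  have "leq M (S \<zero>) b0" using leq_cases[of b0 \<zero>] leq_antisym[of b0 \<zero>] b0 by auto
  then obtain e where e: "e \<in> J" "b0 = e \<oplus> S \<zero>" by (auto elim: leqE)
  have "b = e \<otimes> S c \<oplus> S \<zero> \<oplus> c" using e bound(1) by (simp add: b_def J_semiring)
  then have "leq M c b" using leqI[of c "e \<otimes> S c \<oplus> S \<zero>"] e bound(1) by simp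
  then have Xb: "\<forall>y\<in>J. X y \<longrightarrow> leq M y b" using bound leq_trans by blast
  then obtain a w where a: "a \<in> I" "enc M b k a w X" using enc[OF b] by blast
  define f where "f = (if F then S \<zero> else \<zero>)"
  have f: "f \<in> I" "f \<noteq> \<zero> \<longleftrightarrow> F" by (auto simp: f_def)
  have "elt M y (code M a b k f) \<longleftrightarrow> X y" for y
    using a(2) bound(2) elt_code[of a b k f y] a(1) b k f unfolding enc_def by auto
  then show ?thesis
    using flag_code[of a b k f] a(1) b k f code_I by (intro bexI[of _ "code M a b k f"]) auto
qed

end

section \<open>The universe of hereditarily finite or cofinite sets\<close>

definition mem :: "'a arith \<Rightarrow> 'a \<Rightarrow> 'a \<Rightarrow> bool" where
  "mem M z x \<longleftrightarrow> (if flag M x then \<not> elt M z x else elt M z x)"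

definition good :: "'a arith \<Rightarrow> 'a \<Rightarrow> bool" where
  "good M n \<longleftrightarrow> encodable M (\<lambda>y. elt M y n)"

text \<open>\<open>good\<close> codes are only known to be closed under adjunction, \<open>joinable\<close> ones also under
  binary unions, and \<open>separating\<close> ones allow the separations needed for difference and union.\<close>

definition joinable :: "'a arith \<Rightarrow> 'a \<Rightarrow> bool" where
  "joinable M n \<longleftrightarrow> good M n \<and> (\<forall>d\<in>setc M. good M d \<longrightarrow>
     (\<exists>e\<in>setc M. good M e \<and> (\<forall>y\<in>setc M. elt M y e \<longleftrightarrow> elt M y d \<or> elt M y n)))"

text \<open>The result has to be joinable so that the separations of two sets can be united to one
  of their union.\<close>

definition separable :: "'a arith \<Rightarrow> ('a \<Rightarrow> bool) \<Rightarrow> 'a \<Rightarrow> bool" where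
  "separable M P t \<longleftrightarrow>
     (\<exists>e\<in>setc M. joinable M e \<and> (\<forall>z\<in>setc M. elt M z e \<longleftrightarrow> elt M z t \<and> P z))"

definition diffp :: "'a arith \<Rightarrow> 'a \<Rightarrow> 'a \<Rightarrow> 'a \<Rightarrow> bool" where
  "diffp M x y z \<longleftrightarrow> mem M z x \<and> \<not> mem M z y"

text \<open>Meant for a finite \<open>x\<close>, whose members are given by \<open>elt\<close>; the
  union of a cofinite set is the whole universe.\<close>

definition unionp :: "'a arith \<Rightarrow> 'a \<Rightarrow> 'a \<Rightarrow> bool" where
  "unionp M x z \<longleftrightarrow> (\<exists>w\<in>setc M. elt M w x \<and> mem M z w)"

text \<open>The parameters range over all of \<open>setc\<close>, which avoids a circular reference
  to the universe defined from this notion.\<close>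

definition separating :: "'a arith \<Rightarrow> 'a \<Rightarrow> bool" where
  "separating M t \<longleftrightarrow> joinable M t \<and> (\<forall>x\<in>setc M. \<forall>y\<in>setc M.
     separable M (\<lambda>z. diffp M x y z) t \<and> separable M (\<lambda>z. \<not> diffp M x y z) t \<and>
     separable M (\<lambda>z. unionp M x z) t \<and> separable M (\<lambda>z. \<not> unionp M x z) t)"

text \<open>Transitivity is demanded for \<open>elt\<close>, not \<open>mem\<close>: a cofinite set
  is supported through the finite set that it omits.\<close>

definition support :: "'a arith \<Rightarrow> 'a \<Rightarrow> bool" where
  "support M t \<longleftrightarrow> separating M t \<and>
     (\<forall>m\<in>setc M. elt M m t \<longrightarrow> canon M m \<and> (\<forall>z\<in>setc M. elt M z m \<longrightarrow> elt M z t))"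

definition hfc :: "'a arith \<Rightarrow> 'a set" where
  "hfc M = {n \<in> setc M. \<exists>t\<in>setc M. support M t \<and> elt M n t}"

lemma dfm_mem_set [dfb]: "dtm n s \<Longrightarrow> dtm n t \<Longrightarrow> dfm n (\<lambda>M e. mem M (s M e) (t M e))"
  unfolding mem_def by (rule dfb | erule dtm_mono | simp add: dtm_upd)+

lemma dfm_good [dfb]: "dtm n t \<Longrightarrow> dfm n (\<lambda>M e. good M (t M e))"
  unfolding good_def by (rule dfb | erule dtm_mono | simp add: dtm_upd)+

lemma dfm_joinable [dfb]: "dtm n t \<Longrightarrow> dfm n (\<lambda>M e. joinable M (t M e))"
  unfolding joinable_def by (rule dfb | erule dtm_mono | simp add: dtm_upd)+

lemma dfm_separating [dfb]: "dtm n t \<Longrightarrow> dfm n (\<lambda>M e. separating M (t M e))"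
  unfolding separating_def separable_def diffp_def unionp_def
  by (rule dfb | erule dtm_mono | simp add: dtm_upd)+

lemma dfm_support [dfb]: "dtm n t \<Longrightarrow> dfm n (\<lambda>M e. support M (t M e))"
  unfolding support_def by (rule dfb | erule dtm_mono | simp add: dtm_upd)+

lemma dset_hfc [dfb]: "dset hfc"
  unfolding hfc_def
  by (rule dset_Collect) (rule dfb | erule dtm_mono | simp add: dtm_upd)+

context qmodel
begin

section \<open>Adjunction, binary union and separation\<close>

lemma good_empty: "\<exists>n\<in>I. good M n \<and> (\<forall>y. \<not> elt M y n)"
proof -
  obtain n where "n \<in> I" "\<forall>y. \<not> elt M y n"
    using encodable_code[OF encodable_empty, of "\<zero>" False] by auto
  then show ?thesis using encodable_empty by (intro bexI[of _ n]) (simp_all add: good_def)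
qed

lemma good_add:
  assumes "n \<in> I" "good M n" "x \<in> I"
  shows "\<exists>m\<in>I. good M m \<and> (\<forall>y. elt M y m \<longleftrightarrow> elt M y n \<or> y = x)"
proof -
  have X: "encodable M (\<lambda>y. elt M y n \<or> y = x)"
    using encodable_add assms by (simp add: good_def)
  have b: "y \<in> J \<and> leq M y (n \<oplus> x)" if "elt M y n \<or> y = x" for y
    using that
  proof
    assume y: "elt M y n"
    then have "y \<in> J" by (simp add: elt_def)
    moreover have "leq M y n" using elt_less[OF y] leq_trans[of y "S y" n] \<open>y \<in> J\<close> by simp
    ultimately show ?thesis using leq_trans[of y n "n \<oplus> x"] leqI'[of n x] assms by simp
  next
    assume "y = x"
    then show ?thesis using leqI[of x n] assms by simp
  qed
  obtain m where m: "m \<in> I" "\<And>y. elt M y m \<longleftrightarrow> elt M y n \<or> y = x"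
    using encodable_code[OF X _ b, of False] assms by auto
  then show ?thesis using X unfolding good_def by (intro bexI[of _ m]) simp_all
qed

lemma canon_code:
  assumes n: "n \<in> I" "good M n"
  shows "\<exists>r\<in>I. canon M r \<and> (\<forall>y. elt M y r \<longleftrightarrow> elt M y n) \<and> (flag M r \<longleftrightarrow> F)"
proof -
  have b: "y \<in> J \<and> leq M y n" if "elt M y n" for y
  proof -
    have "y \<in> J" using that by (simp add: elt_def)
    then show ?thesis using elt_less[OF that] leq_trans[of y "S y" n] by simp
  qed
  obtain m where m: "m \<in> I" "\<And>y. elt M y m \<longleftrightarrow> elt M y n" "flag M m \<longleftrightarrow> F"
    using encodable_code[OF _ n(1) b] n(2) unfolding good_def by blast
  obtain r where r: "r \<in> I" "same M m r" "canon M r" using canon_exists m(1) by blast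
  then have "elt M y r \<longleftrightarrow> elt M y m" for y
    by (cases "y \<in> J") (auto simp: same_def elt_def)
  then show ?thesis using r m by (intro bexI[of _ r]) (auto simp: same_def)
qed

lemma canon_eq:
  assumes "n \<in> I" "m \<in> I" "canon M n" "canon M m" "flag M n \<longleftrightarrow> flag M m"
    "\<And>y. elt M y n \<longleftrightarrow> elt M y m"
  shows "n = m"
  using assms canon_unique[of n m] by (simp add: same_def)

lemma not_elt_self: "\<not> elt M n n"
  using elt_less[of n n] not_S_leq[of n] by (auto simp: elt_def)

text \<open>Joining \<open>d\<close> first with \<open>n\<close> and then with \<open>m\<close>
  joins it with their union, just as \<open>plusc\<close> is closed under addition.\<close>

lemma joinable_union:
  assumes n: "n \<in> I" "joinable M n" and m: "m \<in> I" "joinable M m"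
  shows "\<exists>e\<in>I. joinable M e \<and> (\<forall>y. elt M y e \<longleftrightarrow> elt M y n \<or> elt M y m)"
proof -
  have join: "\<exists>e\<in>I. good M e \<and> (\<forall>y. elt M y e \<longleftrightarrow> elt M y d \<or> elt M y k)"
    if d: "d \<in> I" "good M d" and k: "k \<in> I" "joinable M k" for d k
  proof -
    obtain e where e: "e \<in> I" "good M e" "\<forall>y\<in>I. elt M y e \<longleftrightarrow> elt M y d \<or> elt M y k"
      using d k unfolding joinable_def by blast
    then have "elt M y e \<longleftrightarrow> elt M y d \<or> elt M y k" for y
      using elt_I d k by (cases "y \<in> I") blast+
    then show ?thesis using e by blast
  qed
  have "good M n" using n by (simp add: joinable_def)
  then obtain e where e: "e \<in> I" "good M e" "\<And>y. elt M y e \<longleftrightarrow> elt M y n \<or> elt M y m"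
    using join[of n m] n m by blast
  have "\<exists>f\<in>I. good M f \<and> (\<forall>y\<in>I. elt M y f \<longleftrightarrow> elt M y d \<or> elt M y e)" if d: "d \<in> I" "good M d" for d
  proof -
    obtain f where f: "f \<in> I" "good M f" "\<And>y. elt M y f \<longleftrightarrow> elt M y d \<or> elt M y n"
      using join[OF d n] by blast
    obtain g where g: "g \<in> I" "good M g" "\<And>y. elt M y g \<longleftrightarrow> elt M y f \<or> elt M y m"
      using join[OF f(1,2) m] by blast
    then show ?thesis using e f by (intro bexI[of _ g]) auto
  qed
  then show ?thesis using e unfolding joinable_def by blast
qed

lemma joinable_empty: "\<exists>n\<in>I. joinable M n \<and> (\<forall>y. \<not> elt M y n)"
proof -
  obtain n where n: "n \<in> I" "good M n" "\<And>y. \<not> elt M y n" using good_empty by blast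
  then have "joinable M n" unfolding joinable_def by auto
  then show ?thesis using n by blast
qed

text \<open>Joining with a singleton is adjunction, under which good codes are closed.\<close>

lemma joinable_single:
  assumes x: "x \<in> I"
  shows "\<exists>n\<in>I. joinable M n \<and> (\<forall>y. elt M y n \<longleftrightarrow> y = x)"
proof -
  obtain o' where o: "o' \<in> I" "good M o'" "\<And>y. \<not> elt M y o'" using good_empty by blast
  obtain n where n: "n \<in> I" "good M n" "\<And>y. elt M y n \<longleftrightarrow> y = x"
    using good_add[OF o(1,2) x] o(3) by blast
  then have "joinable M n" using good_add x unfolding joinable_def by (metis (no_types, lifting))
  then show ?thesis using n by blast
qed

lemma separableE:
  assumes "separable M P t" "t \<in> I"
  obtains e where "e \<in> I" "joinable M e" "\<And>z. elt M z e \<longleftrightarrow> elt M z t \<and> P z"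
proof -
  obtain e where e: "e \<in> I" "joinable M e" "\<forall>z\<in>I. elt M z e \<longleftrightarrow> elt M z t \<and> P z"
    using assms unfolding separable_def by blast
  then have "elt M z e \<longleftrightarrow> elt M z t \<and> P z" for z
    using elt_I assms(2) by (cases "z \<in> I") blast+
  then show thesis using that e by blast
qed

lemma separable_union:
  assumes "separable M P t" "separable M P s" "t \<in> I" "s \<in> I"
    "\<And>y. elt M y u \<longleftrightarrow> elt M y t \<or> elt M y s"
  shows "separable M P u"
proof -
  obtain e where e: "e \<in> I" "joinable M e" "\<And>z. elt M z e \<longleftrightarrow> elt M z t \<and> P z"
    using separableE assms by blast
  obtain f where f: "f \<in> I" "joinable M f" "\<And>z. elt M z f \<longleftrightarrow> elt M z s \<and> P z"
    using separableE assms by blast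
  show ?thesis
    unfolding separable_def using joinable_union[OF e(1,2) f(1,2)] e(3) f(3) assms(5) by auto
qed

lemma separable_empty: "(\<And>y. \<not> elt M y t) \<Longrightarrow> separable M P t"
  using joinable_empty unfolding separable_def by auto

lemma separable_single:
  assumes "x \<in> I" "\<And>y. elt M y t \<longleftrightarrow> y = x"
  shows "separable M P t"
proof (cases "P x")
  case True
  then show ?thesis using joinable_single[OF assms(1)] assms(2) unfolding separable_def by auto
next
  case False
  then show ?thesis using joinable_empty assms(2) unfolding separable_def by auto
qed

lemma separating_union:
  assumes t: "t \<in> I" "separating M t" and s: "s \<in> I" "separating M s"
  shows "\<exists>u\<in>I. separating M u \<and> (\<forall>y. elt M y u \<longleftrightarrow> elt M y t \<or> elt M y s)"
proof -
  obtain u where u: "u \<in> I" "joinable M u" "\<And>y. elt M y u \<longleftrightarrow> elt M y t \<or> elt M y s"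
    using joinable_union[of t s] t s unfolding separating_def by blast
  then have "separating M u"
    using t s separable_union[OF _ _ t(1) s(1) u(3)] unfolding separating_def by blast
  then show ?thesis using u by blast
qed

lemma separating_empty: "\<exists>t\<in>I. separating M t \<and> (\<forall>y. \<not> elt M y t)"
  using joinable_empty separable_empty unfolding separating_def by blast

lemma separating_single: "x \<in> I \<Longrightarrow> \<exists>t\<in>I. separating M t \<and> (\<forall>y. elt M y t \<longleftrightarrow> y = x)"
  using joinable_single[of x] separable_single[of x] unfolding separating_def by blast

section \<open>Supports and the formation of new sets\<close>

lemma supportD:
  assumes "support M t" "t \<in> I" "elt M m t"
  shows "m \<in> I" "canon M m" "elt M z m \<Longrightarrow> elt M z t"
  using assms elt_I unfolding support_def by blast+

lemma support_joint:
  assumes t: "t \<in> I" "support M t" and s: "s \<in> I" "support M s"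
  shows "\<exists>u\<in>I. support M u \<and> (\<forall>y. elt M y t \<or> elt M y s \<longrightarrow> elt M y u)"
proof -
  obtain u where u: "u \<in> I" "separating M u" "\<And>y. elt M y u \<longleftrightarrow> elt M y t \<or> elt M y s"
    using separating_union[of t s] t s unfolding support_def by blast
  then have "support M u"
    using supportD[OF t(2,1)] supportD[OF s(2,1)] unfolding support_def by blast
  then show ?thesis using u by blast
qed

lemma hfc_support: "x \<in> hfc M \<Longrightarrow> \<exists>t\<in>I. support M t \<and> elt M x t"
  by (auto simp: hfc_def)

lemma hfc_joint:
  assumes "x \<in> hfc M" "y \<in> hfc M"
  shows "\<exists>t\<in>I. support M t \<and> elt M x t \<and> elt M y t"
  using assms support_joint hfc_support by meson

lemma hfcI: "support M t \<Longrightarrow> t \<in> I \<Longrightarrow> elt M x t \<Longrightarrow> x \<in> hfc M"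
  using elt_I by (auto simp: hfc_def)

lemma hfcD:
  assumes "x \<in> hfc M"
  shows "x \<in> I" "canon M x" "elt M y x \<Longrightarrow> y \<in> hfc M"
  using assms hfc_support supportD hfcI by blast+

text \<open>The support of \<open>r\<close> is \<open>t\<close> with \<open>r\<close> adjoined. It
  is transitive because the elements of \<open>r\<close> lie in \<open>t\<close>; this concerns
  \<open>elt\<close> only, so \<open>F\<close> may be chosen freely.\<close>

lemma new_set:
  assumes t: "t \<in> I" "support M t" and n: "n \<in> I" "good M n" "\<And>y. elt M y n \<Longrightarrow> elt M y t"
  shows "\<exists>r\<in>hfc M. (\<forall>y. elt M y r \<longleftrightarrow> elt M y n) \<and> (flag M r \<longleftrightarrow> F)"
proof -
  obtain r where r: "r \<in> I" "canon M r" "\<And>y. elt M y r \<longleftrightarrow> elt M y n" "flag M r \<longleftrightarrow> F"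
    using canon_code[OF n(1,2)] by blast
  obtain s where s: "s \<in> I" "separating M s" "\<And>y. elt M y s \<longleftrightarrow> y = r"
    using separating_single[OF r(1)] by blast
  obtain u where u: "u \<in> I" "separating M u" "\<And>y. elt M y u \<longleftrightarrow> elt M y t \<or> elt M y s"
    using separating_union[of t s] t s unfolding support_def by blast
  have "support M u"
    unfolding support_def
  proof (intro conjI ballI impI)
    fix m assume "elt M m u"
    then have m: "elt M m t \<or> m = r" using u(3) s(3) by simp
    then show "canon M m" using supportD(2)[OF t(2,1)] r(2) by blast
    show "elt M z u" if "elt M z m" for z
      using m supportD(3)[OF t(2,1)] r(3) n(3) u(3) that by blast
  qed (rule u(2))
  then have "r \<in> hfc M" using hfcI[of u r] u s by simp
  then show ?thesis using r by blast
qed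

lemma support_empty: "\<exists>t\<in>I. support M t \<and> (\<forall>y. \<not> elt M y t)"
  using separating_empty unfolding support_def by blast

lemma support_good: "support M t \<Longrightarrow> good M t"
  by (simp add: support_def separating_def joinable_def)

section \<open>The axioms in the universe\<close>

lemma universal_set: "\<exists>v\<in>hfc M. \<forall>x. mem M x v"
proof -
  obtain t where t: "t \<in> I" "support M t" "\<And>y. \<not> elt M y t" using support_empty by blast
  have "\<exists>r\<in>hfc M. (\<forall>y. elt M y r \<longleftrightarrow> elt M y t) \<and> (flag M r \<longleftrightarrow> True)"
    by (rule new_set[OF t(1,2,1) support_good[OF t(2)]])
  then show ?thesis using t(3) unfolding mem_def by metis
qed

lemma empty_set: "\<exists>v\<in>hfc M. \<forall>x. \<not> mem M x v"
proof -
  obtain t where t: "t \<in> I" "support M t" "\<And>y. \<not> elt M y t" using support_empty by blast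
  have "\<exists>r\<in>hfc M. (\<forall>y. elt M y r \<longleftrightarrow> elt M y t) \<and> (flag M r \<longleftrightarrow> False)"
    by (rule new_set[OF t(1,2,1) support_good[OF t(2)]])
  then show ?thesis using t(3) unfolding mem_def by metis
qed

text \<open>\<open>r\<close> is \<open>t\<close> copied as a set; if it belonged to
  \<open>t\<close>, it would be an element of itself. So no support exhausts the universe.\<close>

lemma outside:
  assumes "t \<in> I" "support M t"
  shows "\<exists>r\<in>hfc M. \<not> elt M r t \<and> \<not> flag M r \<and> (\<forall>y. elt M y r \<longleftrightarrow> elt M y t)"
  using new_set[OF assms, of t False] support_good assms not_elt_self by blast

lemma extensionality:
  assumes x: "x \<in> hfc M" and y: "y \<in> hfc M" and e: "\<And>z. z \<in> hfc M \<Longrightarrow> mem M z x \<longleftrightarrow> mem M z y"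
  shows "x = y"
proof (cases "flag M x \<longleftrightarrow> flag M y")
  case True
  \<comment> \<open>The universe is transitive for \<open>elt\<close>, so agreement on its members
    decides all elements.\<close>
  have "elt M z x \<longleftrightarrow> elt M z y" for z
    using e[of z] True hfcD(3)[OF x] hfcD(3)[OF y] unfolding mem_def by metis
  then show ?thesis using canon_eq hfcD[OF x] hfcD[OF y] True by blast
next
  case False
  \<comment> \<open>A finite and a cofinite set disagree at any set outside a common
    support.\<close>
  obtain t where t: "t \<in> I" "support M t" "elt M x t" "elt M y t" using hfc_joint[OF x y] by blast
  obtain r where r: "r \<in> hfc M" "\<not> elt M r t" using outside t by blast
  have "\<not> elt M r x" "\<not> elt M r y" using r supportD(3)[OF t(2,1)] t by blast+
  then show ?thesis using e[OF r(1)] False by (auto simp: mem_def)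
qed

lemma pairing:
  assumes x: "x \<in> hfc M" and y: "y \<in> hfc M"
  shows "\<exists>p\<in>hfc M. \<forall>z. mem M z p \<longleftrightarrow> z = x \<or> z = y"
proof -
  obtain t where t: "t \<in> I" "support M t" "elt M x t" "elt M y t" using hfc_joint[OF x y] by blast
  obtain n where n: "n \<in> I" "good M n" "\<And>z. \<not> elt M z n" using good_empty by blast
  obtain m where m: "m \<in> I" "good M m" "\<And>z. elt M z m \<longleftrightarrow> z = x"
    using good_add[OF n(1,2) hfcD(1)[OF x]] n(3) by blast
  obtain p where p: "p \<in> I" "good M p" "\<And>z. elt M z p \<longleftrightarrow> z = x \<or> z = y"
    using good_add[OF m(1,2) hfcD(1)[OF y]] m(3) by blast
  have "\<exists>r\<in>hfc M. (\<forall>z. elt M z r \<longleftrightarrow> elt M z p) \<and> (flag M r \<longleftrightarrow> False)"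
    by (rule new_set[OF t(1,2) p(1,2)]) (use p(3) t(3,4) in auto)
  then show ?thesis using p(3) unfolding mem_def by metis
qed

lemma new_from_separable:
  assumes t: "t \<in> I" "support M t" and s: "separable M P t"
  shows "\<exists>r\<in>hfc M. (\<forall>z. elt M z r \<longleftrightarrow> elt M z t \<and> P z) \<and> (flag M r \<longleftrightarrow> F)"
proof -
  obtain e where e: "e \<in> I" "joinable M e" "\<And>z. elt M z e \<longleftrightarrow> elt M z t \<and> P z"
    using separableE[OF s t(1)] by blast
  then show ?thesis using new_set[OF t, of e F] by (simp add: joinable_def)
qed

lemma finite_or_cofinite:
  assumes t: "t \<in> I" "support M t" and s: "separable M P t" "separable M (\<lambda>z. \<not> P z) t"
    and P: "(\<forall>z. P z \<longrightarrow> elt M z t) \<or> (\<forall>z. \<not> P z \<longrightarrow> elt M z t)"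
  shows "\<exists>r\<in>hfc M. \<forall>z. mem M z r \<longleftrightarrow> P z"
  using P
proof
  assume "\<forall>z. P z \<longrightarrow> elt M z t"
  then show ?thesis
    using new_from_separable[OF t s(1), of False] unfolding mem_def by (metis (full_types))
next
  assume "\<forall>z. \<not> P z \<longrightarrow> elt M z t"
  then show ?thesis
    using new_from_separable[OF t s(2), of True] unfolding mem_def by (metis (full_types))
qed

lemma set_difference:
  assumes x: "x \<in> hfc M" and y: "y \<in> hfc M"
  shows "\<exists>d\<in>hfc M. \<forall>z. mem M z d \<longleftrightarrow> mem M z x \<and> \<not> mem M z y"
proof -
  obtain t where t: "t \<in> I" "support M t" "elt M x t" "elt M y t" using hfc_joint[OF x y] by blast
  have s: "separable M (\<lambda>z. diffp M x y z) t" "separable M (\<lambda>z. \<not> diffp M x y z) t"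
    using t(2) hfcD(1)[OF x] hfcD(1)[OF y] unfolding support_def separating_def by blast+
  \<comment> \<open>Only for \<open>x\<close> cofinite and \<open>y\<close> finite is the difference
    cofinite; its complement then lies in \<open>t\<close>. In the other cases the difference
    does.\<close>
  have "(\<forall>z. diffp M x y z \<longrightarrow> elt M z t) \<or> (\<forall>z. \<not> diffp M x y z \<longrightarrow> elt M z t)"
    using supportD(3)[OF t(2,1,3)] supportD(3)[OF t(2,1,4)] unfolding diffp_def mem_def
    by (cases "flag M x"; cases "flag M y") auto
  then show ?thesis using finite_or_cofinite[OF t(1,2) s] by (simp add: diffp_def)
qed

lemma union:
  assumes x: "x \<in> hfc M"
  shows "\<exists>u\<in>hfc M. \<forall>z\<in>hfc M. mem M z u \<longleftrightarrow> (\<exists>w\<in>hfc M. mem M w x \<and> mem M z w)"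
proof (cases "flag M x")
  case True
  \<comment> \<open>A copy \<open>r\<close> of a support containing \<open>x\<close> and
    \<open>z\<close> has \<open>z\<close> as an element and is not among the sets omitted by
    \<open>x\<close>, so every \<open>z\<close> is in the union.\<close>
  have "\<exists>w\<in>hfc M. mem M w x \<and> mem M z w" if z: "z \<in> hfc M" for z
  proof -
    obtain t where t: "t \<in> I" "support M t" "elt M x t" "elt M z t" using hfc_joint[OF x z] by blast
    then obtain r where r: "r \<in> hfc M" "\<not> elt M r t" "\<not> flag M r" "elt M z r" using outside by blast
    then have "\<not> elt M r x" using supportD(3)[OF t(2,1,3)] by blast
    then show ?thesis using r True by (auto simp: mem_def)
  qed
  then show ?thesis using universal_set by blast
next
  case False
  obtain t where t: "t \<in> I" "support M t" "elt M x t" using hfc_support[OF x] by blast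
  have s: "separable M (\<lambda>z. unionp M x z) t" "separable M (\<lambda>z. \<not> unionp M x z) t"
    using t(2) hfcD(1)[OF x] unfolding support_def separating_def by blast+
  have tt: "elt M z t" if "elt M w x" "elt M z w" for w z
    using that supportD(3)[OF t(2,1)] t(3) by blast
  \<comment> \<open>A cofinite member of \<open>x\<close> makes the union cofinite, with complement
    inside what that member omits; without one, the union lies in \<open>t\<close>.\<close>
  have "(\<forall>z. unionp M x z \<longrightarrow> elt M z t) \<or> (\<forall>z. \<not> unionp M x z \<longrightarrow> elt M z t)"
  proof (cases "\<exists>w\<in>I. elt M w x \<and> flag M w")
    case True
    then show ?thesis using tt unfolding unionp_def mem_def by meson
  next
    case False
    then show ?thesis using tt unfolding unionp_def mem_def by meson
  qed
  then obtain u where u: "u \<in> hfc M" "\<And>z. mem M z u \<longleftrightarrow> unionp M x z"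
    using finite_or_cofinite[OF t(1,2) s] by blast
  have "unionp M x z \<longleftrightarrow> (\<exists>w\<in>hfc M. mem M w x \<and> mem M z w)" for z
  proof -
    have "mem M w x \<longleftrightarrow> elt M w x" for w using False by (simp add: mem_def)
    then show ?thesis using hfcD(3)[OF x] hfcD(1) unfolding unionp_def by blast
  qed
  then show ?thesis using u by blast
qed

end

section \<open>The interpretation\<close>

text \<open>With equality interpreted as identity the quotient is a copy of \<open>D\<close> by
  singletons.\<close>

lemma quot_struct_id:
  assumes D: "int_dom M I = D" and E: "int_eq M I = Id_on D"
  shows "univ (quot_struct M I) = (\<lambda>a. {a}) ` D"
    and "rl (quot_struct M I) r [{a}, {b}] \<longleftrightarrow> holds M (i_rel I (r, 2)) [a, b]"
proof -
  show "univ (quot_struct M I) = (\<lambda>a. {a}) ` D"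
    by (auto simp: quot_struct_def D E quotient_def)
  have "list_all2 (\<in>) as [{a}, {b}] \<longleftrightarrow> as = [a, b]" for as
    by (auto simp: list_all2_Cons2)
  then show "rl (quot_struct M I) r [{a}, {b}] \<longleftrightarrow> holds M (i_rel I (r, 2)) [a, b]"
    by (simp add: quot_struct_def numeral_2_eq_2)
qed

lemma sat_collection:
  fixes N :: "('a, unit, set_sym) struct"
  assumes v: "v \<in> univ N" "\<And>a. a \<in> univ N \<Longrightarrow> rl N MemS [a, v]"
    and d: "distinct [x, y, a, b]" "b \<notin> fv p"
  shows "sat N e (collection_ax p x y a b)"
proof -
  have Ex: "sat N e (Imp A (Ex b B))" if "sat N e A \<Longrightarrow> sat N (e(b := v)) B" for A B
    using that v(1) by auto
  \<comment> \<open>Assigning \<open>v\<close> to \<open>b\<close> must not disturb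
    \<open>p\<close>; this is where \<open>b\<close> not being free in \<open>p\<close>
    enters.\<close>
  have "sat N (e(b := v, x := c, y := w)) p \<longleftrightarrow> sat N (e(x := c, y := w)) p" for c w
    by (rule sat_cong) (use d in auto)
  then show ?thesis
    unfolding collection_ax_def by (intro Ex) (use v(2) d in auto)
qed

theorem theorem3p3:
  shows "interprets TYPE('a) lang_arith Robinson_Q lang_set (S0 \<union> Coll)"
proof -
  \<comment> \<open>Both formulas are fixed before a model is chosen; for this uniformity all
    notions carry \<open>M\<close> as an argument.\<close>
  have "dfm 1 (\<lambda>(M :: 'a arith) e. e 0 \<in> hfc M)"
    by (rule dfb | simp)+
  then obtain pd where pd: "wf_fm lang_arith pd" "fv pd \<subseteq> {..<1}"
    "\<And>(M :: 'a arith) e. sat M e pd \<longleftrightarrow> e 0 \<in> hfc M"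
    unfolding dfm_def by blast
  have "dfm 2 (\<lambda>(M :: 'a arith) e. mem M (e 0) (e 1))"
    by (rule dfb | simp)+
  then obtain pm where pm: "wf_fm lang_arith pm" "fv pm \<subseteq> {..<2}"
    "\<And>(M :: 'a arith) e. sat M e pm \<longleftrightarrow> mem M (e 0) (e 1)"
    unfolding dfm_def by blast
  define I :: "(arith_sym, unit, unit, set_sym) interp" where
    "I = \<lparr> i_dom = pd, i_eq = Eq (Var 0) (Var 1), i_rel = (\<lambda>_. pm), i_fun = (\<lambda>_. pd) \<rparr>"
  have "defines_quotient lang_set M I \<and> is_model lang_set (S0 \<union> Coll) (quot_struct M I)"
    if "is_model lang_arith Robinson_Q M" for M :: "'a arith"
  proof -
    interpret qmodel M using that by unfold_locales
    have dom: "int_dom M I = hfc M"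
      using hfcD(1) I_J J_U by (auto simp: int_dom_def holds_def I_def pd)
    have eq: "int_eq M I = Id_on (hfc M)"
      by (auto simp: int_eq_def dom) (auto simp: holds_def I_def)
    have ne: "hfc M \<noteq> {}" using empty_set by blast
    have "as = bs" if "list_all2 (\<lambda>a b. (a, b) \<in> Id_on (hfc M)) as bs" for as bs
      using that by (induction rule: list_all2_induct) auto
    then have dq: "defines_quotient lang_set M I"
      unfolding defines_quotient_def dom eq
      using ne by (auto simp: lang_set_def equiv_def refl_on_def sym_def trans_def)
    define N where "N = quot_struct M I"
    have U: "univ N = (\<lambda>a. {a}) ` hfc M"
      unfolding N_def by (rule quot_struct_id[OF dom eq])
    have R: "rl N MemS [{a}, {b}] \<longleftrightarrow> mem M a b" for a b
      unfolding N_def quot_struct_id(2)[OF dom eq] by (simp add: holds_def I_def pm)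
    have "sat N e p" if p: "p \<in> S0 \<union> Coll" and e: "range e \<subseteq> univ N" for p e
      using p
    proof
      assume p: "p \<in> S0"
      have "\<forall>i. \<exists>a\<in>hfc M. e i = {a}" using e U by (simp add: image_subset_iff image_iff)
      then obtain c where c: "\<And>i. c i \<in> hfc M" "e = (\<lambda>i. {c i})" by (metis ext)
      have "sat N e extensionality_ax"
        unfolding extensionality_ax_def c(2) using extensionality[OF c(1) c(1)] by (auto simp: U R)
      moreover have "sat N e empty_set_ax"
        unfolding empty_set_ax_def by (simp add: U R) (use empty_set in blast)
      moreover have "sat N e pairing_ax"
      proof -
        obtain d where "d \<in> hfc M" "\<And>z. mem M z d \<longleftrightarrow> z = c 0 \<or> z = c 1"
          using pairing[OF c(1)[of 0] c(1)[of 1]] by blast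
        then show ?thesis unfolding pairing_ax_def c(2) by (simp add: U R) (rule bexI[of _ d]; auto)
      qed
      moreover have "sat N e set_difference_ax"
      proof -
        obtain d where "d \<in> hfc M" "\<And>z. mem M z d \<longleftrightarrow> mem M z (c 0) \<and> \<not> mem M z (c 1)"
          using set_difference[OF c(1)[of 0] c(1)[of 1]] by blast
        then show ?thesis unfolding set_difference_ax_def c(2) by (simp add: U R) (rule bexI[of _ d]; auto)
      qed
      moreover have "sat N e union_ax"
      proof -
        obtain d where "d \<in> hfc M"
          "\<And>z. z \<in> hfc M \<Longrightarrow> mem M z d \<longleftrightarrow> (\<exists>w\<in>hfc M. mem M w (c 0) \<and> mem M z w)"
          using union[OF c(1)[of 0]] by blast
        then show ?thesis unfolding union_ax_def c(2) by (simp add: U R) (rule bexI[of _ d]; auto)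
      qed
      ultimately show ?thesis using p by (auto simp: S0_def)
    next
      assume "p \<in> Coll"
      then obtain q x y a b where q: "p = collection_ax q x y a b" "distinct [x, y, a, b]" "b \<notin> fv q"
        by (auto simp: Coll_def)
      obtain v where "v \<in> hfc M" "\<And>x. mem M x v" using universal_set by blast
      then show ?thesis
        unfolding q(1) by (intro sat_collection[of "{v}"] q(2,3)) (auto simp: U R)
    qed
    moreover have "is_struct lang_set N"
      using ne by (auto simp: is_struct_def lang_set_def U)
    ultimately show ?thesis using dq by (simp add: is_model_def N_def)
  qed
  moreover have "wf_interp lang_arith lang_set I"
    using pd pm by (auto simp: wf_interp_def I_def lang_set_def)
  ultimately show ?thesis
    unfolding interprets_def is_interpretation_def by blast
qed

end
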